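(* There exist an absolute constant $C\ge1$ and a fixed non-negative smooth function $w_0:\mathbb{R}\to\mathbb{R}$ supported in $[1/2,2]$ such that the following holds for all sufficiently large $T$. If $\rho_0=\beta_0+i\gamma_0$ is a half-isolated zero of $\zeta(s)$ with $\gamma_0\in[T,2T]$, then there exists a real number $Y\in[T^{(\log\log T)^3/\log T},\,T^{5/\log\log T}]$ such that \[ \Bigl|\sum_{n\ge1}\frac{\Lambda(n)}{n^{\rho_0}}w_0(n/Y)\Bigr|\ge(\log T)^{-C}. \]
   Context: $\Lambda$ is the von Mangoldt function and $\zeta(s)$ the Riemann zeta function. Given real $Y>1$, a zero $\rho_0=\beta_0+i\gamma_0$ of $\zeta(s)$ is called $Y$-half-isolated if every zero $\rho'=\beta'+i\gamma'$ of $\zeta(s)$ with $|\rho'-\rho_0|\le(\log|\gamma_0|)^2$ satisfies at least one of: (1) $|\beta'-\beta_0|\le\frac{1}{10\log Y}$ and $\gamma'\ge\gamma_0$; or (2) $\beta'\le\beta_0-\frac{(\log\log|\gamma_0|)^2}{\log Y}$. A zero $\rho_0=\beta_0+i\gamma_0$ is called half-isolated if it is $Y$-half-isolated for some $Y$ with $(\log\log|\gamma_0|)^3\le\log Y\le\frac{\log|\gamma_0|}{\log\log|\gamma_0|}$. *)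

theory Defs
  imports "HOL-Complex_Analysis.Complex_Analysis" "HOL-Number_Theory.Prime_Powers"
begin

section \<open>The Riemann zeta function\<close>

text \<open>
  The zeta function is the analytic continuation to the complex plane without \<open>1\<close> of the
  Dirichlet series with all coefficients \<open>1\<close>. The value at the pole is a dummy value, so that
  the description is unique.
\<close>

definition is_zeta :: "(complex \<Rightarrow> complex) \<Rightarrow> bool" where
  "is_zeta f \<longleftrightarrow>
     f holomorphic_on - {1} \<and>
     (\<forall>s. Re s > 1 \<longrightarrow> (\<lambda>n. 1 / of_nat (Suc n) powr s) sums f s) \<and>
     f 1 = 0"

definition zeta :: "complex \<Rightarrow> complex" where
  "zeta = (THE f. is_zeta f)"

text \<open>
  The description above is shown to be proper. For existence, \<open>(s - 1) * zeta s\<close> is continued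
  from one half-plane to the next by expanding \<open>(n + 1) powr (1 - s)\<close> around \<open>n\<close> with
  Taylor's theorem and summing over \<open>n\<close>.
\<close>

lemma norm_of_nat_Suc_powr: "norm (of_nat (Suc n) powr s :: complex) = real (Suc n) powr Re s"
  by (subst norm_powr_real_powr) auto

lemma zeta_series_summable:
  assumes "Re s > 1"
  shows "summable (\<lambda>n. of_nat (Suc n) powr (- s) :: complex)"
proof (rule summable_norm_cancel)
  have "summable (\<lambda>n. of_nat n powr (- Re s) :: real)"
    using assms by (subst summable_real_powr_iff) auto
  then have "summable (\<lambda>n. of_nat (Suc n) powr (- Re s) :: real)"
    by (subst summable_Suc_iff)
  then show "summable (\<lambda>n. norm (of_nat (Suc n) powr (- s) :: complex))"
    by (simp only: norm_of_nat_Suc_powr uminus_complex.sel)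
qed

definition zeta_series :: "complex \<Rightarrow> complex" where
  "zeta_series s = (\<Sum>n. of_nat (Suc n) powr (- s))"

lemma zeta_series_sums:
  "Re s > 1 \<Longrightarrow> (\<lambda>n. of_nat (Suc n) powr (- s)) sums zeta_series s"
  unfolding zeta_series_def by (intro summable_sums zeta_series_summable)

definition zeta_coeff :: "nat \<Rightarrow> complex \<Rightarrow> complex" where
  "zeta_coeff k s = (\<Prod>j<k. 1 - s - of_nat j)"

definition zeta_rem :: "nat \<Rightarrow> nat \<Rightarrow> complex \<Rightarrow> complex" where
  "zeta_rem M n s = of_nat (Suc (Suc n)) powr (1 - s) -
     (\<Sum>k\<le>M. zeta_coeff k s * of_nat (Suc n) powr (1 - s - of_nat k) / fact k)"

lemma zeta_coeff_holomorphic [holomorphic_intros]: "zeta_coeff k holomorphic_on A"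
  unfolding zeta_coeff_def [abs_def] by (intro holomorphic_intros)

lemma zeta_rem_holomorphic: "zeta_rem M n holomorphic_on A"
  unfolding zeta_rem_def [abs_def] 
  by (intro holomorphic_intros) (auto simp del: of_nat_Suc)

lemma zeta_rem_bound:
  assumes "Re s + real M \<ge> 0"
  shows "norm (zeta_rem M n s) \<le> norm (zeta_coeff (Suc M) s) * real (Suc n) powr (- Re s - real M) / fact M"
proof -
  define S where "S = closed_segment (of_nat (Suc n)) (of_nat (Suc (Suc n)) :: complex)"
  define f where "f i z = zeta_coeff i s * z powr (1 - s - of_nat i)" for i and z :: complex
  define B where "B = norm (zeta_coeff (Suc M) s) * real (Suc n) powr (- Re s - real M)"
  have S: "\<exists>t. z = of_real t \<and> t \<ge> real (Suc n)" if "z \<in> S" for z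
  proof -
    from that obtain u where u: "0 \<le> u" "u \<le> 1"
      and z: "z = (1 - u) *\<^sub>R of_nat (Suc n) + u *\<^sub>R of_nat (Suc (Suc n))"
      by (auto simp: S_def closed_segment_def)
    have "z = of_real (real (Suc n) + u)"
      by (simp add: z algebra_simps scaleR_conv_of_real)
    with u show ?thesis by (intro exI [of _ "real (Suc n) + u"]) auto
  qed
  have "norm (f 0 (of_nat (Suc (Suc n))) -
          (\<Sum>i\<le>M. f i (of_nat (Suc n)) * (of_nat (Suc (Suc n)) - of_nat (Suc n)) ^ i / fact i))
        \<le> B * norm (of_nat (Suc (Suc n)) - of_nat (Suc n) :: complex) ^ Suc M / fact M"
  proof (rule complex_Taylor [of S])
    fix i z assume "z \<in> S"
    then obtain t where t: "z = of_real t" "t \<ge> real (Suc n)" using S by blast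
    then have nz: "z \<notin> \<real>\<^sub>\<le>\<^sub>0" by auto
    have "(f i has_field_derivative
            zeta_coeff i s * ((1 - s - of_nat i) * z powr (1 - s - of_nat i - 1))) (at z within S)"
      unfolding f_def [abs_def]
      by (intro DERIV_cmult has_field_derivative_at_within [OF has_field_derivative_powr] nz)
    also have "zeta_coeff i s * ((1 - s - of_nat i) * z powr (1 - s - of_nat i - 1)) = f (Suc i) z"
      by (simp add: f_def zeta_coeff_def algebra_simps)
    finally show "(f i has_field_derivative f (Suc i) z) (at z within S)" .
  next
    fix z assume "z \<in> S"
    then obtain t where t: "z = of_real t" "t \<ge> real (Suc n)" using S by blast
    have "norm (z powr (1 - s - of_nat (Suc M))) = t powr (- Re s - real M)"
      using t by (subst norm_powr_real_powr) auto
    also have "\<dots> \<le> real (Suc n) powr (- Re s - real M)"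
      using t assms by (intro powr_mono2') auto
    finally show "norm (f (Suc M) z) \<le> B"
      unfolding f_def B_def norm_mult by (intro mult_left_mono) auto
  qed (auto simp: S_def)
  then show ?thesis
    by (simp add: f_def zeta_rem_def B_def zeta_coeff_def [of 0])
qed

lemma zeta_rem_series:
  obtains G where "G holomorphic_on {s. Re s > 1 - real M}"
    "\<And>s. Re s > 1 - real M \<Longrightarrow> (\<lambda>n. zeta_rem M n s) sums G s"
proof -
  define S where "S = {s. Re s > 1 - real M}"
  have opn: "open S" unfolding S_def by (rule open_halfspace_Re_gt)
  obtain G where G: "\<forall>s\<in>S. (\<lambda>n. zeta_rem M n s) sums G s \<and> G field_differentiable (at s)"
  proof (rule series_differentiable_comparison_complex [OF opn])
    fix n s assume "s \<in> S"
    then show "zeta_rem M n field_differentiable (at s)"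
      using zeta_rem_holomorphic [of M n UNIV] by (simp add: holomorphic_on_def)
  next
    fix s0 assume "s0 \<in> S"
    define d where "d = (Re s0 - 1 + real M) / 2"
    have d: "d > 0" using \<open>s0 \<in> S\<close> by (simp add: d_def S_def)
    have "compact (zeta_coeff (Suc M) ` cball s0 d)"
      by (intro compact_continuous_image holomorphic_on_imp_continuous_on
            zeta_coeff_holomorphic compact_cball)
    then have "bounded (zeta_coeff (Suc M) ` cball s0 d)"
      by (rule compact_imp_bounded)
    then obtain K where K: "K > 0" "\<And>s. s \<in> cball s0 d \<Longrightarrow> norm (zeta_coeff (Suc M) s) \<le> K"
      unfolding bounded_pos by auto
    define h where "h n = complex_of_real (K * real (Suc n) powr (- (1 + d)) / fact M)" for n
    have h: "norm (h n) = K * real (Suc n) powr (- (1 + d)) / fact M" for n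
      using K by (simp add: h_def norm_mult norm_divide del: of_nat_Suc)
    have "summable (\<lambda>n. of_nat n powr (- (1 + d)) :: real)"
      using d by (subst summable_real_powr_iff) auto
    then have "summable (\<lambda>n. real (Suc n) powr (- (1 + d)))"
      by (subst summable_Suc_iff)
    then have "summable h"
      unfolding h_def by (intro summable_of_real summable_divide summable_mult)
    moreover have "range h \<subseteq> \<real>\<^sub>\<ge>\<^sub>0"
      using K unfolding h_def
      by (intro image_subsetI iffD2 [OF nonneg_Reals_of_real_iff] divide_nonneg_nonneg mult_nonneg_nonneg) auto
    moreover have "norm (zeta_rem M n s) \<le> norm (h n)" if s: "s \<in> ball s0 d \<inter> S" for n s
    proof -
      have "\<bar>Re (s0 - s)\<bar> < d"
        using s abs_Re_le_cmod [of "s0 - s"] by (auto simp: dist_norm)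
      then have re: "Re s + real M \<ge> 1 + d" by (auto simp: d_def field_simps abs_if split: if_splits)
      have "norm (zeta_rem M n s) \<le>
              norm (zeta_coeff (Suc M) s) * real (Suc n) powr (- Re s - real M) / fact M"
        using re d by (intro zeta_rem_bound) auto
      also have "\<dots> \<le> K * real (Suc n) powr (- (1 + d)) / fact M"
        using s K re by (intro divide_right_mono mult_mono powr_mono) auto
      finally show ?thesis by (simp only: h)
    qed
    ultimately show "\<exists>d (h :: nat \<Rightarrow> complex). 0 < d \<and> summable h \<and> range h \<subseteq> \<real>\<^sub>\<ge>\<^sub>0 \<and>
        (\<forall>\<^sub>F n in sequentially. \<forall>y\<in>ball s0 d \<inter> S. norm (zeta_rem M n y) \<le> norm (h n))"
      using d by (intro exI [of _ d] exI [of _ h]) auto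
  qed
  show ?thesis
  proof (rule that [of G])
    show "G holomorphic_on {s. Re s > 1 - real M}"
      using G unfolding S_def holomorphic_on_def
      by (auto intro: field_differentiable_at_within)
  qed (use G in \<open>auto simp: S_def\<close>)
qed

lemma zeta_recurrence:
  assumes "Re s > 1" and rem: "(\<lambda>n. zeta_rem M n s) sums G" and "M > 0"
  shows "(s - 1) * zeta_series s =
     1 + G - (\<Sum>k=2..M. zeta_coeff (k - 1) s / fact k * ((s + of_nat k - 2) * zeta_series (s + of_nat k - 1)))"
proof -
  let ?p = "\<lambda>n. of_nat (Suc n) powr (1 - s) :: complex"
  have "?p \<longlonglongrightarrow> 0"
  proof (rule tendsto_norm_zero_cancel)
    have "(\<lambda>n. real (Suc n) powr (1 - Re s)) \<longlonglongrightarrow> 0"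
      using assms(1)
      by (intro tendsto_neg_powr filterlim_compose [OF filterlim_real_sequentially filterlim_Suc]) auto
    then show "(\<lambda>n. norm (?p n)) \<longlonglongrightarrow> 0"
      by (simp only: norm_of_nat_Suc_powr minus_complex.sel one_complex.sel)
  qed
  then have tel: "(\<lambda>n. ?p (Suc n) - ?p n) sums (0 - ?p 0)"
    by (rule telescope_sums)
  have k: "(\<lambda>n. of_nat (Suc n) powr (1 - s - of_nat k)) sums zeta_series (s + of_nat k - 1)"
    if "k \<ge> 1" for k
  proof -
    have "1 - s - of_nat k = - (s + of_nat k - 1)" by simp
    moreover have "Re (s + of_nat k - 1) > 1" using assms(1) that by simp
    ultimately show ?thesis using zeta_series_sums by metis
  qed
  have eq: "?p (Suc n) - ?p n - zeta_rem M n s =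
      (\<Sum>k=1..M. zeta_coeff k s / fact k * of_nat (Suc n) powr (1 - s - of_nat k))" for n
  proof -
    have "{..M} = insert 0 {1..M}" by auto
    then show ?thesis
      by (simp add: zeta_rem_def zeta_coeff_def [of 0] algebra_simps del: of_nat_Suc)
  qed
  have "(\<lambda>n. ?p (Suc n) - ?p n - zeta_rem M n s) sums (0 - ?p 0 - G)"
    by (intro sums_diff tel rem)
  moreover have "(\<lambda>n. ?p (Suc n) - ?p n - zeta_rem M n s) sums
      (\<Sum>k=1..M. zeta_coeff k s / fact k * zeta_series (s + of_nat k - 1))"
    unfolding eq by (intro sums_sum sums_mult k) auto
  ultimately have "- 1 - G = (\<Sum>k=1..M. zeta_coeff k s / fact k * zeta_series (s + of_nat k - 1))"
    using sums_unique2 by fastforce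
  also have "{1..M} = insert 1 {2..M}" using assms by auto
  also have "(\<Sum>k\<in>insert 1 {2..M}. zeta_coeff k s / fact k * zeta_series (s + of_nat k - 1)) =
     (1 - s) * zeta_series s + (\<Sum>k=2..M. zeta_coeff k s / fact k * zeta_series (s + of_nat k - 1))"
    by (subst sum.insert) (auto simp: zeta_coeff_def)
  also have "(\<Sum>k=2..M. zeta_coeff k s / fact k * zeta_series (s + of_nat k - 1)) =
     - (\<Sum>k=2..M. zeta_coeff (k - 1) s / fact k * ((s + of_nat k - 2) * zeta_series (s + of_nat k - 1)))"
    unfolding sum_negf [symmetric]
  proof (rule sum.cong)
    fix k assume "k \<in> {2..M}"
    then obtain j where j: "k = Suc j" by (cases k) auto
    show "zeta_coeff k s / fact k * zeta_series (s + of_nat k - 1) =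
      - (zeta_coeff (k - 1) s / fact k * ((s + of_nat k - 2) * zeta_series (s + of_nat k - 1)))"
      unfolding j zeta_coeff_def by (simp add: field_simps del: fact_Suc)
  qed auto
  finally show ?thesis by (simp add: algebra_simps)
qed

lemma zeta_continuation_step:
  "\<exists>g. (m > 0 \<longrightarrow> g holomorphic_on {s. Re s > 1 - real m}) \<and>
       (\<forall>s. Re s > 1 \<longrightarrow> g s = (s - 1) * zeta_series s)"
proof (induction m)
  case 0
  show ?case by auto
next
  case (Suc m)
  then obtain g where hol: "m > 0 \<Longrightarrow> g holomorphic_on {s. Re s > 1 - real m}"
    and g: "\<And>s. Re s > 1 \<Longrightarrow> g s = (s - 1) * zeta_series s" by blast
  obtain G where G: "G holomorphic_on {s. Re s > 1 - real (Suc m)}"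
    "\<And>s. Re s > 1 - real (Suc m) \<Longrightarrow> (\<lambda>n. zeta_rem (Suc m) n s) sums G s"
    by (rule zeta_rem_series [of "Suc m"]) (rule that)
  define F where "F s = 1 + G s - (\<Sum>k=2..Suc m. zeta_coeff (k - 1) s / fact k * g (s + of_nat k - 1))" for s
  have gh: "(\<lambda>s. g (s + of_nat k - 1)) holomorphic_on {s. Re s > 1 - real (Suc m)}"
    if "k \<in> {2..Suc m}" for k
  proof -
    have "g \<circ> (\<lambda>s. s + of_nat k - 1) holomorphic_on {s. Re s > 1 - real (Suc m)}"
      using that
      by (intro holomorphic_on_compose_gen [OF _ hol] holomorphic_intros) auto
    then show ?thesis by (simp add: o_def)
  qed
  have "F holomorphic_on {s. Re s > 1 - real (Suc m)}"
    unfolding F_def [abs_def] by (intro holomorphic_intros G gh) auto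
  moreover have "F s = (s - 1) * zeta_series s" if s: "Re s > 1" for s
  proof -
    have "g (s + of_nat k - 1) = (s + of_nat k - 2) * zeta_series (s + of_nat k - 1)"
      if "k \<in> {2..Suc m}" for k
      using g [of "s + of_nat k - 1"] s that by (simp add: algebra_simps)
    then show ?thesis
      using zeta_recurrence [OF s G(2)] s by (simp add: F_def)
  qed
  ultimately show ?case by blast
qed

lemma is_zeta_exists: "\<exists>f. is_zeta f"
proof -
  define H where "H m = {s. Re s > 1 - real m}" for m
  have "\<forall>m. \<exists>g. (m > 0 \<longrightarrow> g holomorphic_on H m) \<and>
       (\<forall>s. Re s > 1 \<longrightarrow> g s = (s - 1) * zeta_series s)"
    unfolding H_def using zeta_continuation_step by blast
  then obtain g where hol: "\<And>m. m > 0 \<Longrightarrow> g m holomorphic_on H m"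
    and g: "\<And>m s. Re s > 1 \<Longrightarrow> g m s = (s - 1) * zeta_series s" by metis
  have H: "open (H m)" "connected (H m)" for m
    unfolding H_def by (auto intro: open_halfspace_Re_gt convex_connected convex_halfspace_Re_gt)
  have agree: "g m s = g n s" if "0 < m" "m \<le> n" "s \<in> H m" for m n s
  proof (rule analytic_continuation_open [of "H 0" "H m" "g m" "g n"])
    have "2 \<in> H 0" by (simp add: H_def)
    then show "H 0 \<noteq> {}" by blast
    show "g n holomorphic_on H m"
      using that by (intro holomorphic_on_subset [OF hol]) (auto simp: H_def)
    show "g m holomorphic_on H m" using hol that by blast
    show "H 0 \<subseteq> H m" by (auto simp: H_def)
    show "g m z = g n z" if "z \<in> H 0" for z using that by (simp add: H_def g)
  qed (use that H in blast)+
  define m where "m s = Suc (nat \<lceil>2 - Re s\<rceil>)" for s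
  have m: "m s > 0" "s \<in> H (m s)" for s
    by (simp_all add: m_def H_def) linarith
  define E where "E s = g (m s) s" for s
  have E: "E s = g n s" if "s \<in> H n" "n > 0" for s n
    unfolding E_def using that m [of s] agree by (metis nat_le_linear)
  have "E holomorphic_on UNIV"
    unfolding holomorphic_on_open [OF open_UNIV]
  proof
    fix s
    have "E holomorphic_on H (m s)"
      by (rule holomorphic_transform [OF hol [OF m(1) [of s]]], rule E [symmetric]) (use m(1) in blast)+
    then show "\<exists>f'. (E has_field_derivative f') (at s)"
      using m(2) H by (simp add: holomorphic_on_open)
  qed
  define f where "f s = (if s = 1 then 0 else E s / (s - 1))" for s
  have "(\<lambda>s. E s / (s - 1)) holomorphic_on - {1}"
    by (intro holomorphic_intros holomorphic_on_subset [OF \<open>E holomorphic_on UNIV\<close>]) auto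
  then have "f holomorphic_on - {1}"
    by (rule holomorphic_transform) (auto simp: f_def)
  moreover have "(\<lambda>n. 1 / of_nat (Suc n) powr s) sums f s" if "Re s > 1" for s
  proof -
    from that have "s \<noteq> 1" by auto
    moreover have "E s = (s - 1) * zeta_series s"
      unfolding E_def by (rule g [OF that])
    ultimately have "f s = zeta_series s" by (simp add: f_def)
    then show ?thesis
      using zeta_series_sums [OF that] by (simp only: powr_minus_divide)
  qed
  ultimately have "is_zeta f" unfolding is_zeta_def by (auto simp: f_def)
  then show ?thesis by blast
qed

lemma is_zeta_unique:
  assumes "is_zeta f" "is_zeta g"
  shows "f = g"
proof
  fix s
  show "f s = g s"
  proof (cases "s = 1")
    case True
    then show ?thesis using assms by (simp add: is_zeta_def)
  next
    case False
    show ?thesis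
    proof (rule analytic_continuation_open [of "{s. Re s > 1}" "- {1}" f g])
      show "open {s. Re s > 1}" by (rule open_halfspace_Re_gt)
      have "2 \<in> {s. Re s > 1}" by simp
      then show "{s. Re s > 1} \<noteq> {}" by blast
      show "connected (- {1 :: complex})"
        by (rule connected_punctured_universe) auto
      show "f z = g z" if "z \<in> {s. Re s > 1}" for z
      proof (rule sums_unique2)
        show "(\<lambda>n. 1 / of_nat (Suc n) powr z) sums f z" "(\<lambda>n. 1 / of_nat (Suc n) powr z) sums g z"
          using assms that by (simp_all add: is_zeta_def)
      qed
    qed (use assms False in \<open>auto simp: is_zeta_def\<close>)
  qed
qed

theorem is_zeta_zeta: "is_zeta zeta"
proof -
  obtain f where f: "is_zeta f" using is_zeta_exists ..
  then show ?thesis unfolding zeta_def by (rule theI [of is_zeta]) (rule is_zeta_unique [OF _ f])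
qed


section \<open>Half-isolated zeros\<close>

definition zeta_zeros :: "complex set" where
  "zeta_zeros = {\<rho>. \<rho> \<noteq> 1 \<and> zeta \<rho> = 0}"

definition Y_half_isolated :: "real \<Rightarrow> complex \<Rightarrow> bool" where
  "Y_half_isolated Y \<rho>\<^sub>0 \<longleftrightarrow>
     \<rho>\<^sub>0 \<in> zeta_zeros \<and>
     (\<forall>\<rho> \<in> zeta_zeros. norm (\<rho> - \<rho>\<^sub>0) \<le> (ln \<bar>Im \<rho>\<^sub>0\<bar>)\<^sup>2 \<longrightarrow>
        (\<bar>Re \<rho> - Re \<rho>\<^sub>0\<bar> \<le> 1 / (10 * ln Y) \<and> Im \<rho> \<ge> Im \<rho>\<^sub>0) \<or>
        Re \<rho> \<le> Re \<rho>\<^sub>0 - (ln (ln \<bar>Im \<rho>\<^sub>0\<bar>))\<^sup>2 / ln Y)"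

definition half_isolated :: "complex \<Rightarrow> bool" where
  "half_isolated \<rho>\<^sub>0 \<longleftrightarrow>
     (\<exists>Y>1. (ln (ln \<bar>Im \<rho>\<^sub>0\<bar>)) ^ 3 \<le> ln Y \<and> ln Y \<le> ln \<bar>Im \<rho>\<^sub>0\<bar> / ln (ln \<bar>Im \<rho>\<^sub>0\<bar>) \<and>
            Y_half_isolated Y \<rho>\<^sub>0)"


section \<open>Smooth functions\<close>

definition smooth :: "(real \<Rightarrow> real) \<Rightarrow> bool" where
  "smooth f \<longleftrightarrow> (\<forall>k. (deriv ^^ k) f differentiable_on UNIV)"

end

theory Submission
  imports Defs "HOL-Probability.Sinc_Integral" "HOL-Real_Asymp.Real_Asymp"
begin

text \<open>
  Let \<open>\<rho>\<close> be a zero at height \<open>\<gamma>\<close>, let \<open>L = ln \<gamma>\<close>, and let \<open>W\<close> be the Mellin transform of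
  the weight, which decays like \<open>exp (- sqrt \<bar>Im s\<bar> / 2)\<close>. The explicit formula says that, up to a small
  error, minus the sum over \<open>n\<close> with \<open>Y = exp u\<close> equals
  \<open>\<Sum> m(p) W(p - \<rho>) exp ((p - \<rho>) u)\<close> over the zeros \<open>p\<close> with \<open>\<bar>p - \<rho>\<bar> \<le> L\<^sup>2\<close>.
  Half-isolation of \<open>\<rho>\<close> with respect to \<open>exp \<lambda>\<close> makes the zeros of the second kind negligible for
  \<open>u \<ge> \<lambda>\<close>, since \<open>Re (p - \<rho>) u \<le> - (ln L)\<^sup>2\<close>. Those of the first kind have \<open>Im (p - \<rho>) \<ge> 0\<close> and
  \<open>\<bar>Re (p - \<rho>)\<bar> \<lambda> \<le> 1/10\<close>, so that their sum \<open>h(u)\<close>, as an entire function of \<open>u\<close>, is bounded by a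
  power of \<open>L\<close> on the part of the upper half-plane where \<open>\<bar>u\<bar> \<le> 11 \<lambda>\<close>. If the sum over \<open>n\<close> were tiny
  for all admissible \<open>Y\<close>, then \<open>h\<close> would be tiny on \<open>[\<lambda>, 4\<lambda>]\<close>, and hence, by the two-constants
  theorem, at \<open>u = (9/4) \<i> \<lambda>\<close>. At that point the zeros with \<open>Im (p - \<rho>) > 1\<close> contribute at most
  \<open>exp (- \<lambda>)\<close> each, those with \<open>Im (p - \<rho>) \<le> 1\<close> have nonnegative real part, and \<open>\<rho>\<close> itself
  contributes at least \<open>W(0) > 0\<close>: a contradiction.
\<close>

section \<open>Zeros of holomorphic functions in a disc\<close>

text \<open>The control of \<open>h\<close> is one-sided. Zeros of the first kind may lie as far as
  \<open>L\<^sup>2\<close> above the given zero, so \<open>h\<close> can be huge in the lower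
  half-plane; only a half-disc is available, and the smallness on
  \<open>[\<lambda>, 4\<lambda>]\<close> must be carried into it from its boundary. At
  \<open>(9/4) \<i> \<lambda>\<close> the zeros at height at most 1 above the given one need not
  decay. Their sign is a property of the weight: it is nonnegative and lives where
  \<open>\<bar>ln x\<bar> < 1\<close>, so all phases stay below \<open>pi / 2\<close>. The decay of
  \<open>mellin\<close> fixes the truncation: at height of order \<open>L\<^sup>2\<close> it is
  \<open>exp (- L / 3)\<close>, a power of the height of the zero, which survives the factor
  \<open>exp (2 * u)\<close> since \<open>u \<le> 4 * L / ln L\<close>. The zeros used are counted
  crudely by a multiple of \<open>L ^ 4\<close>. The two-constants exponent \<open>3 / 160\<close>
  turns \<open>L powr (- 320)\<close> into order \<open>L powr (- 6)\<close>, which beats this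
  count. The bounds \<open>\<lambda> \<ge> (ln L) ^ 3\<close> and the gap
  \<open>(ln L)\<^sup>2\<close> make \<open>exp (- \<lambda>)\<close> and
  \<open>exp (- (ln L)\<^sup>2)\<close> smaller than every power of \<open>L\<close>. The functional
  equation enters only through the absence of nonreal zeros with \<open>Re s < 0\<close>, which
  frees the left side of the contour.\<close>

lemma holomorphic_split_zero:
  fixes f :: "complex \<Rightarrow> complex"
  assumes hol: "f holomorphic_on U" and U: "open U" "connected U" and p: "p \<in> U"
    and nz: "\<exists>w\<in>U. f w \<noteq> 0"
  obtains g where "g holomorphic_on U" "g p \<noteq> 0"
    "\<And>w. w \<in> U \<Longrightarrow> f w = (w - p) ^ nat (zorder f p) * g w"
proof -
  define n where "n = nat (zorder f p)"
  obtain r where r: "r > 0" "cball p r \<subseteq> U" "zor_poly f p holomorphic_on cball p r"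
    and eq: "\<And>w. w \<in> cball p r \<Longrightarrow> f w = zor_poly f p w * (w - p) ^ n \<and> zor_poly f p w \<noteq> 0"
    using conjunct2 [OF zorder_exist_zero [OF hol U p nz]] unfolding n_def by blast
  \<comment> \<open>The quotient is glued from \<open>zor_poly\<close> near \<open>p\<close> and the
    literal quotient elsewhere. Both are holomorphic on open sets and agree on the overlap.\<close>
  define g where "g w = (if w = p then zor_poly f p p else f w / (w - p) ^ n)" for w
  have gr: "g w = zor_poly f p w" if "w \<in> cball p r" for w
    using eq [OF that] by (auto simp: g_def)
  have "g holomorphic_on ball p r \<union> (U - {p})"
  proof (rule holomorphic_on_Un)
    have "zor_poly f p holomorphic_on ball p r"
      using r(3) by (rule holomorphic_on_subset) auto
    then show "g holomorphic_on ball p r"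
      by (rule holomorphic_transform) (auto simp: gr)
    have "(\<lambda>w. f w / (w - p) ^ n) holomorphic_on U - {p}"
      by (intro holomorphic_intros holomorphic_on_subset [OF hol]) auto
    then show "g holomorphic_on U - {p}"
      by (rule holomorphic_transform) (auto simp: g_def)
  qed (use U in \<open>auto intro: open_delete\<close>)
  moreover have "ball p r \<union> (U - {p}) = U"
  proof -
    have "ball p r \<subseteq> U" using r(2) ball_subset_cball by blast
    moreover have "p \<in> ball p r" using r(1) by simp
    ultimately show ?thesis using p by blast
  qed
  ultimately have "g holomorphic_on U" by simp
  moreover have pp: "f p = zor_poly f p p * (p - p) ^ n" "zor_poly f p p \<noteq> 0"
    using eq [of p] r(1) by (meson centre_in_cball less_imp_le)+
  then have "g p \<noteq> 0" by (simp add: g_def)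
  moreover have "f w = (w - p) ^ n * g w" if "w \<in> U" for w
    using pp(1) by (cases "w = p") (simp_all add: g_def mult.commute)
  ultimately show ?thesis using that unfolding n_def by blast
qed

text \<open>Induction splits off one zero at a time. The point to check is that the cofactor has the
  same order at the new zero \<open>q\<close> as \<open>f\<close> itself, because the factors
  already removed do not vanish at \<open>q\<close>.\<close>

lemma holomorphic_split_zeros:
  fixes f :: "complex \<Rightarrow> complex"
  assumes hol: "f holomorphic_on U" and U: "open U" "connected U"
    and nz: "\<exists>w\<in>U. f w \<noteq> 0" and S: "finite S" "S \<subseteq> U"
  shows "\<exists>g. g holomorphic_on U \<and> (\<forall>p\<in>S. g p \<noteq> 0) \<and>
    (\<forall>w\<in>U. f w = (\<Prod>p\<in>S. (w - p) ^ nat (zorder f p)) * g w)"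
  using S
proof (induction S rule: finite_induct)
  case empty
  show ?case using hol by auto
next
  case (insert q S)
  then obtain g where g: "g holomorphic_on U" "\<forall>p\<in>S. g p \<noteq> 0"
    "\<And>w. w \<in> U \<Longrightarrow> f w = (\<Prod>p\<in>S. (w - p) ^ nat (zorder f p)) * g w"
    by auto
  have q: "q \<in> U" using insert by auto
  have gnz: "\<exists>w\<in>U. g w \<noteq> 0" using nz g(3) by fastforce
  obtain h where h: "h holomorphic_on U" "h q \<noteq> 0"
    "\<And>w. w \<in> U \<Longrightarrow> g w = (w - q) ^ nat (zorder g q) * h w"
    using holomorphic_split_zero [OF g(1) U q gnz] by metis
  have "zorder g q \<ge> 0"
    using zorder_exist_zero [OF g(1) U q gnz] by (auto split: if_splits)
  moreover have zfg: "zorder f q = zorder g q"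
  proof (rule zorder_eqI [OF U(1) q])
    show "(\<lambda>w. h w * (\<Prod>p\<in>S. (w - p) ^ nat (zorder f p))) holomorphic_on U"
      by (intro holomorphic_intros h)
    show "h q * (\<Prod>p\<in>S. (q - p) ^ nat (zorder f p)) \<noteq> 0"
      using h insert by auto
    show "f w = h w * (\<Prod>p\<in>S. (w - p) ^ nat (zorder f p)) * (w - q) powi zorder g q"
      if "w \<in> U" "w \<noteq> q" for w
      using g(3) [OF that(1)] h(3) [OF that(1)] \<open>zorder g q \<ge> 0\<close>
      by (simp add: power_int_def)
  qed
  moreover have "h p \<noteq> 0" if p: "p \<in> insert q S" for p
  proof (cases "p = q")
    case False
    then have "p \<in> S" "p \<in> U" using p insert.prems by auto
    then have "g p \<noteq> 0" "g p = (p - q) ^ nat (zorder g q) * h p"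
      using g(2) h(3) by blast+
    then show ?thesis by (metis mult_zero_right)
  next
    case True
    then show ?thesis using h(2) by blast
  qed
  moreover have "f w = (\<Prod>p\<in>insert q S. (w - p) ^ nat (zorder f p)) * h w" if "w \<in> U" for w
  proof -
    have "(\<Prod>p\<in>insert q S. (w - p) ^ nat (zorder f p)) =
        (w - q) ^ nat (zorder g q) * (\<Prod>p\<in>S. (w - p) ^ nat (zorder f p))"
      using insert.hyps zfg by (subst prod.insert) auto
    then show ?thesis
      unfolding g(3) [OF that] h(3) [OF that] by (simp only: mult_ac)
  qed
  ultimately show ?case
    using h(1) by blast
qed

lemma has_field_derivative_prod_powers:
  fixes z :: complex
  assumes "finite S" "z \<notin> S"
  shows "((\<lambda>w. \<Prod>p\<in>S. (w - p) ^ n p) has_field_derivative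
           (\<Prod>p\<in>S. (z - p) ^ n p) * (\<Sum>p\<in>S. of_nat (n p) / (z - p))) (at z)"
  using assms
proof (induction S rule: finite_induct)
  case (insert q S)
  have d: "((\<lambda>w. (w - q) ^ n q) has_field_derivative (z - q) ^ n q * (of_nat (n q) / (z - q))) (at z)"
  proof -
    have "((\<lambda>w. (w - q) ^ n q) has_field_derivative of_nat (n q) * (z - q) ^ (n q - 1)) (at z)"
      by (auto intro!: derivative_eq_intros)
    also have "of_nat (n q) * (z - q) ^ (n q - 1) = (z - q) ^ n q * (of_nat (n q) / (z - q))"
      using insert by (cases "n q") auto
    finally show ?thesis .
  qed
  show ?case
    using DERIV_mult [OF d insert.IH] insert by (simp add: algebra_simps)
qed auto

text \<open>A zero-free \<open>g\<close> is \<open>g c * exp G\<close> with \<open>G c = 0\<close>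
  and \<open>Re G \<le> A\<close>. The map \<open>x / (2 * B - x)\<close> takes the half-plane
  \<open>Re x < B\<close> into the unit disc, so the Schwarz lemma gives
  \<open>norm G \<le> 6 * B\<close> at distance \<open>3 * r / 4\<close> from \<open>c\<close>. The
  Cauchy estimate on circles of radius \<open>r / 4\<close> then bounds \<open>deriv G\<close>,
  which is the logarithmic derivative of \<open>g\<close>.\<close>

lemma Borel_Caratheodory_deriv:
  fixes g :: "complex \<Rightarrow> complex"
  assumes hol: "g holomorphic_on ball c r" and r: "r > 0"
    and nz: "\<And>z. z \<in> ball c r \<Longrightarrow> g z \<noteq> 0"
    and bd: "\<And>z. z \<in> ball c r \<Longrightarrow> norm (g z) \<le> norm (g c) * exp A"
    and z: "dist c z \<le> r / 2"
  shows "norm (deriv g z / g z) \<le> 24 * (A + 1) / r"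
proof -
  obtain G0 where G0: "G0 holomorphic_on ball c r" "\<And>z. z \<in> ball c r \<Longrightarrow> g z = exp (G0 z)"
  proof -
    obtain h where "h holomorphic_on ball c r" "\<forall>z\<in>ball c r. g z = exp (h z)"
      using iffD1 [OF simply_connected_eq_holomorphic_log [OF open_ball]
          convex_imp_simply_connected [OF convex_ball]] hol nz by blast
    then show ?thesis using that by blast
  qed
  define G where "G z = G0 z - G0 c" for z
  have cin: "c \<in> ball c r" using r by simp
  have Ghol: "G holomorphic_on ball c r" unfolding G_def by (intro holomorphic_intros G0)
  have gG: "g z = g c * exp (G z)" if "z \<in> ball c r" for z
    using G0(2) [OF that] G0(2) [OF cin] by (simp add: G_def exp_diff)
  have ReG: "Re (G z) \<le> A" if "z \<in> ball c r" for z
    using bd [OF that] nz [OF cin] gG [OF that] by (simp add: norm_mult)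
  have A: "A \<ge> 0" using ReG [OF cin] by (simp add: G_def)
  \<comment> \<open>Strictly larger than \<open>A\<close>, so that the denominator of
    \<open>\<phi>\<close> cannot vanish even when \<open>A = 0\<close>.\<close>
  define B where "B = A + 1"
  have B: "B > 0" "A < B" using A by (auto simp: B_def)
  define \<phi> where "\<phi> w = G (c + of_real r * w) / (2 * of_real B - G (c + of_real r * w))" for w
  have inb: "c + of_real r * w \<in> ball c r" if "norm w < 1" for w
    using that r by (auto simp: dist_norm norm_mult)
  have den: "2 * of_real B - G (c + of_real r * w) \<noteq> 0" if "norm w < 1" for w
  proof
    assume "2 * of_real B - G (c + of_real r * w) = 0"
    then have "Re (2 * of_real B - G (c + of_real r * w)) = 0" by simp
    then show False using ReG [OF inb [OF that]] B by simp
  qed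
  have comp: "(\<lambda>w. G (c + of_real r * w)) holomorphic_on ball 0 1"
  proof -
    have "G \<circ> (\<lambda>w. c + of_real r * w) holomorphic_on ball 0 1"
      by (rule holomorphic_on_compose_gen [OF _ Ghol]) (auto intro!: holomorphic_intros inb)
    then show ?thesis by (simp add: o_def)
  qed
  have \<phi>hol: "\<phi> holomorphic_on ball 0 1"
    unfolding \<phi>_def by (intro holomorphic_intros comp) (use den in auto)
  have \<phi>lt: "norm (\<phi> w) < 1" if w: "norm w < 1" for w
  proof -
    let ?x = "G (c + of_real r * w)"
    have "(norm ?x)\<^sup>2 < (norm (2 * of_real B - ?x))\<^sup>2"
    proof -
      have "Re ?x < B" using ReG [OF inb [OF w]] B by simp
      then have "(2 * B - Re ?x)\<^sup>2 - (Re ?x)\<^sup>2 = 4 * B * (B - Re ?x) \<and> 4 * B * (B - Re ?x) > 0"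
        using B by (auto simp: power2_eq_square algebra_simps)
      then show ?thesis by (simp add: cmod_power2)
    qed
    then have "norm ?x < norm (2 * of_real B - ?x)"
      by (rule power2_less_imp_less) simp
    then show ?thesis using den [OF w] by (simp add: \<phi>_def norm_divide)
  qed
  have sch: "norm (\<phi> w) \<le> norm w" if "norm w < 1" for w
    using Schwarz_Lemma(1) [OF \<phi>hol _ \<phi>lt that] by (simp add: \<phi>_def G_def)
  have Gbd: "norm (G x) \<le> 6 * B" if x: "dist c x \<le> 3 * r / 4" for x
  proof -
    define w where "w = (x - c) / of_real r"
    have w: "norm w \<le> 3 / 4" using x r by (simp add: w_def norm_divide dist_norm norm_minus_commute field_simps)
    have xw: "c + of_real r * w = x" using r by (simp add: w_def)
    have "norm (\<phi> w) \<le> 3 / 4" using sch [of w] w by simp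
    moreover have "G x = \<phi> w * (2 * of_real B - G x)"
      using den [of w] w by (simp add: \<phi>_def xw)
    ultimately have "norm (G x) \<le> 3 / 4 * norm (2 * of_real B - G x)"
      by (metis mult_right_mono norm_ge_zero norm_mult)
    also have "norm (2 * of_real B - G x) \<le> 2 * B + norm (G x)"
      using norm_triangle_ineq4 [of "2 * of_real B" "G x"] B by (simp add: norm_mult)
    finally show ?thesis by simp
  qed
  have zin: "z \<in> ball c r" using z r by simp
  have "deriv g z / g z = deriv G z"
  proof -
    have "(g has_field_derivative g c * (exp (G z) * deriv G z)) (at z)"
    proof (rule has_field_derivative_transform_within_open [OF _ open_ball zin])
      show "((\<lambda>z. g c * exp (G z)) has_field_derivative g c * (exp (G z) * deriv G z)) (at z)"
        using holomorphic_derivI [OF Ghol open_ball zin]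
        by (auto intro!: derivative_eq_intros)
    qed (use gG in auto)
    then show ?thesis using gG [OF zin] nz [OF zin] by (simp add: DERIV_imp_deriv)
  qed
  moreover have "norm (deriv G z) \<le> 6 * B / (r / 4)"
  proof -
    have sub: "cball z (r / 4) \<subseteq> cball c (3 * r / 4)"
      using z by (auto simp: cball_subset_cball_iff dist_commute)
    have sub2: "cball c (3 * r / 4) \<subseteq> ball c r" using r by auto
    have "norm ((deriv ^^ 1) G z) \<le> fact 1 * (6 * B) / (r / 4) ^ 1"
    proof (rule Cauchy_inequality)
      show "G holomorphic_on ball z (r / 4)"
        using sub sub2 ball_subset_cball by (intro holomorphic_on_subset [OF Ghol]) blast
      show "continuous_on (cball z (r / 4)) G"
        using sub sub2 by (intro holomorphic_on_imp_continuous_on holomorphic_on_subset [OF Ghol]) blast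
      show "norm (G x) \<le> 6 * B" if "norm (z - x) = r / 4" for x
      proof (rule Gbd)
        have "x \<in> cball z (r / 4)" using that by (simp add: dist_norm)
        then show "dist c x \<le> 3 * r / 4" using sub by auto
      qed
    qed (use r in auto)
    then show ?thesis by simp
  qed
  ultimately show ?thesis by (simp add: B_def field_simps)
qed

lemma finite_zeros_cball:
  fixes f :: "complex \<Rightarrow> complex"
  assumes "f holomorphic_on U" "open U" "connected U" "compact K" "K \<subseteq> U" "\<exists>w\<in>U. f w \<noteq> 0"
  shows "finite {z \<in> K. f z = 0}"
proof -
  have "\<not> f constant_on U \<or> (\<forall>w\<in>U. f w \<noteq> 0)"
    using assms(6) unfolding constant_on_def by metis
  then show ?thesis
  proof
    assume "\<not> f constant_on U"
    then show ?thesis using holomorphic_compact_finite_zeros [OF assms(1-5)] by simp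
  next
    assume "\<forall>w\<in>U. f w \<noteq> 0"
    then have "{z \<in> K. f z = 0} = {}" using assms(5) by auto
    then show ?thesis by (simp only: finite.emptyI)
  qed
qed

text \<open>Jensen's argument. Each factor \<open>w - p\<close> is at least \<open>2 * r\<close> on
  the circle of radius \<open>3 * r\<close> and at most \<open>r\<close> at the centre, so by the
  maximum principle the quotient \<open>g\<close> obeys the bound for \<open>f\<close> improved by
  \<open>2 ^ N\<close>. At the centre this reads \<open>2 ^ N \<le> exp A\<close>, which counts the
  zeros. As \<open>g\<close> has no zeros in the disc of radius \<open>r\<close>, the
  Borel-Caratheodory bound applies to it, and \<open>deriv g / g\<close> is the logarithmic
  derivative of \<open>f\<close> with its poles removed.\<close>

lemma zeros_in_disc:
  fixes f :: "complex \<Rightarrow> complex"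
  assumes hol: "f holomorphic_on U" and U: "open U" "connected U" and sub: "cball c (3 * r) \<subseteq> U"
    and r: "r > 0" and bd: "\<And>z. z \<in> cball c (3 * r) \<Longrightarrow> norm (f z) \<le> norm (f c) * exp A"
    and nz: "f c \<noteq> 0"
  defines "Z \<equiv> {z \<in> cball c r. f z = 0}"
  shows "finite Z" and "(\<Sum>p\<in>Z. real (nat (zorder f p))) \<le> 2 * A"
    and "\<And>z. dist c z \<le> r / 2 \<Longrightarrow> f z \<noteq> 0 \<Longrightarrow>
      norm (deriv f z / f z - (\<Sum>p\<in>Z. of_nat (nat (zorder f p)) / (z - p))) \<le> 24 * (A + 1) / r"
proof -
  have cin: "c \<in> cball c (3 * r)" using r by simp
  have nz': "\<exists>w\<in>U. f w \<noteq> 0" using nz sub cin by blast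
  have Zsub: "Z \<subseteq> U" using sub r unfolding Z_def by (auto intro!: subsetD [OF sub])
  show fin: "finite Z" unfolding Z_def
    by (rule finite_zeros_cball [OF hol U _ _ nz']) (use sub r in \<open>auto intro!: subsetD [OF sub]\<close>)
  define n where "n p = nat (zorder f p)" for p
  define N where "N = (\<Sum>p\<in>Z. n p)"
  define P where "P w = (\<Prod>p\<in>Z. (w - p) ^ n p)" for w
  obtain g where g: "g holomorphic_on U" "\<And>p. p \<in> Z \<Longrightarrow> g p \<noteq> 0"
    and fg: "\<And>w. w \<in> U \<Longrightarrow> f w = P w * g w"
    using holomorphic_split_zeros [OF hol U nz' fin Zsub] unfolding P_def n_def by auto
  have Pbd1: "norm (P w) \<ge> (2 * r) ^ N" if "dist c w = 3 * r" for w
  proof -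
    have "(2 * r) ^ N = (\<Prod>p\<in>Z. (2 * r) ^ n p)" by (simp add: N_def power_sum)
    also have "\<dots> \<le> (\<Prod>p\<in>Z. norm (w - p) ^ n p)"
    proof (intro prod_mono conjI power_mono)
      fix p assume "p \<in> Z"
      then have "dist c p \<le> r" by (simp add: Z_def)
      then show "2 * r \<le> norm (w - p)"
        using that dist_triangle [of c w p] by (simp add: dist_norm norm_minus_commute)
    qed (use r in auto)
    finally show ?thesis by (simp add: P_def prod_norm [symmetric] norm_power)
  qed
  have Pbd2: "norm (P c) \<le> r ^ N"
  proof -
    have "(\<Prod>p\<in>Z. norm (c - p) ^ n p) \<le> (\<Prod>p\<in>Z. r ^ n p)"
      by (intro prod_mono conjI power_mono) (auto simp: Z_def dist_norm)
    also have "\<dots> = r ^ N" by (simp add: N_def power_sum)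
    finally show ?thesis by (simp add: P_def prod_norm [symmetric] norm_power)
  qed
  have gbd: "norm (g w) \<le> norm (f c) * exp A / (2 * r) ^ N" if "w \<in> cball c (3 * r)" for w
  proof (rule maximum_modulus_frontier [of g "cball c (3 * r)"])
    show "g holomorphic_on interior (cball c (3 * r))"
      using sub interior_subset by (intro holomorphic_on_subset [OF g(1)]) blast
    show "continuous_on (closure (cball c (3 * r))) g"
      using sub by (intro holomorphic_on_imp_continuous_on holomorphic_on_subset [OF g(1)]) auto
    show "norm (g z) \<le> norm (f c) * exp A / (2 * r) ^ N" if "z \<in> frontier (cball c (3 * r))" for z
    proof -
      have z: "dist c z = 3 * r" using that r by simp
      then have zc: "z \<in> cball c (3 * r)" by simp
      have "(2 * r) ^ N * norm (g z) \<le> norm (P z) * norm (g z)"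
        by (intro mult_right_mono Pbd1 z) auto
      also have "\<dots> = norm (f z)" using fg [of z] zc sub by (auto simp: norm_mult)
      also have "\<dots> \<le> norm (f c) * exp A" by (rule bd [OF zc])
      finally show ?thesis using r by (simp add: field_simps)
    qed
  qed (use that in auto)
  have fgc: "f c = P c * g c" using fg sub cin by blast
  have fc: "norm (f c) \<le> r ^ N * norm (g c)"
    unfolding fgc norm_mult by (intro mult_right_mono Pbd2) auto
  have gc: "g c \<noteq> 0" using fgc nz by force
  have gA: "norm (g w) \<le> norm (g c) * exp A / 2 ^ N" if "w \<in> cball c (3 * r)" for w
  proof -
    have "norm (g w) \<le> norm (f c) * exp A / (2 * r) ^ N" by (rule gbd [OF that])
    also have "\<dots> \<le> r ^ N * norm (g c) * exp A / (2 * r) ^ N"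
      using r by (intro divide_right_mono mult_right_mono fc) auto
    also have "\<dots> = norm (g c) * exp A / 2 ^ N" using r by (simp add: power_mult_distrib)
    finally show ?thesis .
  qed
  have "2 ^ N \<le> exp A" using gA [OF cin] gc by (simp add: field_simps)
  then have "real N * ln 2 \<le> A"
    using ln_le_cancel_iff [of "2 ^ N" "exp A"] by (simp add: ln_realpow)
  moreover have "real N * (1 / 2) \<le> real N * ln 2"
    using ln2_ge_two_thirds by (intro mult_left_mono) auto
  ultimately have "real N \<le> 2 * A" by linarith
  then show "(\<Sum>p\<in>Z. real (nat (zorder f p))) \<le> 2 * A"
    by (simp add: N_def n_def)
  fix z assume z: "dist c z \<le> r / 2" and fz: "f z \<noteq> 0"
  have zU: "z \<in> U" 
  proof -
    have "z \<in> cball c (3 * r)" using z r by simp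
    then show ?thesis using sub by blast
  qed
  have zZ: "z \<notin> Z" using fz by (auto simp: Z_def)
  have g': "(g has_field_derivative deriv g z) (at z)"
    by (rule holomorphic_derivI [OF g(1) U(1) zU])
  have "(f has_field_derivative P z * (\<Sum>p\<in>Z. of_nat (n p) / (z - p)) * g z + deriv g z * P z) (at z)"
  proof (rule has_field_derivative_transform_within_open [OF _ U(1) zU])
    show "((\<lambda>w. P w * g w) has_field_derivative P z * (\<Sum>p\<in>Z. of_nat (n p) / (z - p)) * g z + deriv g z * P z) (at z)"
      unfolding P_def
      by (rule DERIV_mult [OF has_field_derivative_prod_powers [OF fin zZ] g'])
  qed (use fg in auto)
  then have "deriv f z = P z * (\<Sum>p\<in>Z. of_nat (n p) / (z - p)) * g z + deriv g z * P z"
    by (rule DERIV_imp_deriv)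
  moreover have "P z \<noteq> 0" "g z \<noteq> 0" using fg [OF zU] fz by auto
  ultimately have "deriv f z / f z - (\<Sum>p\<in>Z. of_nat (n p) / (z - p)) = deriv g z / g z"
    using fg [OF zU] by (simp add: field_simps)
  moreover have "norm (deriv g z / g z) \<le> 24 * (A + 1) / r"
  proof (rule Borel_Caratheodory_deriv [OF _ r _ _ z])
    have s: "ball c r \<subseteq> cball c (3 * r)" using r by auto
    show "g holomorphic_on ball c r"
      using s sub by (intro holomorphic_on_subset [OF g(1)]) blast
    show "g w \<noteq> 0" if "w \<in> ball c r" for w
    proof (cases "f w = 0")
      case True
      then show ?thesis using that g(2) by (auto simp: Z_def)
    next
      case False
      have "w \<in> U" using that s sub by blast
      then show ?thesis using False fg [of w] by auto
    qed
    show "norm (g w) \<le> norm (g c) * exp A" if "w \<in> ball c r" for w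
    proof -
      have "norm (g w) \<le> norm (g c) * exp A / 2 ^ N" using that s by (intro gA) blast
      also have "\<dots> \<le> norm (g c) * exp A / 1" by (intro divide_left_mono) auto
      finally show ?thesis by simp
    qed
  qed
  ultimately show "norm (deriv f z / f z - (\<Sum>p\<in>Z. of_nat (nat (zorder f p)) / (z - p))) \<le> 24 * (A + 1) / r"
    unfolding n_def by presburger
qed

section \<open>Dirichlet series\<close>

no_notation Infinite_Set_Sum.abs_summable_on (infix \<open>abs'_summable'_on\<close> 50)

lemma zeta_eq_zeta_series:
  assumes "Re s > 1"
  shows "zeta s = zeta_series s"
proof (rule sums_unique2)
  show "(\<lambda>n. 1 / of_nat (Suc n) powr s) sums zeta s"
    using is_zeta_zeta assms by (simp add: is_zeta_def)
  show "(\<lambda>n. 1 / of_nat (Suc n) powr s) sums zeta_series s"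
    using zeta_series_sums [OF assms] by (simp only: powr_minus_divide)
qed

lemma zeta_holomorphic: "zeta holomorphic_on - {1}"
  using is_zeta_zeta by (simp add: is_zeta_def)

lemma of_nat_powr_mult:
  "(of_nat (m * n) :: complex) powr s = of_nat m powr s * of_nat n powr s"
  using powr_times_real [of "of_nat m" "of_nat n" s] by simp

lemma has_sum_Suc_iff:
  "((\<lambda>n. f (Suc n)) has_sum S) UNIV \<longleftrightarrow> (f has_sum S) {1..}"
  by (rule has_sum_reindex_bij_betw) (auto simp: bij_betw_def image_def Suc_le_eq gr0_conv_Suc)

lemma summable_ln_powr:
  assumes "\<sigma> > 1"
  shows "summable (\<lambda>n. ln (real (Suc n)) * real (Suc n) powr (- \<sigma>))"
proof (rule summable_comparison_test')
  \<comment> \<open>Half of the surplus of \<open>\<sigma>\<close> over 1: one half pays for the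
    logarithm, the other keeps the exponent above 1.\<close>
  define e where "e = (\<sigma> - 1) / 2"
  have e: "e > 0" using assms by (simp add: e_def)
  have "summable (\<lambda>n. of_nat n powr (- (1 + e)) :: real)"
    using e by (subst summable_real_powr_iff) auto
  then have "summable (\<lambda>n. real (Suc n) powr (- (1 + e)))"
    by (subst summable_Suc_iff)
  then show "summable (\<lambda>n. real (Suc n) powr (- (1 + e)) / e)"
    by (rule summable_divide)
  show "norm (ln (real (Suc n)) * real (Suc n) powr (- \<sigma>)) \<le> real (Suc n) powr (- (1 + e)) / e" for n
  proof -
    have "ln (real (Suc n)) * real (Suc n) powr (- \<sigma>) \<le> real (Suc n) powr e / e * real (Suc n) powr (- \<sigma>)"
      by (intro mult_right_mono ln_powr_bound e) auto
    also have "\<dots> = real (Suc n) powr (e - \<sigma>) / e"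
      by (simp add: powr_diff powr_minus field_simps del: of_nat_Suc)
    also have "e - \<sigma> = - (1 + e)" by (simp add: e_def field_simps)
    finally show ?thesis by (simp del: of_nat_Suc)
  qed
qed

lemma zeta_abs_summable:
  assumes "Re s > 1"
  shows "(\<lambda>n. of_nat n powr (- s) :: complex) abs_summable_on {1..}"
proof -
  have "summable (\<lambda>n. norm (of_nat (Suc n) powr (- s) :: complex))"
  proof -
    have "summable (\<lambda>n. of_nat n powr (- Re s) :: real)"
      using assms by (subst summable_real_powr_iff) auto
    then have "summable (\<lambda>n. of_nat (Suc n) powr (- Re s) :: real)"
      by (subst summable_Suc_iff)
    then show ?thesis by (simp only: norm_of_nat_Suc_powr uminus_complex.sel)
  qed
  then have "(\<lambda>n. norm (of_nat (Suc n) powr (- s) :: complex)) summable_on UNIV"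
    by (subst summable_on_UNIV_nonneg_real_iff) auto
  then show ?thesis
    unfolding summable_on_def has_sum_Suc_iff [where f = "\<lambda>n. norm (of_nat n powr (- s) :: complex)"] .
qed

lemma zeta_has_sum:
  assumes "Re s > 1"
  shows "((\<lambda>n. of_nat n powr (- s)) has_sum zeta s) {1..}"
proof -
  have "(\<lambda>n. of_nat n powr (- s) :: complex) summable_on {1..}"
    using zeta_abs_summable [OF assms] by (rule abs_summable_summable)
  then have *: "((\<lambda>n. of_nat n powr (- s) :: complex) has_sum infsum (\<lambda>n. of_nat n powr (- s)) {1..}) {1..}"
    by (rule has_sum_infsum)
  then have "((\<lambda>n. of_nat (Suc n) powr (- s) :: complex) has_sum infsum (\<lambda>n. of_nat n powr (- s)) {1..}) UNIV"
    by (subst has_sum_Suc_iff)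
  then have "(\<lambda>n. of_nat (Suc n) powr (- s)) sums (infsum (\<lambda>n. of_nat n powr (- s)) {1..} :: complex)"
    by (rule has_sum_imp_sums)
  then have "infsum (\<lambda>n. of_nat n powr (- s)) {1..} = zeta s"
    using zeta_series_sums [OF assms] zeta_eq_zeta_series [OF assms] sums_unique2 by metis
  with * show ?thesis by simp
qed

lemma ln_abs_summable:
  assumes "Re s > 1"
  shows "(\<lambda>n. of_real (ln (real n)) * of_nat n powr (- s) :: complex) abs_summable_on {1..}"
proof -
  have "(\<lambda>n. ln (real (Suc n)) * real (Suc n) powr (- Re s)) summable_on UNIV"
    using summable_ln_powr [OF assms] by (subst summable_on_UNIV_nonneg_real_iff) auto
  then have "(\<lambda>n. ln (real n) * real n powr (- Re s)) summable_on {1..}"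
    unfolding summable_on_def has_sum_Suc_iff [where f = "\<lambda>n. ln (real n) * real n powr (- Re s)"] .
  also have "?this \<longleftrightarrow> ?thesis"
    by (intro summable_on_cong) (auto simp: norm_mult norm_powr_real_powr)
  finally show ?thesis .
qed

lemma deriv_zeta_has_sum:
  assumes s: "Re s > 1"
  shows "((\<lambda>n. of_real (ln (real n)) * of_nat n powr (- s)) has_sum (- deriv zeta s)) {1..}"
proof -
  define S where "S = {s. Re s > 1}"
  have opn: "open S" unfolding S_def by (rule open_halfspace_Re_gt)
  define f where "f n s = (of_nat (Suc n) powr (- s) :: complex)" for n s
  define f' where "f' n s = - (of_real (ln (real (Suc n))) * of_nat (Suc n) powr (- s) :: complex)" for n s
  have "\<exists>g g'. \<forall>x\<in>S. (\<lambda>n. f n x) sums g x \<and> (\<lambda>n. f' n x) sums g' x \<and> (g has_field_derivative g' x) (at x)"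
  proof (rule series_and_derivative_comparison_local [OF opn])
    show "(f n has_field_derivative f' n x) (at x)" for n x
    proof -
      have "ln (of_nat (Suc n) :: complex) = of_real (ln (real (Suc n)))"
        using Ln_of_real [of "real (Suc n)"] by (simp del: of_nat_Suc)
      moreover have "(uminus has_field_derivative (- 1)) (at x)"
        by (auto intro!: derivative_eq_intros)
      ultimately show ?thesis
        using DERIV_chain2 [OF has_field_derivative_powr_right [of "of_nat (Suc n)"], of uminus "-1" x UNIV]
        unfolding f_def [abs_def] f'_def by (simp del: of_nat_Suc)
    qed
    fix s0 assume "s0 \<in> S"
    define d where "d = (Re s0 - 1) / 2"
    have d: "d > 0" using \<open>s0 \<in> S\<close> by (simp add: d_def S_def)
    have "summable (\<lambda>n. of_nat n powr (- (1 + d)) :: real)"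
      using d by (subst summable_real_powr_iff) auto
    then have "summable (\<lambda>n. real (Suc n) powr (- (1 + d)))"
      by (subst summable_Suc_iff)
    moreover have "norm (f n y) \<le> real (Suc n) powr (- (1 + d))" if "y \<in> ball s0 d \<inter> S" for n y
    proof -
      have "\<bar>Re (s0 - y)\<bar> < d"
        using that abs_Re_le_cmod [of "s0 - y"] by (auto simp: dist_norm)
      then have "Re y \<ge> 1 + d" by (auto simp: d_def field_simps abs_if split: if_splits)
      then show ?thesis
        unfolding f_def norm_of_nat_Suc_powr by (intro powr_mono) auto
    qed
    ultimately show "\<exists>d h. 0 < d \<and> summable h \<and> (\<forall>\<^sub>F n in sequentially. \<forall>y\<in>ball s0 d \<inter> S. norm (f n y) \<le> h n)"
      using d by (intro exI [of _ d] exI [of _ "\<lambda>n. real (Suc n) powr (- (1 + d))"]) auto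
  qed
  then obtain g g' where g: "\<And>x. x \<in> S \<Longrightarrow> (\<lambda>n. f n x) sums g x"
    "\<And>x. x \<in> S \<Longrightarrow> (\<lambda>n. f' n x) sums g' x"
    "\<And>x. x \<in> S \<Longrightarrow> (g has_field_derivative g' x) (at x)" by blast
  have sS: "s \<in> S" using s by (simp add: S_def)
  have gz: "g x = zeta x" if "x \<in> S" for x
  proof -
    have x: "Re x > 1" using that by (simp add: S_def)
    show ?thesis
      using sums_unique2 [OF g(1) [OF that, unfolded f_def] zeta_series_sums [OF x]]
      by (simp add: zeta_eq_zeta_series [OF x])
  qed
  have "(zeta has_field_derivative g' s) (at s)"
    by (rule has_field_derivative_transform_within_open [OF g(3) [OF sS] opn sS]) (rule gz)
  then have dz: "deriv zeta s = g' s" by (rule DERIV_imp_deriv)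
  let ?h = "\<lambda>n. of_real (ln (real n)) * of_nat n powr (- s) :: complex"
  have *: "(?h has_sum infsum ?h {1..}) {1..}"
    by (rule has_sum_infsum [OF abs_summable_summable [OF ln_abs_summable [OF s]]])
  then have "((\<lambda>n. ?h (Suc n)) has_sum infsum ?h {1..}) UNIV"
    by (subst has_sum_Suc_iff)
  then have "(\<lambda>n. ?h (Suc n)) sums infsum ?h {1..}"
    by (rule has_sum_imp_sums)
  moreover have "(\<lambda>n. ?h (Suc n)) sums (- g' s)"
    using sums_minus [OF g(2) [OF sS]] by (simp add: f'_def)
  ultimately have "infsum ?h {1..} = - g' s" by (rule sums_unique2)
  with * show ?thesis by (simp add: dz)
qed

lemma mangoldt_abs_summable:
  assumes "Re s > 1"
  shows "(\<lambda>n. mangoldt n * of_nat n powr (- s) :: complex) abs_summable_on {1..}"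
proof (rule Infinite_Sum.abs_summable_on_comparison_test [OF ln_abs_summable [OF assms]])
  fix n :: nat assume "n \<in> {1..}"
  then show "norm (mangoldt n * of_nat n powr (- s) :: complex) \<le>
      norm (of_real (ln (real n)) * of_nat n powr (- s) :: complex)"
    using mangoldt_le [of n] unfolding norm_mult
    by (intro mult_right_mono) (auto simp: norm_mangoldt)
qed

definition mangoldt_series :: "complex \<Rightarrow> complex" where
  "mangoldt_series s = infsum (\<lambda>n. mangoldt n * of_nat n powr (- s)) {1..}"

lemma mangoldt_has_sum:
  assumes "Re s > 1"
  shows "((\<lambda>n. mangoldt n * of_nat n powr (- s)) has_sum mangoldt_series s) {1..}"
  unfolding mangoldt_series_def
  by (rule has_sum_infsum [OF abs_summable_summable [OF mangoldt_abs_summable [OF assms]]])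

text \<open>The von Mangoldt function summed over the divisors of \<open>n\<close> is
  \<open>ln n\<close>, so the absolutely convergent double series is regrouped by the product of its
  two indices. The identity is kept free of division because the nonvanishing of \<open>zeta\<close>
  is deduced from it afterwards.\<close>

lemma deriv_zeta:
  assumes s: "Re s > 1"
  shows "deriv zeta s = - (mangoldt_series s * zeta s)"
proof -
  define a where "a n = (mangoldt n * of_nat n powr (- s) :: complex)" for n
  define b where "b n = (of_nat n powr (- s) :: complex)" for n
  have abs: "(\<lambda>(m, n). a m * b n) abs_summable_on {1..} \<times> {1..}"
    unfolding Infinite_Sum.abs_summable_on_Sigma_iff
  proof
    have b: "(\<lambda>n. norm (b n)) summable_on {1..}"
      using zeta_abs_summable [OF s] unfolding b_def .
    show "\<forall>x\<in>{1..}. (\<lambda>y. case (x, y) of (m, n) \<Rightarrow> a m * b n) abs_summable_on {1..}"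
      using b by (auto simp: norm_mult intro!: summable_on_cmult_right)
    have "(\<lambda>m. norm (a m) * infsum (\<lambda>n. norm (b n)) {1..}) summable_on {1..}"
      using mangoldt_abs_summable [OF s] unfolding a_def by (intro summable_on_cmult_left)
    then show "(\<lambda>x. \<Sum>\<^sub>\<infinity>y\<in>{1..}. norm (case (x, y) of (m, n) \<Rightarrow> a m * b n)) abs_summable_on {1..}"
      by (simp add: norm_mult infsum_cmult_right' infsum_nonneg)
  qed
  have "((\<lambda>(m, n). a m * b n) has_sum mangoldt_series s * zeta s) ({1..} \<times> {1..})"
  proof (rule has_sum_SigmaI)
    show "((\<lambda>m. a m * zeta s) has_sum mangoldt_series s * zeta s) {1..}"
      using mangoldt_has_sum [OF s] unfolding a_def by (rule has_sum_cmult_left)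
    show "((\<lambda>y. case (x, y) of (m, n) \<Rightarrow> a m * b n) has_sum a x * zeta s) {1..}" for x
      using has_sum_cmult_right [OF zeta_has_sum [OF s], of "a x"] by (simp add: b_def)
    show "(\<lambda>(m, n). a m * b n) summable_on {1..} \<times> {1..}"
      using abs by (rule abs_summable_summable)
  qed
  also have "?this \<longleftrightarrow> ((\<lambda>(n, d). mangoldt d * of_nat n powr (- s)) has_sum mangoldt_series s * zeta s)
      (SIGMA n:{1..}. {d. d dvd n})"
  proof (rule has_sum_reindex_bij_witness [of _ "\<lambda>(n, d). (d, n div d)" "\<lambda>(d, m). (d * m, d)"])
    show "(case case x of (d, m) \<Rightarrow> (d * m, d) of (n, d) \<Rightarrow> mangoldt d * of_nat n powr - s) =
        (case x of (m, n) \<Rightarrow> a m * b n)" for x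
      unfolding a_def b_def by (cases x) (simp only: prod.case of_nat_powr_mult mult.assoc)
  qed (auto simp: Suc_le_eq intro: dvd_pos_nat elim: dvdE)
  finally have "((\<lambda>n. \<Sum>d | d dvd n. mangoldt d * of_nat n powr (- s)) has_sum mangoldt_series s * zeta s) {1..}"
  proof (rule has_sum_Sigma')
    show "((\<lambda>y. case (x, y) of (n, d) \<Rightarrow> mangoldt d * of_nat n powr - s) has_sum
         (\<Sum>d | d dvd x. mangoldt d * of_nat x powr (- s))) {d. d dvd x}" if "x \<in> {1..}" for x
      using that by (auto intro!: has_sum_finiteI finite_divisors_nat)
  qed
  also have "?this \<longleftrightarrow> ((\<lambda>n. of_real (ln (real n)) * of_nat n powr (- s)) has_sum mangoldt_series s * zeta s) {1..}"
    by (intro has_sum_cong) (auto simp: mangoldt_sum sum_distrib_right [symmetric])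
  finally show ?thesis
    using has_sum_unique [OF deriv_zeta_has_sum [OF s]] by (simp add: minus_equation_iff)
qed

lemma mangoldt_series_bound:
  assumes "\<sigma> > 1" "Re s \<ge> \<sigma>"
  shows "norm (mangoldt_series s) \<le> infsum (\<lambda>n. mangoldt n * real n powr (- \<sigma>)) {1..}"
    and "(\<lambda>n. mangoldt n * real n powr (- \<sigma>)) summable_on {1..}"
proof -
  have eq: "norm (mangoldt n * of_nat n powr (- s) :: complex) = mangoldt n * real n powr (- Re s)"
    if "n \<ge> 1" for n s
    using that by (simp add: norm_mult norm_mangoldt norm_powr_real_powr)
  have 1: "(\<lambda>n. mangoldt n * real n powr (- Re s)) summable_on {1..}" if "Re s > 1" for s
    using mangoldt_abs_summable [OF that]
    by (rule iffD1 [OF summable_on_cong, rotated]) (use eq in auto)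
  show 2: "(\<lambda>n. mangoldt n * real n powr (- \<sigma>)) summable_on {1..}"
    using 1 [of "of_real \<sigma>"] assms by simp
  have "norm (mangoldt_series s) \<le> infsum (\<lambda>n. norm (mangoldt n * of_nat n powr (- s) :: complex)) {1..}"
    unfolding mangoldt_series_def using assms
    by (intro norm_infsum_bound mangoldt_abs_summable) auto
  also have "\<dots> = infsum (\<lambda>n. mangoldt n * real n powr (- Re s)) {1..}"
    by (rule infsum_cong) (use eq in auto)
  also have "\<dots> \<le> infsum (\<lambda>n. mangoldt n * real n powr (- \<sigma>)) {1..}"
    using assms by (intro infsum_mono 1 2 mult_left_mono powr_mono mangoldt_nonneg) auto
  finally show "norm (mangoldt_series s) \<le> infsum (\<lambda>n. mangoldt n * real n powr (- \<sigma>)) {1..}" .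
qed

text \<open>The terms from \<open>n = 2\<close> on are compared with \<open>1 / n ^ 2 / 2\<close>,
  and \<open>pi < 4\<close> makes their sum at most \<open>5 / 6\<close>. The bound supplies the
  value at the centre \<open>Complex 3 t\<close> of the discs in which zeros are counted.\<close>

lemma norm_zeta_ge:
  assumes "Re s \<ge> 3"
  shows "norm (zeta s) \<ge> 1 / 6"
proof -
  have s: "Re s > 1" using assms by simp
  have sums: "(\<lambda>n. of_nat (Suc n) powr (- s)) sums zeta s"
    using zeta_series_sums [OF s] by (simp only: zeta_eq_zeta_series [OF s])
  have tail: "(\<lambda>n. of_nat (Suc (Suc n)) powr (- s)) sums (zeta s - 1)"
    using iffD2 [OF sums_Suc_iff, of "\<lambda>n. of_nat (Suc n) powr (- s)" "zeta s - 1"] sums by simp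
  have "(\<lambda>n. 1 / (real n + 1) ^ 2) sums (pi ^ 2 / 6)"
    using inverse_squares_sums by (simp add: add.commute)
  then have "(\<lambda>n. 1 / (real (Suc n)) ^ 2) sums (pi ^ 2 / 6)" by (simp add: add.commute)
  then have sq: "(\<lambda>n. 1 / (real (Suc (Suc n))) ^ 2) sums (pi ^ 2 / 6 - 1)"
    using iffD2 [OF sums_Suc_iff, of "\<lambda>n. 1 / (real (Suc n)) ^ 2" "pi ^ 2 / 6 - 1"] by simp
  have "norm (zeta s - 1) \<le> (pi ^ 2 / 6 - 1) / 2"
  proof (rule norm_sums_le [OF tail sums_divide [OF sq]])
    fix n
    let ?x = "real (Suc (Suc n))"
    have "norm (of_nat (Suc (Suc n)) powr (- s) :: complex) = ?x powr (- Re s)"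
      by (simp only: norm_of_nat_Suc_powr uminus_complex.sel)
    also have "\<dots> \<le> ?x powr (- 3)"
      using assms by (intro powr_mono) auto
    also have "?x powr (- 3) = 1 / ?x ^ 2 / ?x"
      using powr_realpow [of ?x 3] by (simp add: powr_minus field_simps power2_eq_square power3_eq_cube del: of_nat_Suc)
    also have "\<dots> \<le> 1 / ?x ^ 2 / 2" by (intro divide_left_mono) auto
    finally show "norm (of_nat (Suc (Suc n)) powr (- s) :: complex) \<le> 1 / ?x ^ 2 / 2" .
  qed
  moreover have "pi ^ 2 \<le> 4 ^ 2" using pi_less_4 by (intro power_mono) auto
  moreover have "norm (1 :: complex) \<le> norm (zeta s) + norm (zeta s - 1)"
    by (metis norm_minus_commute norm_triangle_sub add.commute)
  ultimately show ?thesis by simp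
qed

text \<open>
  No Euler product is needed: near a zero the logarithmic derivative would be unbounded, whereas the
  von Mangoldt series is bounded.
\<close>

lemma zeta_nonzero_Re_gt_1:
  assumes s: "Re s > 1"
  shows "zeta s \<noteq> 0"
proof
  assume zs: "zeta s = 0"
  define U where "U = {s. Re s > 1}"
  have U: "open U" "connected U"
    unfolding U_def by (auto intro: open_halfspace_Re_gt convex_connected convex_halfspace_Re_gt)
  have hol: "zeta holomorphic_on U"
    by (rule holomorphic_on_subset [OF zeta_holomorphic]) (auto simp: U_def)
  have sU: "s \<in> U" using s by (simp add: U_def)
  have "zeta 3 \<noteq> 0" using norm_zeta_ge [of 3] by auto
  then have nz: "\<exists>w\<in>U. zeta w \<noteq> 0" by (intro bexI [of _ 3]) (auto simp: U_def)
  define n where "n = nat (zorder zeta s)"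
  obtain g where g: "g holomorphic_on U" "g s \<noteq> 0" and eq: "\<And>w. w \<in> U \<Longrightarrow> zeta w = (w - s) ^ n * g w"
    using holomorphic_split_zero [OF hol U sU nz] unfolding n_def by metis
  have n: "n > 0" using eq [OF sU] zs g by (cases n) auto
  define \<sigma> where "\<sigma> = (1 + Re s) / 2"
  define B where "B = infsum (\<lambda>n. mangoldt n * real n powr (- \<sigma>)) {1..}"
  have \<sigma>: "\<sigma> > 1" "\<sigma> < Re s" using s by (auto simp: \<sigma>_def)
  \<comment> \<open>The relation \<open>zeta' = - (mangoldt_series * zeta)\<close> is divided by
    \<open>(w - s) ^ (n - 1)\<close>. Everything but \<open>n * g\<close> keeps a factor
    \<open>w - s\<close>, so letting \<open>w\<close> tend to \<open>s\<close> forces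
    \<open>n * g s = 0\<close>.\<close>
  have key: "of_nat n * g w = - ((w - s) * (deriv g w + mangoldt_series w * g w))"
    if "w \<in> U" "w \<noteq> s" for w
  proof -
    have "(zeta has_field_derivative of_nat n * (w - s) ^ (n - 1) * g w + deriv g w * (w - s) ^ n) (at w)"
    proof (rule has_field_derivative_transform_within_open [OF _ U(1) that(1)])
      show "((\<lambda>w. (w - s) ^ n * g w) has_field_derivative
          of_nat n * (w - s) ^ (n - 1) * g w + deriv g w * (w - s) ^ n) (at w)"
        using holomorphic_derivI [OF g(1) U(1) that(1)]
        by (auto intro!: derivative_eq_intros)
    qed (rule eq [symmetric])
    then have "deriv zeta w = of_nat n * (w - s) ^ (n - 1) * g w + deriv g w * (w - s) ^ n"
      by (rule DERIV_imp_deriv)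
    also have "deriv zeta w = - (mangoldt_series w * zeta w)"
      using that by (intro deriv_zeta) (simp add: U_def)
    also have "zeta w = (w - s) ^ n * g w" by (rule eq [OF that(1)])
    also have "(w - s) ^ n = (w - s) ^ (n - 1) * (w - s)" using n by (cases n) auto
    finally have "(w - s) ^ (n - 1) * (of_nat n * g w + (w - s) * (deriv g w + mangoldt_series w * g w)) = 0"
      by (simp add: algebra_simps)
    then show ?thesis using that(2) by (simp add: eq_neg_iff_add_eq_0)
  qed
  have contg: "isCont g s" "isCont (deriv g) s"
    using continuous_on_interior [of U g s] continuous_on_interior [of U "deriv g" s] U sU
      holomorphic_on_imp_continuous_on [OF g(1)]
      holomorphic_on_imp_continuous_on [OF holomorphic_deriv [OF g(1) U(1)]]
    by (auto simp: interior_open)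
  have lim1: "((\<lambda>w. norm (w - s) * (norm (deriv g w) + B * norm (g w))) \<longlongrightarrow>
      norm (s - s) * (norm (deriv g s) + B * norm (g s))) (at s)"
    using contg by (intro tendsto_intros) (auto simp: isCont_def)
  have ev: "\<forall>\<^sub>F w in at s. w \<in> {w. Re w > \<sigma>} - {s}"
    using \<sigma> by (intro eventually_at_in_open open_halfspace_Re_gt) auto
  have "((\<lambda>w. of_nat n * g w) \<longlongrightarrow> 0) (at s)"
  proof (rule Lim_null_comparison [OF _ lim1 [simplified]])
    show "\<forall>\<^sub>F w in at s. norm (of_nat n * g w) \<le> norm (w - s) * (norm (deriv g w) + B * norm (g w))"
      using ev
    proof eventually_elim
      case (elim w)
      then have w: "w \<in> U" "w \<noteq> s" "Re w \<ge> \<sigma>" using \<sigma> by (auto simp: U_def)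
      have "norm (of_nat n * g w) = norm (w - s) * norm (deriv g w + mangoldt_series w * g w)"
        unfolding key [OF w(1,2)] by (simp add: norm_mult)
      also have "norm (deriv g w + mangoldt_series w * g w) \<le> norm (deriv g w) + norm (mangoldt_series w) * norm (g w)"
        using norm_triangle_ineq [of "deriv g w" "mangoldt_series w * g w"] by (simp add: norm_mult)
      also have "norm (mangoldt_series w) * norm (g w) \<le> B * norm (g w)"
        unfolding B_def by (intro mult_right_mono mangoldt_series_bound \<sigma> w) auto
      finally show ?case by (simp add: mult_left_mono)
    qed
  qed
  moreover have "((\<lambda>w. of_nat n * g w) \<longlongrightarrow> of_nat n * g s) (at s)"
    using contg by (intro tendsto_intros) (auto simp: isCont_def)
  ultimately have "of_nat n * g s = 0"
    using tendsto_unique [OF at_neq_bot] by blast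
  then show False using n g(2) by simp
qed

section \<open>Growth in the upper half-plane\<close>

definition poly_growth :: "(complex \<Rightarrow> complex) \<Rightarrow> complex set \<Rightarrow> bool" where
  "poly_growth F S \<longleftrightarrow> (\<exists>A\<ge>0. \<exists>k::nat. \<forall>s\<in>S. norm (F s) \<le> A * (1 + norm s) ^ k)"

lemma poly_growthI:
  "A \<ge> 0 \<Longrightarrow> (\<And>s. s \<in> S \<Longrightarrow> norm (F s) \<le> A * (1 + norm s) ^ k) \<Longrightarrow> poly_growth F S"
  unfolding poly_growth_def by blast

lemma poly_growth_const: "poly_growth (\<lambda>_. c) S"
  by (rule poly_growthI [of "norm c" _ _ 0]) auto

lemma poly_growth_id: "poly_growth (\<lambda>s. s) S"
  by (rule poly_growthI [of 1 _ _ 1]) auto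

lemma poly_growth_mult:
  assumes "poly_growth F S" "poly_growth G S"
  shows "poly_growth (\<lambda>s. F s * G s) S"
proof -
  obtain A k where A: "A \<ge> 0" "\<forall>s\<in>S. norm (F s) \<le> A * (1 + norm s) ^ k"
    using assms(1) unfolding poly_growth_def by blast
  obtain B l where B: "B \<ge> 0" "\<forall>s\<in>S. norm (G s) \<le> B * (1 + norm s) ^ l"
    using assms(2) unfolding poly_growth_def by blast
  show ?thesis
  proof (rule poly_growthI [of "A * B" _ _ "k + l"])
    fix s assume s: "s \<in> S"
    have "norm (F s * G s) \<le> (A * (1 + norm s) ^ k) * (B * (1 + norm s) ^ l)"
      unfolding norm_mult using A B s by (intro mult_mono) auto
    then show "norm (F s * G s) \<le> A * B * (1 + norm s) ^ (k + l)"
      by (simp add: power_add mult_ac)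
  qed (use A B in auto)
qed

lemma poly_growth_add:
  assumes "poly_growth F S" "poly_growth G S"
  shows "poly_growth (\<lambda>s. F s + G s) S"
proof -
  obtain A k where A: "A \<ge> 0" "\<forall>s\<in>S. norm (F s) \<le> A * (1 + norm s) ^ k"
    using assms(1) unfolding poly_growth_def by blast
  obtain B l where B: "B \<ge> 0" "\<forall>s\<in>S. norm (G s) \<le> B * (1 + norm s) ^ l"
    using assms(2) unfolding poly_growth_def by blast
  show ?thesis
  proof (rule poly_growthI [of "A + B" _ _ "k + l"])
    fix s assume s: "s \<in> S"
    have p: "(1 + norm s) ^ k \<le> (1 + norm s) ^ (k + l)" "(1 + norm s) ^ l \<le> (1 + norm s) ^ (k + l)"
      by (intro power_increasing; simp)+
    have "norm (F s + G s) \<le> norm (F s) + norm (G s)" by (rule norm_triangle_ineq)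
    also have "\<dots> \<le> A * (1 + norm s) ^ k + B * (1 + norm s) ^ l"
      using A B s by (intro add_mono) auto
    also have "\<dots> \<le> A * (1 + norm s) ^ (k + l) + B * (1 + norm s) ^ (k + l)"
      using A B p by (intro add_mono mult_left_mono) auto
    finally show "norm (F s + G s) \<le> (A + B) * (1 + norm s) ^ (k + l)"
      by (simp add: algebra_simps)
  qed (use A B in auto)
qed

lemma poly_growth_diff:
  assumes "poly_growth F S" "poly_growth G S"
  shows "poly_growth (\<lambda>s. F s - G s) S"
  using poly_growth_add [OF assms(1) poly_growth_mult [OF poly_growth_const [of "-1"] assms(2)]] by simp

lemma poly_growth_sum:
  "(\<And>i. i \<in> I \<Longrightarrow> poly_growth (F i) S) \<Longrightarrow> poly_growth (\<lambda>s. \<Sum>i\<in>I. F i s) S"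
  by (induction I rule: infinite_finite_induct) (auto intro: poly_growth_add poly_growth_const)

lemma poly_growth_prod:
  "(\<And>i. i \<in> I \<Longrightarrow> poly_growth (F i) S) \<Longrightarrow> poly_growth (\<lambda>s. \<Prod>i\<in>I. F i s) S"
  by (induction I rule: infinite_finite_induct) (auto intro: poly_growth_mult poly_growth_const)

lemma poly_growth_shift:
  assumes "poly_growth F S" "\<And>s. s \<in> S' \<Longrightarrow> s + a \<in> S"
  shows "poly_growth (\<lambda>s. F (s + a)) S'"
proof -
  obtain A k where A: "A \<ge> 0" "\<forall>s\<in>S. norm (F s) \<le> A * (1 + norm s) ^ k"
    using assms(1) unfolding poly_growth_def by blast
  show ?thesis
  proof (rule poly_growthI [of "A * (1 + norm a) ^ k" _ _ k])
    fix s assume s: "s \<in> S'"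
    have "norm (F (s + a)) \<le> A * (1 + norm (s + a)) ^ k"
      using A assms(2) s by auto
    also have "1 + norm (s + a) \<le> (1 + norm a) * (1 + norm s)"
    proof -
      have "0 \<le> norm a * norm s" by simp
      moreover have "(1 + norm a) * (1 + norm s) = 1 + norm a + norm s + norm a * norm s"
        by (simp add: algebra_simps)
      ultimately show ?thesis using norm_triangle_ineq [of s a] by linarith
    qed
    then have "A * (1 + norm (s + a)) ^ k \<le> A * ((1 + norm a) * (1 + norm s)) ^ k"
      using A by (intro mult_left_mono power_mono) auto
    finally show "norm (F (s + a)) \<le> A * (1 + norm a) ^ k * (1 + norm s) ^ k"
      by (simp add: power_mult_distrib)
  qed (use A in auto)
qed

lemma poly_growth_zeta_coeff: "poly_growth (zeta_coeff k) S"
  unfolding zeta_coeff_def [abs_def]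
  by (intro poly_growth_prod poly_growth_diff poly_growth_const poly_growth_id)

lemma poly_growth_bound:
  assumes "poly_growth F S" "\<And>s. s \<in> S \<Longrightarrow> norm (G s) \<le> C * norm (F s)" "C \<ge> 0"
  shows "poly_growth G S"
proof -
  obtain A k where A: "A \<ge> 0" "\<forall>s\<in>S. norm (F s) \<le> A * (1 + norm s) ^ k"
    using assms(1) unfolding poly_growth_def by blast
  show ?thesis
  proof (rule poly_growthI [of "C * A" _ _ k])
    fix s assume s: "s \<in> S"
    have "norm (G s) \<le> C * norm (F s)" by (rule assms(2) [OF s])
    also have "\<dots> \<le> C * (A * (1 + norm s) ^ k)" using A s assms(3) by (intro mult_left_mono) auto
    finally show "norm (G s) \<le> C * A * (1 + norm s) ^ k" by simp
  qed (use A assms(3) in auto)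
qed

lemma poly_growth_subset: "poly_growth F S \<Longrightarrow> S' \<subseteq> S \<Longrightarrow> poly_growth F S'"
  unfolding poly_growth_def by blast

text \<open>Each step moves the half-plane one unit to the left by the recurrence behind the
  continuation of \<open>zeta\<close>: shifted values of \<open>(s - 1) * zeta s\<close> are covered
  by the induction hypothesis, and the remainder series is dominated by the polynomial
  \<open>zeta_coeff\<close>. The margin \<open>1 / 2\<close> in \<open>3 / 2 - real m\<close> lets
  the fixed series over \<open>n powr (- (3 / 2))\<close> majorise it uniformly.\<close>

lemma poly_growth_mult_zeta:
  "poly_growth (\<lambda>s. (s - 1) * zeta s) {s. Re s \<ge> 3 / 2 - real m \<and> Im s > 0}"
proof (induction m)
  case 0
  have "summable (\<lambda>n. of_nat n powr (- (3 / 2)) :: real)"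
    by (subst summable_real_powr_iff) auto
  then have sm: "summable (\<lambda>n. real (Suc n) powr (- (3 / 2)))"
    by (subst summable_Suc_iff)
  have "poly_growth zeta {s. Re s \<ge> 3 / 2 - real 0 \<and> Im s > 0}"
  proof (rule poly_growthI [of "\<Sum>n. real (Suc n) powr (- (3 / 2))" _ _ 0])
    fix s assume "s \<in> {s. Re s \<ge> 3 / 2 - real 0 \<and> Im s > 0}"
    then have s: "Re s \<ge> 3 / 2" by simp
    then have s1: "Re s > 1" by simp
    have "norm (zeta s) \<le> (\<Sum>n. real (Suc n) powr (- (3 / 2)))"
    proof (rule norm_sums_le [OF zeta_series_sums [OF s1, folded zeta_eq_zeta_series [OF s1]] summable_sums [OF sm]])
      show "norm (of_nat (Suc n) powr (- s) :: complex) \<le> real (Suc n) powr (- (3 / 2))" for n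
        unfolding norm_of_nat_Suc_powr using s by (intro powr_mono) auto
    qed
    then show "norm (zeta s) \<le> (\<Sum>n. real (Suc n) powr (- (3 / 2))) * (1 + norm s) ^ 0" by simp
  qed (use sm in \<open>auto intro!: suminf_nonneg\<close>)
  then show ?case
    by (intro poly_growth_mult poly_growth_diff poly_growth_const poly_growth_id)
next
  case (Suc m)
  define M where "M = Suc m"
  define S where "S = {s. Re s > 1 - real M \<and> Im s > 0}"
  define R where "R = {s. Re s \<ge> 3 / 2 - real M \<and> Im s > 0}"
  have RS: "R \<subseteq> S" by (auto simp: R_def S_def)
  obtain G where G: "G holomorphic_on {s. Re s > 1 - real M}"
    "\<And>s. Re s > 1 - real M \<Longrightarrow> (\<lambda>n. zeta_rem M n s) sums G s"
    by (rule zeta_rem_series [of M]) (rule that)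
  \<comment> \<open>The right-hand side of \<open>zeta_recurrence\<close>, with \<open>zeta\<close>
    in place of \<open>zeta_series\<close> so that it makes sense to the left of the line
    \<open>Re s = 1\<close>.\<close>
  define F where "F s = 1 + G s - (\<Sum>k=2..M. zeta_coeff (k - 1) s * (1 / fact k) *
      ((s + of_nat (k - 1) - 1) * zeta (s + of_nat (k - 1))))" for s
  have conv: "convex S"
  proof -
    have "S = {s. Re s > 1 - real M} \<inter> {s. Im s > 0}" by (auto simp: S_def)
    then show ?thesis by (auto intro: convex_Int convex_halfspace_Re_gt convex_halfspace_Im_gt)
  qed
  have opS: "open S"
  proof -
    have "S = {s. Re s > 1 - real M} \<inter> {s. Im s > 0}" by (auto simp: S_def)
    then show ?thesis by (auto intro: open_Int open_halfspace_Re_gt open_halfspace_Im_gt)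
  qed
  have zh: "(\<lambda>s. zeta (s + of_nat j)) holomorphic_on S" for j
  proof -
    have "zeta \<circ> (\<lambda>s. s + of_nat j) holomorphic_on S"
      by (rule holomorphic_on_compose_gen [OF _ zeta_holomorphic])
         (auto intro!: holomorphic_intros simp: S_def complex_eq_iff)
    then show ?thesis by (simp add: o_def)
  qed
  have eq: "(s - 1) * zeta s = F s" if "s \<in> S" for s
  proof (rule analytic_continuation_open [of "{s. Re s > 1 \<and> Im s > 0}" S "\<lambda>s. (s - 1) * zeta s" F s])
    have "{s. Re s > 1 \<and> Im s > 0} = {s. Re s > 1} \<inter> {s. Im s > 0}" by auto
    then show "open {s. Re s > 1 \<and> Im s > 0}"
      by (auto intro: open_Int open_halfspace_Re_gt open_halfspace_Im_gt)
    have "Complex 2 1 \<in> {s. Re s > 1 \<and> Im s > 0}" by simp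
    then show "{s. Re s > 1 \<and> Im s > 0} \<noteq> {}" by blast
    show "(\<lambda>s. (s - 1) * zeta s) holomorphic_on S"
      using zh [of 0] by (intro holomorphic_intros) auto
    have "G holomorphic_on S" by (rule holomorphic_on_subset [OF G(1)]) (auto simp: S_def)
    then show "F holomorphic_on S"
      unfolding F_def [abs_def] by (intro holomorphic_intros zh)
    show "(z - 1) * zeta z = F z" if "z \<in> {s. Re s > 1 \<and> Im s > 0}" for z
    proof -
      have z: "Re z > 1" using that by simp
      have "(\<Sum>k=2..M. zeta_coeff (k - 1) z / fact k * ((z + of_nat k - 2) * zeta_series (z + of_nat k - 1))) =
        (\<Sum>k=2..M. zeta_coeff (k - 1) z * (1 / fact k) * ((z + of_nat (k - 1) - 1) * zeta (z + of_nat (k - 1))))"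
      proof (rule sum.cong)
        fix k assume "k \<in> {2..M}"
        then obtain j where j: "k = Suc j" by (cases k) auto
        have "Re (z + of_nat j) > 1" using z by simp
        then show "zeta_coeff (k - 1) z / fact k * ((z + of_nat k - 2) * zeta_series (z + of_nat k - 1)) =
          zeta_coeff (k - 1) z * (1 / fact k) * ((z + of_nat (k - 1) - 1) * zeta (z + of_nat (k - 1)))"
          using zeta_eq_zeta_series [of "z + of_nat j"] unfolding j by (simp add: algebra_simps del: fact_Suc)
      qed auto
      moreover have "(z - 1) * zeta_series z =
         1 + G z - (\<Sum>k=2..M. zeta_coeff (k - 1) z / fact k * ((z + of_nat k - 2) * zeta_series (z + of_nat k - 1)))"
        using z by (intro zeta_recurrence G(2)) (auto simp: M_def)
      ultimately show ?thesis using zeta_eq_zeta_series [OF z] by (simp add: F_def)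
    qed
  qed (use that opS convex_connected [OF conv] in \<open>auto simp: S_def\<close>)
  have "summable (\<lambda>n. of_nat n powr (- (3 / 2)) :: real)"
    by (subst summable_real_powr_iff) auto
  then have sm: "summable (\<lambda>n. real (Suc n) powr (- (3 / 2)))"
    by (subst summable_Suc_iff)
  define C where "C = (\<Sum>n. real (Suc n) powr (- (3 / 2)))"
  have C: "C \<ge> 0" unfolding C_def using sm by (auto intro!: suminf_nonneg)
  have "poly_growth G R"
  proof (rule poly_growth_bound [OF poly_growth_zeta_coeff [of "Suc M"] _ C])
    fix s assume "s \<in> R"
    then have s: "Re s \<ge> 3 / 2 - real M" by (simp add: R_def)
    have "norm (G s) \<le> norm (zeta_coeff (Suc M) s) * C"
    proof (rule norm_sums_le [OF G(2) sums_mult [OF summable_sums [OF sm, folded C_def]]])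
      fix n
      have "norm (zeta_rem M n s) \<le> norm (zeta_coeff (Suc M) s) * real (Suc n) powr (- Re s - real M) / fact M"
        using s by (intro zeta_rem_bound) auto
      also have "\<dots> \<le> norm (zeta_coeff (Suc M) s) * real (Suc n) powr (- Re s - real M) / 1"
        using fact_ge_1 [of M, where 'a = real] by (intro divide_left_mono) auto
      also have "\<dots> \<le> norm (zeta_coeff (Suc M) s) * real (Suc n) powr (- (3 / 2))"
        using s by (simp only: div_by_1) (intro mult_left_mono powr_mono, auto)
      finally show "norm (zeta_rem M n s) \<le> norm (zeta_coeff (Suc M) s) * real (Suc n) powr (- (3 / 2))" .
    qed (use s in auto)
    then show "norm (G s) \<le> C * norm (zeta_coeff (Suc M) s)" by (simp add: mult.commute)
  qed
  moreover have "poly_growth (\<lambda>s. zeta_coeff (k - 1) s * (1 / fact k) *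
      ((s + of_nat (k - 1) - 1) * zeta (s + of_nat (k - 1)))) R" if "k \<in> {2..M}" for k
  proof (rule poly_growth_mult [OF poly_growth_mult [OF poly_growth_zeta_coeff poly_growth_const]])
    show "poly_growth (\<lambda>s. (s + of_nat (k - 1) - 1) * zeta (s + of_nat (k - 1))) R"
      by (rule poly_growth_shift [OF Suc.IH]) (use that in \<open>auto simp: R_def M_def of_nat_diff\<close>)
  qed
  ultimately have "poly_growth F R"
    unfolding F_def [abs_def]
    by (intro poly_growth_diff poly_growth_add poly_growth_const poly_growth_sum)
  then have "poly_growth (\<lambda>s. (s - 1) * zeta s) R"
    by (rule poly_growth_bound [where C = 1]) (use eq RS in auto)
  then show ?case by (simp add: R_def M_def)
qed

section \<open>Zeros and the logarithmic derivative near a given height\<close>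

lemma zeta_poly_growth: "poly_growth zeta {s. Re s \<ge> - real m \<and> Im s \<ge> 1}"
proof (rule poly_growth_bound [where C = 1])
  show "poly_growth (\<lambda>s. (s - 1) * zeta s) {s. Re s \<ge> - real m \<and> Im s \<ge> 1}"
    by (rule poly_growth_subset [OF poly_growth_mult_zeta [of "m + 2"]]) auto
  fix s assume "s \<in> {s. Re s \<ge> - real m \<and> Im s \<ge> 1}"
  then have "1 \<le> norm (s - 1)" using abs_Im_le_cmod [of "s - 1"] by simp
  then show "norm (zeta s) \<le> 1 * norm ((s - 1) * zeta s)"
    using mult_right_mono [of 1 "norm (s - 1)" "norm (zeta s)"] by (simp add: norm_mult)
qed simp

text \<open>The centre \<open>Complex 3 t\<close> lies where \<open>zeta\<close> is bounded below.
  Radius 10 lets the half radius 5 reach all points at height \<open>t\<close> with real part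
  between -1 and 2. The tripled disc goes down to \<open>Re s = -27\<close>, and
  \<open>t \<ge> 40\<close> keeps it above height 1, away from the pole.\<close>

lemma zeta_deriv_over_zeta_local:
  obtains K T\<^sub>0 :: real where "K > 0" "T\<^sub>0 \<ge> 40"
    "\<And>t. t \<ge> T\<^sub>0 \<Longrightarrow> finite {z \<in> cball (Complex 3 t) 10. zeta z = 0}"
    "\<And>t. t \<ge> T\<^sub>0 \<Longrightarrow> (\<Sum>p\<in>{z \<in> cball (Complex 3 t) 10. zeta z = 0}. real (nat (zorder zeta p))) \<le> K * ln t"
    "\<And>t z. t \<ge> T\<^sub>0 \<Longrightarrow> dist (Complex 3 t) z \<le> 5 \<Longrightarrow> zeta z \<noteq> 0 \<Longrightarrow>
      norm (deriv zeta z / zeta z - (\<Sum>p\<in>{z \<in> cball (Complex 3 t) 10. zeta z = 0}. of_nat (nat (zorder zeta p)) / (z - p))) \<le> K * ln t"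
proof -
  obtain A k where A: "A \<ge> 0" and bd: "\<And>s. Re s \<ge> - real 27 \<Longrightarrow> Im s \<ge> 1 \<Longrightarrow> norm (zeta s) \<le> A * (1 + norm s) ^ k"
    using zeta_poly_growth [of 27] unfolding poly_growth_def by blast
  \<comment> \<open>The bound \<open>6 * A \<le> t\<close> replaces the growth constant by
    \<open>t / 6\<close>, whose \<open>1 / 6\<close> is the lower bound for \<open>zeta\<close> at
    the centre. The remaining power \<open>t ^ (1 + 2 * k)\<close> explains \<open>K0\<close>; the
    factor 5 in \<open>K\<close> covers both 2 and \<open>24 / 10 * 2\<close>.\<close>
  define T\<^sub>0 where "T\<^sub>0 = max 40 (6 * A)"
  define K0 where "K0 = 1 + 2 * real k"
  have K0: "K0 \<ge> 1" by (simp add: K0_def)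
  define K where "K = 5 * K0"
  have main: "norm (zeta z) \<le> norm (zeta (Complex 3 t)) * exp (K0 * ln t)"
    if t: "t \<ge> T\<^sub>0" and z: "z \<in> cball (Complex 3 t) (3 * 10)" for t z
  proof -
    have t40: "t \<ge> 40" "t \<ge> 6 * A" using t by (auto simp: T\<^sub>0_def)
    have d: "norm (Complex 3 t - z) \<le> 30" using z by (simp add: dist_norm)
    have "Re z \<ge> - 27" using abs_Re_le_cmod [of "Complex 3 t - z"] d by (simp)
    moreover have "Im z \<ge> 1" using abs_Im_le_cmod [of "Complex 3 t - z"] d t40 by (simp)
    ultimately have "norm (zeta z) \<le> A * (1 + norm z) ^ k" by (intro bd) auto
    also have "\<dots> \<le> A * (1 + (3 + t + 30)) ^ k"
    proof (intro mult_left_mono power_mono A)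
      have "norm z \<le> norm (Complex 3 t) + 30"
        using norm_triangle_ineq2 [of z "Complex 3 t"] d by (simp add: norm_minus_commute)
      moreover have "norm (Complex 3 t) \<le> 3 + t"
        using cmod_le [of "Complex 3 t"] t40 by simp
      ultimately show "1 + norm z \<le> 1 + (3 + t + 30)" by simp
    qed auto
    also have "A * (1 + (3 + t + 30)) ^ k \<le> A * (t ^ 2) ^ k"
    proof (intro mult_left_mono power_mono A)
      have "40 * t \<le> t * t" using t40 by (intro mult_right_mono) auto
      then show "1 + (3 + t + 30) \<le> t ^ 2" using t40 unfolding power2_eq_square by linarith
    qed (use t40 in auto)
    also have "\<dots> \<le> t / 6 * (t ^ 2) ^ k" using t40 by (intro mult_right_mono) auto
    also have "\<dots> = 1 / 6 * (t * t ^ (2 * k))" by (simp add: power_mult)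
    also have "t * t ^ (2 * k) = exp (K0 * ln t)"
    proof -
      have "exp (K0 * ln t) = t powr (1 + 2 * real k)" using t40 by (simp add: powr_def K0_def)
      also have "\<dots> = t powr real (Suc (2 * k))" by (simp add: algebra_simps)
      also have "\<dots> = t ^ (Suc (2 * k))" using t40 by (subst powr_realpow) auto
      finally show ?thesis by simp
    qed
    also have "1 / 6 * exp (K0 * ln t) \<le> norm (zeta (Complex 3 t)) * exp (K0 * ln t)"
      by (intro mult_right_mono norm_zeta_ge) auto
    finally show ?thesis .
  qed
  define U where "U = {s. Im s > 0}"
  have hol: "zeta holomorphic_on U"
    by (rule holomorphic_on_subset [OF zeta_holomorphic]) (auto simp: U_def)
  have U: "open U" "connected U"
    unfolding U_def by (auto intro: open_halfspace_Im_gt convex_connected convex_halfspace_Im_gt)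
  have sub: "cball (Complex 3 t) (3 * 10) \<subseteq> U" if t: "t \<ge> T\<^sub>0" for t
  proof
    fix z assume "z \<in> cball (Complex 3 t) (3 * 10)"
    then have "norm (Complex 3 t - z) \<le> 30" by (simp add: dist_norm)
    then have "\<bar>t - Im z\<bar> \<le> 30" using abs_Im_le_cmod [of "Complex 3 t - z"] by simp
    then show "z \<in> U" using t by (simp add: U_def T\<^sub>0_def abs_le_iff)
  qed
  have nz: "zeta (Complex 3 t) \<noteq> 0" for t using norm_zeta_ge [of "Complex 3 t"] by auto
  have r: "(10 :: real) > 0" by simp
  note L = zeros_in_disc [OF hol U sub r main nz]
  show ?thesis
  proof (rule that [of K T\<^sub>0])
    show "K > 0" using K0 by (simp add: K_def)
    show "T\<^sub>0 \<ge> 40" by (simp add: T\<^sub>0_def)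
    fix t assume t: "t \<ge> T\<^sub>0"
    have lnt: "ln t \<ge> 1"
    proof -
      have "exp 1 \<le> t" using e_less_272 t by (simp add: T\<^sub>0_def)
      then show ?thesis using t by (subst ln_ge_iff) (auto simp: T\<^sub>0_def)
    qed
    show "finite {z \<in> cball (Complex 3 t) 10. zeta z = 0}"
      by (rule L(1) [OF t t])
    have "(\<Sum>p\<in>{z \<in> cball (Complex 3 t) 10. zeta z = 0}. real (nat (zorder zeta p))) \<le> 2 * (K0 * ln t)"
      by (rule L(2) [OF t t])
    also have "\<dots> \<le> K * ln t" using lnt K0 by (simp add: K_def)
    finally show "(\<Sum>p\<in>{z \<in> cball (Complex 3 t) 10. zeta z = 0}. real (nat (zorder zeta p))) \<le> K * ln t" .
    fix z assume z: "dist (Complex 3 t) z \<le> 5" "zeta z \<noteq> 0"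
    have "norm (deriv zeta z / zeta z - (\<Sum>p\<in>{z \<in> cball (Complex 3 t) 10. zeta z = 0}. of_nat (nat (zorder zeta p)) / (z - p)))
       \<le> 24 * (K0 * ln t + 1) / 10"
      by (rule L(3) [OF t t]) (use z in auto)
    also have "\<dots> \<le> K * ln t"
    proof -
      have "1 * 1 \<le> K0 * ln t" using lnt K0 by (intro mult_mono) auto
      then show ?thesis by (simp add: K_def)
    qed
    finally show "norm (deriv zeta z / zeta z - (\<Sum>p\<in>{z \<in> cball (Complex 3 t) 10. zeta z = 0}. of_nat (nat (zorder zeta p)) / (z - p))) \<le> K * ln t" .
  qed
qed

section \<open>The functional equation\<close>

text \<open>
  For \<open>-1 < a < 0\<close> the integral of \<open>x powr (a - 1) * (1 / 2 - 1 / x + 1 / (exp x - 1))\<close> over the positive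
  reals is evaluated twice. The partial fractions of the hyperbolic cotangent lead to \<open>zeta (1 - a)\<close>, and
  the geometric series leads to \<open>zeta a\<close>, as the sum of the errors of the trapezoidal rule for
  \<open>v powr (- a)\<close>. All integrands are nonnegative, so sums and integrals may be interchanged freely.
\<close>

lemma nn_integral_powr_exp:
  assumes c: "c > -1" and v: "v > 0"
  shows "(\<integral>\<^sup>+x. ennreal (indicator {0<..} x * (x powr c * exp (- (v * x)))) \<partial>lborel) =
    ennreal (Gamma (c + 1) * v powr (- c - 1))"
proof -
  let ?f = "\<lambda>t. ennreal (indicator {0..} t * t powr c / exp t)"
  have "ennreal (Gamma (c + 1)) = (\<integral>\<^sup>+t. ?f t \<partial>lborel)"
    using Gamma_conv_nn_integral_real [of "c + 1"] c by simp
  also have "\<dots> = ennreal \<bar>v\<bar> * (\<integral>\<^sup>+x. ?f (0 + v * x) \<partial>lborel)"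
    using v by (intro nn_integral_real_affine) auto
  also have "(\<integral>\<^sup>+x. ?f (0 + v * x) \<partial>lborel) =
      (\<integral>\<^sup>+x. ennreal (v powr c) * ennreal (indicator {0<..} x * (x powr c * exp (- (v * x)))) \<partial>lborel)"
  proof (rule nn_integral_cong)
    fix x :: real
    show "?f (0 + v * x) = ennreal (v powr c) * ennreal (indicator {0<..} x * (x powr c * exp (- (v * x))))"
    proof (cases "x > 0")
      case True
      then have "indicator {0..} (0 + v * x) * (0 + v * x) powr c / exp (0 + v * x) = v powr c * (indicator {0<..} x * (x powr c * exp (- (v * x))))"
        using v by (simp add: powr_mult exp_minus field_simps)
      then show ?thesis by (simp add: ennreal_mult')
    next
      case False
      then show ?thesis using v by (cases "x = 0") (auto simp: indicator_def zero_le_mult_iff)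
    qed
  qed
  also have "\<dots> = ennreal (v powr c) * (\<integral>\<^sup>+x. ennreal (indicator {0<..} x * (x powr c * exp (- (v * x)))) \<partial>lborel)"
    by (rule nn_integral_cmult) auto
  finally have "ennreal (v powr (- c - 1)) * ennreal (Gamma (c + 1)) =
     (ennreal (v powr (- c - 1)) * ennreal \<bar>v\<bar> * ennreal (v powr c)) * (\<integral>\<^sup>+x. ennreal (indicator {0<..} x * (x powr c * exp (- (v * x)))) \<partial>lborel)"
    by (simp add: mult.assoc)
  also have "ennreal (v powr (- c - 1)) * ennreal \<bar>v\<bar> * ennreal (v powr c) = 1"
  proof -
    have "v powr (- c - 1) * v powr 1 * v powr c = 1"
      unfolding powr_add [symmetric] using v by simp
    then have "v powr (- c - 1) * v * v powr c = 1" using v by simp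
    then show ?thesis using v by (simp flip: ennreal_mult')
  qed
  finally show ?thesis using c by (simp add: mult.commute flip: ennreal_mult')
qed

text \<open>The substitution \<open>t = 1 / (1 + x\<^sup>2)\<close> turns this into half a Beta
  integral whose two parameters add up to 1. The Gamma product is left as it is until the reflection
  formula is applied in the functional equation.\<close>

lemma nn_integral_powr_over_1_plus_square:
  fixes a :: real
  assumes a: "-1 < a" "a < 1"
  shows "(\<integral>\<^sup>+x. ennreal (indicator {0<..} x * (x powr a / (1 + x\<^sup>2))) \<partial>lborel) =
    ennreal (Gamma ((1 + a) / 2) * Gamma ((1 - a) / 2) / 2)"
proof -
  define p where "p = (1 - a) / 2"
  define q where "q = (1 + a) / 2"
  have pq: "p > 0" "q > 0" "p + q = 1" "2 * q - 1 = a" using a by (auto simp: p_def q_def field_simps)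
  define g :: "real \<Rightarrow> real" where "g x = 1 / (1 + x\<^sup>2)" for x
  define g' :: "real \<Rightarrow> real" where "g' x = - (2 * x) / (1 + x\<^sup>2)\<^sup>2" for x
  define f where "f t = t powr (p - 1) * (1 - t) powr (q - 1)" for t :: real
  have pos: "1 + x\<^sup>2 > 0" for x :: real by (simp add: add_pos_nonneg)
  have img: "g ` {0<..} = {0<..<1}"
  proof
    show "g ` {0<..} \<subseteq> {0<..<1}" using pos by (auto simp: g_def field_simps)
    show "{0<..<1} \<subseteq> g ` {0<..}"
    proof
      fix t :: real assume t: "t \<in> {0<..<1}"
      have "t = g (sqrt (1 / t - 1))" using t by (simp add: g_def field_simps)
      moreover have "sqrt (1 / t - 1) \<in> {0<..}" using t by simp
      ultimately show "t \<in> g ` {0<..}" by blast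
    qed
  qed
  have inj: "inj_on g {0<..}"
    using pos by (auto simp: inj_on_def g_def field_simps)
  have der: "(g has_field_derivative g' x) (at x within {0<..})" for x
    unfolding g_def [abs_def] g'_def using pos [of x]
    by (auto intro!: derivative_eq_intros simp: power2_eq_square)
  have fB: "(f has_integral Beta p q) {0..1}"
    unfolding f_def using pq by (intro has_integral_Beta_real) auto
  have fB': "(f has_integral Beta p q) {0<..<1}"
    using fB by (simp add: has_integral_Icc_iff_Ioo)
  then have "f absolutely_integrable_on {0<..<1}"
    by (intro nonnegative_absolutely_integrable_1) (auto simp: f_def integrable_on_def)
  then have "(\<lambda>x. \<bar>g' x\<bar> * f (g x)) absolutely_integrable_on {0<..} \<and>
      integral {0<..} (\<lambda>x. \<bar>g' x\<bar> * f (g x)) = Beta p q"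
    using has_absolute_integral_change_of_variables_1' [of "{0<..}" g g' f "Beta p q"] der inj
      integral_unique [OF fB'] by (simp add: img)
  then have I0: "((\<lambda>x. \<bar>g' x\<bar> * f (g x)) has_integral Beta p q) {0<..}"
    using absolutely_integrable_on_def has_integral_integral by metis
  have eq: "\<bar>g' x\<bar> * f (g x) = 2 * (x powr a / (1 + x\<^sup>2))" if "x \<in> {0<..}" for x
  proof -
    have x: "x > 0" using that by simp
    define y where "y = 1 + x\<^sup>2"
    have y: "y > 0" using pos by (simp add: y_def)
    have e0: "1 - 1 / y = x\<^sup>2 / y" using y by (simp add: y_def field_simps)
    have e1: "(1 / y) powr (p - 1) = y powr (1 - p)"
      using y powr_minus_divide [of y "p - 1"] by (simp add: powr_divide)
    have e2: "(x\<^sup>2 / y) powr (q - 1) = (x\<^sup>2) powr (q - 1) * y powr (1 - q)"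
      using y x powr_minus_divide [of y "q - 1"] by (simp add: powr_divide)
    have "f (g x) = (1 / y) powr (p - 1) * (1 - 1 / y) powr (q - 1)"
      by (simp add: f_def g_def y_def)
    also have "\<dots> = y powr (1 - p) * ((x\<^sup>2) powr (q - 1) * y powr (1 - q))"
      unfolding e0 e1 e2 by (rule refl)
    also have "\<dots> = (x\<^sup>2) powr (q - 1) * y powr ((1 - p) + (1 - q))" by (simp only: powr_add mult_ac)
    also have "(1 - p) + (1 - q) = 1" using pq by simp
    also have "(x\<^sup>2) powr (q - 1) = x powr (2 * (q - 1))"
      using x by (simp add: powr_powr flip: powr_numeral)
    also have "2 * (q - 1) = a - 1" using pq by simp
    finally have "f (g x) = x powr (a - 1) * y" using y by simp
    moreover have "\<bar>g' x\<bar> = 2 * x / y\<^sup>2" using x by (simp add: g'_def y_def abs_mult)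
    moreover have "x powr (a - 1) = x powr a / x" using x by (simp add: powr_diff)
    ultimately have "\<bar>g' x\<bar> * f (g x) = 2 * x / y\<^sup>2 * (x powr a / x * y)" by simp
    also have "\<dots> = 2 * (x powr a / y)" using x y by (simp add: power2_eq_square)
    finally show ?thesis by (simp add: y_def)
  qed
  have "((\<lambda>x. 2 * (x powr a / (1 + x\<^sup>2))) has_integral Beta p q) {0<..}"
    by (rule has_integral_eq [OF eq I0])
  then have "((\<lambda>x. (1/2) * (2 * (x powr a / (1 + x\<^sup>2)))) has_integral (1/2) * Beta p q) {0<..}"
    by (rule has_integral_mult_right)
  then have I: "((\<lambda>x. x powr a / (1 + x\<^sup>2)) has_integral Beta p q / 2) {0<..}"
    by simp
  have "Beta p q = Gamma q * Gamma p" using pq by (simp add: Beta_def mult.commute)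
  then show ?thesis
    using nn_integral_has_integral_lebesgue [OF _ I] pos
    by (simp add: p_def q_def less_imp_le)
qed

text \<open>The right-hand side is \<open>coth (x / 2) / 2 - 1 / x\<close>. The logarithmic
  derivative of the reflection formula for \<open>rGamma\<close> at
  \<open>z = \<i> * x / (2 * pi)\<close> gives \<open>pi * cot (pi * z)\<close> as a difference of
  two Digamma values, and their series give the partial fractions.\<close>

lemma coth_partial_fractions:
  assumes x: "x > (0 :: real)"
  shows "(\<lambda>n. 2 * x / (x\<^sup>2 + (2 * pi * real (Suc n))\<^sup>2)) sums (1 / 2 - 1 / x + 1 / (exp x - 1))"
proof -
  define y where "y = x / (2 * pi)"
  have y: "y > 0" using x by (simp add: y_def)
  define z where "z = \<i> * complex_of_real y"
  have nz: "z \<noteq> 0" "1 - z \<noteq> 0" "z \<notin> \<int>\<^sub>\<le>\<^sub>0" "1 - z \<notin> \<int>\<^sub>\<le>\<^sub>0"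
    using y by (auto simp: z_def complex_eq_iff elim!: nonpos_Ints_cases)
  have s1: "(\<lambda>k. inverse (of_nat (Suc k)) - inverse (w + of_nat k)) sums (Digamma w + euler_mascheroni)"
    if "w \<noteq> 0" for w :: complex
    using summable_sums [OF summable_Digamma [OF that]] by (simp add: Digamma_def)
  have "(\<lambda>k. inverse (z + of_nat k) - inverse (1 - z + of_nat k)) sums (Digamma (1 - z) - Digamma z)"
    using sums_diff [OF s1 [OF nz(2)] s1 [OF nz(1)]] by simp
  moreover have refl: "Digamma (1 - z) - Digamma z = of_real pi * cos (of_real pi * z) / sin (of_real pi * z)"
    and sn: "sin (of_real pi * z) \<noteq> 0"
  proof -
    have d1: "((\<lambda>w. rGamma w * rGamma (1 - w)) has_field_derivative
        (Digamma (1 - z) - Digamma z) * (rGamma z * rGamma (1 - z))) (at z)"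
      using nz by (auto intro!: derivative_eq_intros simp: algebra_simps)
    have d2: "((\<lambda>w. sin (of_real pi * w) / of_real pi) has_field_derivative cos (of_real pi * z)) (at z)"
      by (auto intro!: derivative_eq_intros)
    have "(\<lambda>w :: complex. rGamma w * rGamma (1 - w)) = (\<lambda>w. sin (of_real pi * w) / of_real pi)"
      by (intro ext rGamma_reflection_complex)
    with d1 d2 have eq: "(Digamma (1 - z) - Digamma z) * (rGamma z * rGamma (1 - z)) = cos (of_real pi * z)"
      by (metis DERIV_unique)
    have "rGamma z * rGamma (1 - z) \<noteq> 0" using nz by (simp add: rGamma_eq_zero_iff)
    then show "sin (of_real pi * z) \<noteq> 0" by (simp add: rGamma_reflection_complex)
    then show "Digamma (1 - z) - Digamma z = of_real pi * cos (of_real pi * z) / sin (of_real pi * z)"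
      using eq by (simp add: rGamma_reflection_complex field_simps)
  qed
  ultimately have s2: "(\<lambda>k. inverse (z + of_nat k) - inverse (1 - z + of_nat k)) sums
     (of_real pi * cos (of_real pi * z) / sin (of_real pi * z))" by simp
  \<comment> \<open>Shifting the first family of terms by one index pairs \<open>z + (k + 1)\<close>
    with \<open>(k + 1) - z\<close>, whose product is the real number
    \<open>y\<^sup>2 + (k + 1)\<^sup>2\<close>. The term \<open>inverse z\<close> left over becomes
    the \<open>1 / x\<close> of the claim.\<close>
  have tel: "(\<lambda>k. inverse (z + of_nat (Suc k)) - inverse (z + of_nat k)) sums (0 - inverse (z + of_nat 0))"
    by (intro telescope_sums filterlim_compose [OF tendsto_inverse_0]
              tendsto_add_filterlim_at_infinity [OF tendsto_const] tendsto_of_nat)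
  have s3: "(\<lambda>k. inverse (z + of_nat (Suc k)) - inverse (1 - z + of_nat k)) sums
     (of_real pi * cos (of_real pi * z) / sin (of_real pi * z) - inverse z)"
    using sums_add [OF s2 tel] by simp
  have t: "inverse (z + of_nat (Suc k)) - inverse (1 - z + of_nat k) =
      - \<i> * complex_of_real (2 * y / (y\<^sup>2 + (real (Suc k))\<^sup>2))" for k
  proof -
    have n1: "z + of_nat (Suc k) \<noteq> 0" "1 - z + of_nat k \<noteq> 0"
      using y by (auto simp: z_def complex_eq_iff)
    have "y\<^sup>2 + (real (Suc k))\<^sup>2 > 0" using y by (simp add: add_pos_nonneg)
    have pr: "(z + of_nat (Suc k)) * (1 - z + of_nat k) = complex_of_real (y\<^sup>2 + (real (Suc k))\<^sup>2)"
      by (simp add: z_def complex_eq_iff power2_eq_square algebra_simps)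
    have "inverse (z + of_nat (Suc k)) - inverse (1 - z + of_nat k) =
      ((1 - z + of_nat k) - (z + of_nat (Suc k))) / ((z + of_nat (Suc k)) * (1 - z + of_nat k))"
      using n1 by (simp add: field_simps del: of_nat_Suc)
    also have "\<dots> = - \<i> * complex_of_real (2 * y / (y\<^sup>2 + (real (Suc k))\<^sup>2))"
      unfolding pr by (simp add: z_def algebra_simps)
    finally show ?thesis .
  qed
  have "(\<lambda>k. \<i> * (- \<i> * complex_of_real (2 * y / (y\<^sup>2 + (real (Suc k))\<^sup>2)))) sums
     (\<i> * (of_real pi * cos (of_real pi * z) / sin (of_real pi * z) - inverse z))"
    using sums_mult [OF s3, of \<i>] unfolding t .
  then have s4: "(\<lambda>k. complex_of_real (2 * y / (y\<^sup>2 + (real (Suc k))\<^sup>2))) sums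
     (\<i> * (of_real pi * cos (of_real pi * z) / sin (of_real pi * z) - inverse z))"
    by (simp flip: mult.assoc)
  define E where "E = exp (pi * y)"
  have E: "E > 1" using y by (simp add: E_def)
  have piz: "of_real pi * z = \<i> * complex_of_real (pi * y)" by (simp add: z_def)
  have "cos (of_real pi * z) / sin (of_real pi * z) = - \<i> * complex_of_real ((E + 1 / E) / (E - 1 / E))"
  proof -
    have w: "\<i> * (of_real pi * z) = complex_of_real (- (pi * y))"
      by (simp add: z_def complex_eq_iff)
    have e1: "exp (\<i> * (of_real pi * z)) = complex_of_real (1 / E)"
      unfolding w exp_of_real E_def by (simp add: exp_minus field_simps)
    have e2: "exp (- (\<i> * (of_real pi * z))) = complex_of_real E"
      unfolding w of_real_minus [symmetric] exp_of_real E_def by simp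
    have "1 / E < 1" using E by simp
    then have "E - 1 / E \<noteq> 0" using E by linarith
    then have ne: "complex_of_real (E - 1 / E) \<noteq> 0" by (metis of_real_eq_0_iff)
    have gen: "(A / 2) / (- D / (2 * \<i>)) = - \<i> * (A / D)" if "D \<noteq> 0" for A D :: complex
      using that by (simp add: field_simps)
    have "cos (of_real pi * z) = complex_of_real (E + 1 / E) / 2"
      unfolding cos_exp_eq e1 e2 by simp
    moreover have "sin (of_real pi * z) = - complex_of_real (E - 1 / E) / (2 * \<i>)"
      unfolding sin_exp_eq e1 e2 by simp
    ultimately show ?thesis using gen [OF ne] by (simp only: of_real_divide)
  qed
  moreover have "inverse z = - \<i> * complex_of_real (1 / y)"
    using y by (simp add: z_def field_simps)
  ultimately have "\<i> * (of_real pi * cos (of_real pi * z) / sin (of_real pi * z) - inverse z) =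
      complex_of_real (pi * ((E + 1 / E) / (E - 1 / E)) - 1 / y)"
    by (simp only: times_divide_eq_right [symmetric]) (simp add: algebra_simps)
  with s4 have "(\<lambda>k. complex_of_real (2 * y / (y\<^sup>2 + (real (Suc k))\<^sup>2))) sums
      complex_of_real (pi * ((E + 1 / E) / (E - 1 / E)) - 1 / y)" by simp
  then have "(\<lambda>k. 2 * y / (y\<^sup>2 + (real (Suc k))\<^sup>2)) sums (pi * ((E + 1 / E) / (E - 1 / E)) - 1 / y)"
    by (simp only: sums_of_real_iff)
  then have "(\<lambda>k. 1 / (2 * pi) * (2 * y / (y\<^sup>2 + (real (Suc k))\<^sup>2))) sums
      (1 / (2 * pi) * (pi * ((E + 1 / E) / (E - 1 / E)) - 1 / y))"
    by (rule sums_mult)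
  moreover have "1 / (2 * pi) * (2 * y / (y\<^sup>2 + (real (Suc k))\<^sup>2)) = 2 * x / (x\<^sup>2 + (2 * pi * real (Suc k))\<^sup>2)" for k
  proof -
    have p: "y\<^sup>2 + (real (Suc k))\<^sup>2 > 0" using y by (simp add: add_pos_nonneg)
    have xy: "x = 2 * pi * y" by (simp add: y_def)
    have "x\<^sup>2 + (2 * pi * real (Suc k))\<^sup>2 = (2 * pi)\<^sup>2 * (y\<^sup>2 + (real (Suc k))\<^sup>2)"
      unfolding xy by (simp add: power_mult_distrib algebra_simps del: of_nat_Suc)
    then show ?thesis using p unfolding xy
      by (simp add: divide_simps power2_eq_square del: of_nat_Suc)
  qed
  moreover have "1 / (2 * pi) * (pi * ((E + 1 / E) / (E - 1 / E)) - 1 / y) = 1 / 2 - 1 / x + 1 / (exp x - 1)"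
  proof -
    have "exp x = E * E" unfolding E_def y_def by (simp flip: exp_add)
    moreover have "E * E > 1" using E by (simp add: less_1_mult)
    moreover have "(E + 1 / E) / (E - 1 / E) = ((E * E + 1) / E) / ((E * E - 1) / E)"
      using E by (simp add: field_simps)
    then have "(E + 1 / E) / (E - 1 / E) = 1 + 2 / (E * E - 1)"
      using E \<open>E * E > 1\<close> by (simp add: field_simps)
    moreover have "1 / (2 * pi) * (pi * (1 + 2 / D) - 1 / y) = 1 / 2 - 1 / (2 * pi * y) + 1 / D" if "D > 0" for D
      using that y by (simp add: field_simps)
    moreover have "x = 2 * pi * y" by (simp add: y_def)
    ultimately show ?thesis by simp
  qed
  ultimately show ?thesis by simp
qed

text \<open>The quadratic is the Peano kernel of the trapezoidal rule: integrated against a second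
  derivative over \<open>[n, n + 1]\<close> it gives the error of the rule. Here the function is
  \<open>exp (- (x * v))\<close>, whose second derivative carries the factor
  \<open>x\<^sup>2\<close> that is divided out.\<close>

lemma has_integral_exp_quadratic:
  fixes x :: real
  assumes x: "x > 0"
  shows "((\<lambda>v. exp (- (x * v)) * ((v - real n) * (real n + 1 - v) / 2)) has_integral
    exp (- (x * real n)) * ((1 / 2 + 1 / x) * exp (- x) + 1 / 2 - 1 / x) / x\<^sup>2) {real n..real n + 1}"
proof -
  define p where "p v = (v - real n) * (real n + 1 - v) / 2" for v
  define p' where "p' v = (2 * real n + 1 - 2 * v) / 2" for v
  define F where "F v = - (exp (- (x * v)) * (x * p v + p' v - 1 / x)) / x\<^sup>2" for v
  have "((\<lambda>v. exp (- (x * v)) * p v) has_integral F (real n + 1) - F (real n)) {real n..real n + 1}"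
  proof (rule fundamental_theorem_of_calculus)
    fix v
    have d1: "(p has_real_derivative p' v) (at v)"
      unfolding p_def [abs_def] p'_def
      by (rule derivative_eq_intros refl | simp)+
    have d2: "(p' has_real_derivative - 1) (at v)"
      unfolding p'_def [abs_def] by (rule derivative_eq_intros refl | simp)+
    have d3: "((\<lambda>v. exp (- (x * v))) has_real_derivative - x * exp (- (x * v))) (at v)"
      by (rule derivative_eq_intros refl | simp)+
    have "((\<lambda>v. x * p v + p' v - 1 / x) has_real_derivative x * p' v + (- 1) - 0) (at v)"
      by (intro DERIV_diff DERIV_add DERIV_cmult d1 d2 DERIV_const)
    from DERIV_cdivide [OF DERIV_minus [OF DERIV_mult [OF d3 this]], of "x\<^sup>2"]
    have "(F has_real_derivative exp (- (x * v)) * p v) (at v)"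
      unfolding F_def [abs_def]
      by (rule DERIV_cong) (use x in \<open>simp add: algebra_simps power2_eq_square\<close>)
    then show "(F has_vector_derivative exp (- (x * v)) * p v) (at v within {real n..real n + 1})"
      by (rule has_vector_derivative_at_within [OF iffD1 [OF has_real_derivative_iff_has_vector_derivative]])
  qed simp
  also have "F (real n + 1) - F (real n) =
      exp (- (x * real n)) * ((1 / 2 + 1 / x) * exp (- x) + 1 / 2 - 1 / x) / x\<^sup>2"
  proof -
    have e: "exp (- (x * (real n + 1))) = exp (- (x * real n)) * exp (- x)"
      unfolding exp_add [symmetric] by (simp add: algebra_simps)
    have pv: "p (real n + 1) = 0" "p (real n) = 0" "p' (real n + 1) = - 1 / 2" "p' (real n) = 1 / 2"
      by (simp_all add: p_def p'_def)
    define G where "G = exp (- (x * real n))"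
    define D where "D = exp (- x)"
    have "- (G * D * (- 1 / 2 - 1 / x)) - (- (G * (1 / 2 - 1 / x))) = G * ((1 / 2 + 1 / x) * D + 1 / 2 - 1 / x)"
      by (simp add: algebra_simps)
    then show ?thesis unfolding F_def e pv G_def [symmetric] D_def [symmetric]
      by (simp add: diff_divide_distrib [symmetric])
  qed
  finally show ?thesis unfolding p_def .
qed

text \<open>Summed over \<open>n\<close>, the trapezoidal sums of \<open>exp (- (x * v))\<close>
  give \<open>1 / 2 + 1 / (exp x - 1)\<close> and the integrals give \<open>1 / x\<close>; the
  kernel is the total error of the rule on the half-line.\<close>

lemma coth_kernel_eq_suminf:
  fixes x :: real
  assumes x: "x > 0"
  shows "(\<lambda>n. x\<^sup>2 * (exp (- (x * real n)) * ((1 / 2 + 1 / x) * exp (- x) + 1 / 2 - 1 / x) / x\<^sup>2)) sums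
    (1 / 2 - 1 / x + 1 / (exp x - 1))"
proof -
  define c where "c = (1 / 2 + 1 / x) * exp (- x) + 1 / 2 - 1 / x"
  have "(\<lambda>n. exp (- x) ^ n) sums (1 / (1 - exp (- x)))"
    using x by (intro geometric_sums) auto
  then have "(\<lambda>n. exp (- x) ^ n * c) sums (1 / (1 - exp (- x)) * c)"
    by (rule sums_mult2)
  moreover have "exp (- x) ^ n * c = x\<^sup>2 * (exp (- (x * real n)) * c / x\<^sup>2)" for n
    using x by (simp add: mult.commute flip: exp_of_nat_mult)
  moreover have "1 / (1 - exp (- x)) * c = 1 / 2 - 1 / x + 1 / (exp x - 1)"
  proof -
    define E where "E = exp x"
    have E: "E > 1" using x by (simp add: E_def)
    have "exp (- x) = 1 / E" by (simp add: E_def exp_minus field_simps)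
    moreover have "1 / (1 - 1 / E) * ((1 / 2 + 1 / x) * (1 / E) + 1 / 2 - 1 / x) = 1 / 2 - 1 / x + 1 / (E - 1)"
      using E x by (simp add: divide_simps) (simp add: algebra_simps)
    ultimately show ?thesis unfolding c_def E_def [symmetric] by simp
  qed
  ultimately show ?thesis unfolding c_def by simp
qed

text \<open>Trapezoidal rule for \<open>v powr (- a)\<close> on \<open>[n, n + 1]\<close>, minus the
  exact integral. For \<open>n = 0\<close> the convention \<open>0 powr b = 0\<close> gives the
  right boundary values when \<open>-1 < a < 0\<close>, since both exponents are then
  positive.\<close>

definition trapezoid_err :: "nat \<Rightarrow> real \<Rightarrow> real" where
  "trapezoid_err n a = (real n powr (- a) + real (Suc n) powr (- a)) / 2 -
     (real (Suc n) powr (1 - a) - real n powr (1 - a)) / (1 - a)"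

lemma has_integral_powr_quadratic:
  fixes a :: real
  assumes a: "-1 < a" "a < 0"
  shows "((\<lambda>v. v powr (- a - 2) * ((v - real n) * (real n + 1 - v) / 2)) has_integral
    trapezoid_err n a / (a * (a + 1))) {real n..real n + 1}"
proof -
  define H where "H v = - (v powr (1 - a)) / (2 * (1 - a)) - (real n + 1 / 2) * v powr (- a) / a
    + real n * (real n + 1) / 2 * v powr (- a - 1) / (a + 1)" for v
  have nz: "a \<noteq> 0" "1 - a \<noteq> 0" "a + 1 \<noteq> 0" using a by auto
  have "((\<lambda>v. v powr (- a - 2) * ((v - real n) * (real n + 1 - v) / 2)) has_integral
      H (real n + 1) - H (real n)) {real n..real n + 1}"
  \<comment> \<open>For \<open>n = 0\<close> the derivative may fail at the endpoint 0, so only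
    continuity of \<open>H\<close> is asked for there. The singular power
    \<open>v powr (- a - 1)\<close> then has coefficient 0.\<close>
  proof (rule fundamental_theorem_of_calculus_interior)
    show "continuous_on {real n..real n + 1} H"
    proof (cases "n = 0")
      case True
      have "H = (\<lambda>v. - (v powr (1 - a)) / (2 * (1 - a)) - (1 / 2) * v powr (- a) / a)"
        by (simp add: H_def [abs_def] True)
      then show ?thesis using True a
        by (auto intro!: continuous_intros continuous_on_powr')
    next
      case False
      then show ?thesis unfolding H_def [abs_def] using nz
        by (auto intro!: continuous_intros)
    qed
    fix v assume v: "v \<in> {real n<..<real n + 1}"
    then have v0: "v > 0" by (auto intro: le_less_trans [of 0 "real n"])
    have "(H has_real_derivative
        - ((1 - a) * v powr (1 - a - 1)) / (2 * (1 - a)) - (real n + 1 / 2) * (- a * v powr (- a - 1)) / a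
        + real n * (real n + 1) / 2 * ((- a - 1) * v powr (- a - 1 - 1)) / (a + 1)) (at v)"
      unfolding H_def [abs_def] using v0 nz
      by (intro derivative_intros DERIV_cdivide DERIV_cmult has_real_derivative_powr) auto
    also have "- ((1 - a) * v powr (1 - a - 1)) / (2 * (1 - a)) - (real n + 1 / 2) * (- a * v powr (- a - 1)) / a
        + real n * (real n + 1) / 2 * ((- a - 1) * v powr (- a - 1 - 1)) / (a + 1) =
        v powr (- a - 2) * ((v - real n) * (real n + 1 - v) / 2)"
    proof -
      define P where "P = v powr (- a - 2)"
      have x: "1 - a - 1 = (- a - 2) + 2" "- a - 1 = (- a - 2) + 1" "- a - 1 - 1 = - a - 2" by simp_all
      have e1: "v powr (1 - a - 1) = P * v\<^sup>2"
        unfolding x(1) powr_add P_def using v0 by simp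
      have e3: "v powr (- a - 1 - 1) = P" unfolding x(3) P_def ..
      have e2: "v powr (- a - 1) = P * v"
        unfolding x(2) powr_add P_def using v0 by simp
      have "- ((1 - a) * (P * v\<^sup>2)) / (2 * (1 - a)) = - (P * v\<^sup>2) / 2"
        "(real n + 1 / 2) * (- a * (P * v)) / a = - ((real n + 1 / 2) * (P * v))"
        "real n * (real n + 1) / 2 * ((- a - 1) * P) / (a + 1) = - (real n * (real n + 1) / 2 * P)"
        using nz by (simp_all add: divide_simps) (simp_all add: algebra_simps)
      then show ?thesis unfolding e1 e2 e3 P_def [symmetric]
        by (simp add: power2_eq_square field_simps)
    qed
    finally show "(H has_vector_derivative v powr (- a - 2) * ((v - real n) * (real n + 1 - v) / 2)) (at v)"
      by (rule iffD1 [OF has_real_derivative_iff_has_vector_derivative])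
  qed simp
  also have "H (real n + 1) - H (real n) = trapezoid_err n a / (a * (a + 1))"
  proof -
    have e1: "(real n + 1) powr (1 - a) = (real n + 1) powr (- a) * (real n + 1)"
      "(real n + 1) powr (- a - 1) = (real n + 1) powr (- a) / (real n + 1)"
      using powr_add [of "real n + 1" "- a" 1] powr_diff [of "real n + 1" "- a" 1] by simp_all
    define X where "X = (real n + 1) powr (- a)"
    define Y where "Y = real n powr (- a)"
    have e2: "real n powr (1 - a) = Y * real n"
      using powr_add [of "real n" "- a" 1] by (cases "n = 0") (simp_all add: Y_def)
    have e3: "real n * (real n + 1) / 2 * real n powr (- a - 1) / (a + 1) = (real n + 1) / 2 * Y / (a + 1)"
    proof (cases "n = 0")
      case False
      then show ?thesis using powr_diff [of "real n" "- a" 1] by (simp add: Y_def)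
    next
      case True
      then show ?thesis by (simp add: Y_def)
    qed
    have e4: "real n * (real n + 1) / 2 * (X / (real n + 1)) / (a + 1) = real n / 2 * X / (a + 1)"
    proof -
      have "real n + 1 \<noteq> 0" by linarith
      then have "(real n + 1) * (X / (real n + 1)) = X" by simp
      moreover have "k * u / 2 * (X / u) / b = k / 2 * (u * (X / u)) / b" for k u b :: real by simp
      then have "real n * (real n + 1) / 2 * (X / (real n + 1)) / (a + 1) =
          real n / 2 * ((real n + 1) * (X / (real n + 1))) / (a + 1)" .
      ultimately show ?thesis by simp
    qed
    have e5: "real (Suc n) = real n + 1" by simp
    show ?thesis
      unfolding H_def trapezoid_err_def e5 e1 X_def [symmetric] Y_def [symmetric] e2 e3 e4
      using nz by (simp add: divide_simps) (simp add: algebra_simps)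
  qed
  finally show ?thesis .
qed

text \<open>The trapezoidal error for complex \<open>s\<close> is a combination of the Taylor
  remainder of order 1 at \<open>s + 1\<close> and that of order 2 at \<open>s\<close>, in which the
  terms with exponent \<open>- s - 1\<close> cancel. Hence the errors sum to a function holomorphic
  for \<open>Re s > -1\<close> off 1. For \<open>Re s > 1\<close> the sum can be evaluated directly,
  and the identity theorem carries it to \<open>-1 < a < 0\<close>.\<close>

lemma trapezoid_err_sums_zeta:
  fixes a :: real
  assumes a: "-1 < a" "a < 0"
  shows "(\<lambda>n. complex_of_real (trapezoid_err n a)) sums zeta (of_real a)"
proof -
  define E where "E n s = (of_nat (Suc n) powr (- s) + of_nat (Suc (Suc n)) powr (- s)) / 2 -
     (of_nat (Suc (Suc n)) powr (1 - s) - of_nat (Suc n) powr (1 - s)) / (1 - s)" for n and s :: complex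
  obtain G1 where G1: "G1 holomorphic_on {s. Re s > 1 - real 1}"
    "\<And>s. Re s > 1 - real 1 \<Longrightarrow> (\<lambda>n. zeta_rem 1 n s) sums G1 s"
    by (rule zeta_rem_series [of 1]) (rule that)
  obtain G2 where G2: "G2 holomorphic_on {s. Re s > 1 - real 2}"
    "\<And>s. Re s > 1 - real 2 \<Longrightarrow> (\<lambda>n. zeta_rem 2 n s) sums G2 s"
    by (rule zeta_rem_series [of 2]) (rule that)
  define D where "D = {s. Re s > - 1} - {1 :: complex}"
  have D: "open D" "connected D"
    unfolding D_def
    by (auto intro!: open_delete open_halfspace_Re_gt)
       (intro connected_open_delete open_halfspace_Re_gt convex_connected convex_halfspace_Re_gt, simp)
  have Esums: "(\<lambda>n. E n s) sums (G1 (s + 1) / 2 - G2 s / (1 - s))" if "s \<in> D" for s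
  proof -
    have s: "Re s > - 1" "s \<noteq> 1" using that by (auto simp: D_def)
    have "(\<lambda>n. zeta_rem 1 n (s + 1) / 2 - zeta_rem 2 n s / (1 - s)) sums (G1 (s + 1) / 2 - G2 s / (1 - s))"
      using s by (intro sums_diff sums_divide G1 G2) auto
    moreover have "zeta_rem 1 n (s + 1) / 2 - zeta_rem 2 n s / (1 - s) = E n s" for n
    proof -
      define w v :: complex where "w = of_nat (Suc n)" and "v = of_nat (Suc (Suc n))"
      have set: "{..2::nat} = {0, 1, 2}" "{..1::nat} = {0, 1}" by auto
      have c: "zeta_coeff 0 z = 1" "zeta_coeff 1 z = 1 - z" "zeta_coeff 2 z = (1 - z) * (- z)" for z
        by (auto simp: zeta_coeff_def numeral_2_eq_2)
      have "zeta_rem 1 n (s + 1) = v powr (1 - (s + 1)) -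
          (zeta_coeff 0 (s + 1) * w powr (1 - (s + 1) - of_nat 0) / fact 0 +
           zeta_coeff 1 (s + 1) * w powr (1 - (s + 1) - of_nat 1) / fact 1)"
        unfolding zeta_rem_def w_def [symmetric] v_def [symmetric] set by simp
      also have "\<dots> = v powr (- s) - w powr (- s) + s * w powr (- s - 1)"
        unfolding c by simp
      finally have R1: "zeta_rem 1 n (s + 1) = v powr (- s) - w powr (- s) + s * w powr (- s - 1)" .
      have "zeta_rem 2 n s = v powr (1 - s) -
          (zeta_coeff 0 s * w powr (1 - s - of_nat 0) / fact 0 +
           (zeta_coeff 1 s * w powr (1 - s - of_nat 1) / fact 1 + zeta_coeff 2 s * w powr (1 - s - of_nat 2) / fact 2))"
        unfolding zeta_rem_def w_def [symmetric] v_def [symmetric] set by simp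
      also have "1 - s - of_nat 2 = - s - 1" by simp
      also have "1 - s - of_nat 1 = - s" by simp
      also have "v powr (1 - s) -
          (zeta_coeff 0 s * w powr (1 - s - of_nat 0) / fact 0 +
           (zeta_coeff 1 s * w powr (- s) / fact 1 + zeta_coeff 2 s * w powr (- s - 1) / fact 2)) =
          v powr (1 - s) - w powr (1 - s) - (1 - s) * w powr (- s) + (1 - s) * s / 2 * w powr (- s - 1)"
        unfolding c by (simp add: numeral_2_eq_2)
      finally have R2: "zeta_rem 2 n s = v powr (1 - s) - w powr (1 - s)
          - (1 - s) * w powr (- s) + (1 - s) * s / 2 * w powr (- s - 1)" .
      have gen: "(V - A + s * B) / 2 - (V1 - W1 - d * A + d * s / 2 * B) / d = (A + V) / 2 - (V1 - W1) / d"
        if "d \<noteq> 0" for V A B V1 W1 d :: complex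
        using that by (simp add: field_simps)
      show ?thesis
        unfolding E_def w_def [symmetric] v_def [symmetric] R1 R2 using s by (intro gen) simp
    qed
    ultimately show ?thesis by simp
  qed
  \<comment> \<open>The errors \<open>E n\<close> start with the interval \<open>[1, 2]\<close>. The
    added \<open>1 / 2 - 1 / (1 - s)\<close> is the error on \<open>[0, 1]\<close>, where the
    endpoint 0 contributes nothing.\<close>
  define F where "F s = 1 / 2 - 1 / (1 - s) + (G1 (s + 1) / 2 - G2 s / (1 - s))" for s
  have eq: "zeta s = F s" if "s \<in> D" for s
  proof (rule analytic_continuation_open [of "{s. Re s > 1}" D zeta F s])
    show "open {s :: complex. Re s > 1}" by (rule open_halfspace_Re_gt)
    have "2 \<in> {s. Re s > 1}" by simp
    then show "{s. Re s > 1} \<noteq> {}" by blast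
    show "zeta holomorphic_on D"
      by (rule holomorphic_on_subset [OF zeta_holomorphic]) (auto simp: D_def)
    have "G1 \<circ> (\<lambda>s. s + 1) holomorphic_on D"
      by (rule holomorphic_on_compose_gen [OF _ G1(1)]) (auto intro!: holomorphic_intros simp: D_def)
    then have "(\<lambda>s. G1 (s + 1)) holomorphic_on D" by (simp add: o_def)
    moreover have "G2 holomorphic_on D"
      by (rule holomorphic_on_subset [OF G2(1)]) (auto simp: D_def)
    ultimately show "F holomorphic_on D"
      unfolding F_def [abs_def] by (intro holomorphic_intros) (auto simp: D_def)
    show "zeta z = F z" if "z \<in> {s. Re s > 1}" for z
    proof -
      have z: "Re z > 1" using that by simp
      have zD: "z \<in> D" using z by (auto simp: D_def)
      have s1: "(\<lambda>n. of_nat (Suc n) powr (- z)) sums zeta z"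
        using zeta_series_sums [OF z] by (simp only: zeta_eq_zeta_series [OF z])
      have s2: "(\<lambda>n. of_nat (Suc (Suc n)) powr (- z)) sums (zeta z - 1)"
        using iffD2 [OF sums_Suc_iff, of "\<lambda>n. of_nat (Suc n) powr (- z)" "zeta z - 1"] s1 by simp
      have "(\<lambda>n. of_nat (Suc n) powr (1 - z) :: complex) \<longlonglongrightarrow> 0"
      proof (rule tendsto_norm_zero_cancel)
        have "(\<lambda>n. real (Suc n) powr (1 - Re z)) \<longlonglongrightarrow> 0"
          using z
          by (intro tendsto_neg_powr filterlim_compose [OF filterlim_real_sequentially filterlim_Suc]) auto
        then show "(\<lambda>n. norm (of_nat (Suc n) powr (1 - z) :: complex)) \<longlonglongrightarrow> 0"
          by (simp only: norm_of_nat_Suc_powr minus_complex.sel one_complex.sel)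
      qed
      then have s3: "(\<lambda>n. of_nat (Suc (Suc n)) powr (1 - z) - of_nat (Suc n) powr (1 - z)) sums (0 - of_nat (Suc 0) powr (1 - z) :: complex)"
        by (rule telescope_sums)
      have "(\<lambda>n. E n z) sums ((zeta z + (zeta z - 1)) / 2 - (0 - of_nat (Suc 0) powr (1 - z)) / (1 - z))"
        unfolding E_def by (intro sums_diff sums_divide sums_add s1 s2 s3)
      then have "(zeta z + (zeta z - 1)) / 2 - (0 - of_nat (Suc 0) powr (1 - z)) / (1 - z) = G1 (z + 1) / 2 - G2 z / (1 - z)"
        using Esums [OF zD] by (rule sums_unique2)
      then show ?thesis by (simp add: F_def field_simps)
    qed
  qed (use that D in \<open>auto simp: D_def\<close>)
  have aD: "of_real a \<in> D" using a by (auto simp: D_def complex_eq_iff)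
  have "complex_of_real (trapezoid_err (Suc n) a) = E n (of_real a)" for n
  proof -
    have pw: "complex_of_real (real m powr b) = of_nat m powr of_real b" for m b
      using powr_of_real [of "real m" b] by simp
    show ?thesis
      unfolding trapezoid_err_def E_def
      by (simp only: of_real_diff of_real_divide of_real_add pw of_real_minus of_real_1 of_real_numeral)
  qed
  then have "(\<lambda>n. complex_of_real (trapezoid_err (Suc n) a)) sums (zeta (of_real a) - (1 / 2 - 1 / (1 - of_real a)))"
    using Esums [OF aD] eq [OF aD] by (simp add: F_def)
  then have "(\<lambda>n. complex_of_real (trapezoid_err n a)) sums
     (zeta (of_real a) - (1 / 2 - 1 / (1 - of_real a)) + complex_of_real (trapezoid_err 0 a))"
    by (subst (asm) sums_Suc_iff) simp
  moreover have "complex_of_real (trapezoid_err 0 a) = 1 / 2 - 1 / (1 - of_real a)"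
    using a by (simp add: trapezoid_err_def)
  ultimately show ?thesis by simp
qed

text \<open>Each trapezoidal error of the exponential is an integral of
  \<open>exp (- (x * v))\<close> against the Peano kernel. After the order of integration is
  changed, the \<open>x\<close>-integral yields \<open>Gamma (a + 2) * v powr (- a - 2)\<close>, and
  integrating this against the kernel yields the trapezoidal error of
  \<open>v powr (- a)\<close>.\<close>

lemma nn_integral_coth_kernel_zeta:
  fixes a :: real
  assumes a: "-1 < a" "a < 0"
  shows "(\<integral>\<^sup>+x. ennreal (indicator {0<..} x * (x powr (a - 1) * (1 / 2 - 1 / x + 1 / (exp x - 1)))) \<partial>lborel) =
    ennreal (Gamma (a + 2) * (Re (zeta (of_real a)) / (a * (a + 1))))"
proof -
  define p where "p n v = (v - real n) * (real n + 1 - v) / 2" for n v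
  define q where "q n x = exp (- (x * real n)) * ((1 / 2 + 1 / x) * exp (- x) + 1 / 2 - 1 / x) / x\<^sup>2" for n x
  have p: "p n v \<ge> 0" if "v \<in> {real n..real n + 1}" for n v
    using that by (simp add: p_def)
  have inner: "ennreal (q n x) = (\<integral>\<^sup>+v. ennreal (indicator {real n..real n + 1} v * (exp (- (x * v)) * p n v)) \<partial>lborel)"
    if "x > 0" for n x
    using nn_integral_has_integral_lebesgue [OF _ has_integral_exp_quadratic [OF that, of n]] p
    by (simp add: p_def q_def)
  have q: "q n x \<ge> 0" if "x > 0" for n x
    using has_integral_nonneg [OF has_integral_exp_quadratic [OF that, of n]] p
    by (simp add: q_def p_def)
  have "(\<integral>\<^sup>+x. ennreal (indicator {0<..} x * (x powr (a - 1) * (1 / 2 - 1 / x + 1 / (exp x - 1)))) \<partial>lborel) =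
    (\<integral>\<^sup>+x. (\<Sum>n. ennreal (indicator {0<..} x * (x powr (a + 1) * q n x))) \<partial>lborel)"
  proof (rule nn_integral_cong)
    fix x :: real
    show "ennreal (indicator {0<..} x * (x powr (a - 1) * (1 / 2 - 1 / x + 1 / (exp x - 1)))) =
      (\<Sum>n. ennreal (indicator {0<..} x * (x powr (a + 1) * q n x)))"
    proof (cases "x > 0")
      case True
      have "(\<lambda>n. x powr (a - 1) * (x\<^sup>2 * q n x)) sums (x powr (a - 1) * (1 / 2 - 1 / x + 1 / (exp x - 1)))"
        unfolding q_def by (intro sums_mult coth_kernel_eq_suminf True)
      moreover have "x powr (a - 1) * (x\<^sup>2 * q n x) = x powr (a + 1) * q n x" for n
      proof -
        have "a + 1 = (a - 1) + 2" by simp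
        then have "x powr (a + 1) = x powr (a - 1) * x\<^sup>2"
          using True by (simp only: powr_add) simp
        then show ?thesis by simp
      qed
      ultimately have "(\<lambda>n. x powr (a + 1) * q n x) sums (x powr (a - 1) * (1 / 2 - 1 / x + 1 / (exp x - 1)))"
        by simp
      then have "(\<Sum>n. ennreal (x powr (a + 1) * q n x)) = ennreal (x powr (a - 1) * (1 / 2 - 1 / x + 1 / (exp x - 1)))"
        using q True by (intro suminf_ennreal_eq) auto
      then show ?thesis using True by simp
    qed simp
  qed
  also have "\<dots> = (\<Sum>n. \<integral>\<^sup>+x. ennreal (indicator {0<..} x * (x powr (a + 1) * q n x)) \<partial>lborel)"
    by (rule nn_integral_suminf) (auto simp: q_def)
  also have "\<dots> = (\<Sum>n. ennreal (Gamma (a + 2) * (trapezoid_err n a / (a * (a + 1)))))"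
  proof (rule suminf_cong)
    fix n
    define f where "f x v = ennreal (indicator {0<..} x * indicator {real n..real n + 1} v * (x powr (a + 1) * exp (- (x * v)) * p n v))" for x v :: real
    have mf: "case_prod f \<in> borel_measurable (lborel \<Otimes>\<^sub>M lborel)"
      unfolding f_def p_def by measurable
    have "(\<integral>\<^sup>+x. ennreal (indicator {0<..} x * (x powr (a + 1) * q n x)) \<partial>lborel) = (\<integral>\<^sup>+x. \<integral>\<^sup>+v. f x v \<partial>lborel \<partial>lborel)"
    proof (rule nn_integral_cong)
      fix x :: real
      show "ennreal (indicator {0<..} x * (x powr (a + 1) * q n x)) = (\<integral>\<^sup>+v. f x v \<partial>lborel)"
      proof (cases "x > 0")
        case True
        have "ennreal (x powr (a + 1) * q n x) = ennreal (x powr (a + 1)) * ennreal (q n x)"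
          by (simp add: ennreal_mult')
        also have "\<dots> = (\<integral>\<^sup>+v. ennreal (x powr (a + 1)) * ennreal (indicator {real n..real n + 1} v * (exp (- (x * v)) * p n v)) \<partial>lborel)"
          unfolding inner [OF True] by (rule nn_integral_cmult [symmetric]) (auto simp: p_def)
        also have "\<dots> = (\<integral>\<^sup>+v. f x v \<partial>lborel)"
          using True by (intro nn_integral_cong) (simp add: f_def mult_ac flip: ennreal_mult')
        finally show ?thesis using True by simp
      qed (simp add: f_def)
    qed
    also have "\<dots> = (\<integral>\<^sup>+v. \<integral>\<^sup>+x. f x v \<partial>lborel \<partial>lborel)"
      by (rule lborel_pair.Fubini' [OF mf, symmetric])
    also have "\<dots> = (\<integral>\<^sup>+v. ennreal (Gamma (a + 2)) * ennreal (indicator {real n..real n + 1} v * (v powr (- a - 2) * p n v)) \<partial>lborel)"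
    proof (rule nn_integral_cong)
      fix v :: real
      show "(\<integral>\<^sup>+x. f x v \<partial>lborel) = ennreal (Gamma (a + 2)) * ennreal (indicator {real n..real n + 1} v * (v powr (- a - 2) * p n v))"
      proof (cases "v \<in> {real n..real n + 1} \<and> v > 0")
        case True
        then have pv: "p n v \<ge> 0" by (intro p) auto
        have "(\<integral>\<^sup>+x. f x v \<partial>lborel) = (\<integral>\<^sup>+x. ennreal (p n v) * ennreal (indicator {0<..} x * (x powr (a + 1) * exp (- (v * x)))) \<partial>lborel)"
          using True pv by (intro nn_integral_cong) (simp add: f_def mult_ac flip: ennreal_mult')
        also have "\<dots> = ennreal (p n v) * (\<integral>\<^sup>+x. ennreal (indicator {0<..} x * (x powr (a + 1) * exp (- (v * x)))) \<partial>lborel)"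
          by (rule nn_integral_cmult) auto
        also have "(\<integral>\<^sup>+x. ennreal (indicator {0<..} x * (x powr (a + 1) * exp (- (v * x)))) \<partial>lborel) = ennreal (Gamma (a + 1 + 1) * v powr (- (a + 1) - 1))"
          using True a by (intro nn_integral_powr_exp) auto
        also have "a + 1 + 1 = a + 2" by simp
        also have "- (a + 1) - 1 = - a - 2" by simp
        finally show ?thesis using True pv Gamma_real_pos [of "a + 2"] a
          by (simp add: mult_ac flip: ennreal_mult')
      next
        case False
        then consider "v \<notin> {real n..real n + 1}" | "v = 0" "n = 0" by force
        then show ?thesis by cases (auto simp: f_def p_def)
      qed
    qed
    also have "\<dots> = ennreal (Gamma (a + 2)) * (\<integral>\<^sup>+v. ennreal (indicator {real n..real n + 1} v * (v powr (- a - 2) * p n v)) \<partial>lborel)"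
      by (rule nn_integral_cmult) (auto simp: p_def)
    also have "(\<integral>\<^sup>+v. ennreal (indicator {real n..real n + 1} v * (v powr (- a - 2) * p n v)) \<partial>lborel) = ennreal (trapezoid_err n a / (a * (a + 1)))"
      using nn_integral_has_integral_lebesgue [OF _ has_integral_powr_quadratic [OF a, of n]] p by (simp add: p_def)
    finally show "(\<integral>\<^sup>+x. ennreal (indicator {0<..} x * (x powr (a + 1) * q n x)) \<partial>lborel) = ennreal (Gamma (a + 2) * (trapezoid_err n a / (a * (a + 1))))"
      using Gamma_real_pos [of "a + 2"] a by (simp flip: ennreal_mult')
  qed
  also have "\<dots> = ennreal (Gamma (a + 2) * (Re (zeta (of_real a)) / (a * (a + 1))))"
  proof (rule suminf_ennreal_eq)
    fix n
    have "trapezoid_err n a / (a * (a + 1)) \<ge> 0"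
      using has_integral_nonneg [OF has_integral_powr_quadratic [OF a, of n]] p by (simp add: p_def)
    then show "0 \<le> Gamma (a + 2) * (trapezoid_err n a / (a * (a + 1)))"
      using Gamma_real_pos [of "a + 2"] a by (intro mult_nonneg_nonneg) auto
    have "(\<lambda>n. trapezoid_err n a) sums Re (zeta (of_real a))"
      using sums_Re [OF trapezoid_err_sums_zeta [OF a]] by simp
    then show "(\<lambda>n. Gamma (a + 2) * (trapezoid_err n a / (a * (a + 1)))) sums (Gamma (a + 2) * (Re (zeta (of_real a)) / (a * (a + 1))))"
      by (intro sums_mult sums_divide)
  qed
  finally show ?thesis .
qed

text \<open>Scaling \<open>x\<close> by \<open>k n = 2 * pi * (n + 1)\<close> turns the integral of
  each partial fraction into \<open>k n powr (a - 1)\<close> times one fixed integral, so the sum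
  over \<open>n\<close> is a zeta value at \<open>1 - a\<close>.\<close>

lemma nn_integral_coth_kernel_reflected:
  fixes a :: real
  assumes a: "-1 < a" "a < 0"
  shows "(\<integral>\<^sup>+x. ennreal (indicator {0<..} x * (x powr (a - 1) * (1 / 2 - 1 / x + 1 / (exp x - 1)))) \<partial>lborel) =
    ennreal ((2 * pi) powr (a - 1) * (Gamma ((1 + a) / 2) * Gamma ((1 - a) / 2)) * Re (zeta (of_real (1 - a))))"
proof -
  define J where "J = Gamma ((1 + a) / 2) * Gamma ((1 - a) / 2)"
  have J: "J > 0" using a by (simp add: J_def Gamma_real_pos)
  define k where "k n = 2 * pi * real (Suc n)" for n
  have k: "k n > 0" for n by (simp add: k_def)
  have "(\<integral>\<^sup>+x. ennreal (indicator {0<..} x * (x powr (a - 1) * (1 / 2 - 1 / x + 1 / (exp x - 1)))) \<partial>lborel) =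
    (\<integral>\<^sup>+x. (\<Sum>n. ennreal (indicator {0<..} x * (x powr (a - 1) * (2 * x / (x\<^sup>2 + (k n)\<^sup>2))))) \<partial>lborel)"
  proof (rule nn_integral_cong)
    fix x :: real
    show "ennreal (indicator {0<..} x * (x powr (a - 1) * (1 / 2 - 1 / x + 1 / (exp x - 1)))) =
      (\<Sum>n. ennreal (indicator {0<..} x * (x powr (a - 1) * (2 * x / (x\<^sup>2 + (k n)\<^sup>2)))))"
    proof (cases "x > 0")
      case True
      have "(\<lambda>n. x powr (a - 1) * (2 * x / (x\<^sup>2 + (k n)\<^sup>2))) sums (x powr (a - 1) * (1 / 2 - 1 / x + 1 / (exp x - 1)))"
        unfolding k_def by (intro sums_mult coth_partial_fractions True)
      then have "(\<Sum>n. ennreal (x powr (a - 1) * (2 * x / (x\<^sup>2 + (k n)\<^sup>2)))) = ennreal (x powr (a - 1) * (1 / 2 - 1 / x + 1 / (exp x - 1)))"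
        using True by (intro suminf_ennreal_eq) auto
      then show ?thesis using True by simp
    qed simp
  qed
  also have "\<dots> = (\<Sum>n. \<integral>\<^sup>+x. ennreal (indicator {0<..} x * (x powr (a - 1) * (2 * x / (x\<^sup>2 + (k n)\<^sup>2)))) \<partial>lborel)"
    by (rule nn_integral_suminf) auto
  also have "\<dots> = (\<Sum>n. ennreal (k n powr (a - 1) * J))"
  proof (rule suminf_cong)
    fix n
    have "(\<integral>\<^sup>+x. ennreal (indicator {0<..} x * (x powr (a - 1) * (2 * x / (x\<^sup>2 + (k n)\<^sup>2)))) \<partial>lborel) =
      ennreal \<bar>k n\<bar> * (\<integral>\<^sup>+y. ennreal (indicator {0<..} (0 + k n * y) * ((0 + k n * y) powr (a - 1) * (2 * (0 + k n * y) / ((0 + k n * y)\<^sup>2 + (k n)\<^sup>2)))) \<partial>lborel)"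
      using k [of n] by (intro nn_integral_real_affine) auto
    also have "(\<integral>\<^sup>+y. ennreal (indicator {0<..} (0 + k n * y) * ((0 + k n * y) powr (a - 1) * (2 * (0 + k n * y) / ((0 + k n * y)\<^sup>2 + (k n)\<^sup>2)))) \<partial>lborel) =
       (\<integral>\<^sup>+y. ennreal (2 * k n powr (a - 2)) * ennreal (indicator {0<..} y * (y powr a / (1 + y\<^sup>2))) \<partial>lborel)"
    proof (rule nn_integral_cong)
      fix y :: real
      show "ennreal (indicator {0<..} (0 + k n * y) * ((0 + k n * y) powr (a - 1) * (2 * (0 + k n * y) / ((0 + k n * y)\<^sup>2 + (k n)\<^sup>2)))) =
        ennreal (2 * k n powr (a - 2)) * ennreal (indicator {0<..} y * (y powr a / (1 + y\<^sup>2)))"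
      proof (cases "y > 0")
        case True
        have py: "1 + y\<^sup>2 > 0" by (simp add: add_pos_nonneg)
        have "(k n * y)\<^sup>2 + (k n)\<^sup>2 = (k n)\<^sup>2 * (1 + y\<^sup>2)" by (simp add: power_mult_distrib algebra_simps)
        moreover have "(k n * y) powr (a - 1) = k n powr (a - 1) * (y powr a / y)"
          using k [of n] True by (simp add: powr_mult powr_diff)
        moreover have "k n powr (a - 2) = k n powr (a - 1) / k n"
          using k [of n] powr_diff [of "k n" "a - 1" 1] by simp
        ultimately have "(k n * y) powr (a - 1) * (2 * (k n * y) / ((k n * y)\<^sup>2 + (k n)\<^sup>2)) =
           (2 * k n powr (a - 2)) * (y powr a / (1 + y\<^sup>2))"
          using k [of n] True py by (simp add: power2_eq_square)
        then show ?thesis using True k [of n] by (simp flip: ennreal_mult')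
      next
        case False
        then have "\<not> k n * y > 0" using k [of n] by (simp add: zero_less_mult_iff)
        then show ?thesis using False by simp
      qed
    qed
    also have "\<dots> = ennreal (2 * k n powr (a - 2)) * (\<integral>\<^sup>+y. ennreal (indicator {0<..} y * (y powr a / (1 + y\<^sup>2))) \<partial>lborel)"
      by (rule nn_integral_cmult) auto
    also have "(\<integral>\<^sup>+y. ennreal (indicator {0<..} y * (y powr a / (1 + y\<^sup>2))) \<partial>lborel) = ennreal (J / 2)"
      using nn_integral_powr_over_1_plus_square [of a] a by (simp add: J_def)
    also have "ennreal \<bar>k n\<bar> * (ennreal (2 * k n powr (a - 2)) * ennreal (J / 2)) = ennreal (k n * (2 * k n powr (a - 2) * (J / 2)))"
      using k [of n] J by (simp flip: ennreal_mult')
    also have "k n * (2 * k n powr (a - 2) * (J / 2)) = k n powr (a - 1) * J"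
      using k [of n] powr_diff [of "k n" "a - 1" 1] by simp
    finally show "(\<integral>\<^sup>+x. ennreal (indicator {0<..} x * (x powr (a - 1) * (2 * x / (x\<^sup>2 + (k n)\<^sup>2)))) \<partial>lborel) = ennreal (k n powr (a - 1) * J)" .
  qed
  also have "\<dots> = ennreal ((2 * pi) powr (a - 1) * J * Re (zeta (of_real (1 - a))))"
  proof (rule suminf_ennreal_eq)
    show "0 \<le> k n powr (a - 1) * J" for n using J by simp
    have "Re (complex_of_real (1 - a)) > 1" using a by simp
    from sums_Re [OF zeta_series_sums [OF this, folded zeta_eq_zeta_series [OF this]]]
    have "(\<lambda>n. Re (of_nat (Suc n) powr (- complex_of_real (1 - a)))) sums Re (zeta (of_real (1 - a)))" .
    moreover have "Re (of_nat (Suc n) powr (- complex_of_real (1 - a))) = real (Suc n) powr (a - 1)" for n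
    proof -
      have "- complex_of_real (1 - a) = complex_of_real (a - 1)" by simp
      moreover have "of_nat (Suc n) powr complex_of_real (a - 1) = complex_of_real (real (Suc n) powr (a - 1))"
        using powr_of_real [OF of_nat_0_le_iff, of "Suc n" "a - 1"] by (simp only: of_real_of_nat_eq)
      ultimately show ?thesis by (simp only: Re_complex_of_real)
    qed
    ultimately have "(\<lambda>n. (2 * pi) powr (a - 1) * J * real (Suc n) powr (a - 1)) sums ((2 * pi) powr (a - 1) * J * Re (zeta (of_real (1 - a))))"
      by (intro sums_mult) (simp only:)
    moreover have "(2 * pi) powr (a - 1) * J * real (Suc n) powr (a - 1) = k n powr (a - 1) * J" for n
      unfolding k_def by (simp add: powr_mult del: of_nat_Suc)
    ultimately show "(\<lambda>n. k n powr (a - 1) * J) sums ((2 * pi) powr (a - 1) * J * Re (zeta (of_real (1 - a))))"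
      by (simp only:)
  qed
  finally show ?thesis by (simp add: J_def)
qed

section \<open>The functional equation and the strip containing the nonreal zeros\<close>

lemma sums_of_real_imp_real:
  "(\<lambda>n. complex_of_real (f n)) sums z \<Longrightarrow> z = of_real (Re z)"
  using sums_Re [of "\<lambda>n. complex_of_real (f n)" z] sums_of_real [of f "Re z"] sums_unique2
  by (metis (no_types, lifting) Re_complex_of_real sums_cong)

text \<open>The two evaluations of the integral are equated. Reflection turns the Gamma product into
  \<open>pi / cos (pi * a / 2)\<close>, and \<open>Gamma (a + 2)\<close> with the factor
  \<open>a * (a + 1)\<close> becomes \<open>rGamma a\<close>. The result is cleared of denominators
  so that both sides continue analytically.\<close>

lemma zeta_functional_equation_real:
  fixes a :: real
  assumes a: "-1 < a" "a < 0"
  shows "zeta (of_real a) * (2 * cos (of_real pi * of_real a / 2)) =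
    of_real (2 * pi) powr of_real a * zeta (1 - of_real a) * rGamma (of_real a)"
proof -
  define A where "A = complex_of_real a"
  define x where "x = Gamma (a + 2) * (Re (zeta (of_real a)) / (a * (a + 1)))"
  define y where "y = (2 * pi) powr (a - 1) * (Gamma ((1 + a) / 2) * Gamma ((1 - a) / 2)) * Re (zeta (of_real (1 - a)))"
  have za: "zeta A = of_real (Re (zeta A))"
    unfolding A_def by (rule sums_of_real_imp_real [OF trapezoid_err_sums_zeta [OF a]])
  have Re1: "Re (complex_of_real (1 - a)) > 1" using a by simp
  have pw: "of_nat (Suc n) powr (- complex_of_real (1 - a)) = complex_of_real (real (Suc n) powr (a - 1))" for n
  proof -
    have "- complex_of_real (1 - a) = complex_of_real (a - 1)" by simp
    moreover have "of_nat (Suc n) powr complex_of_real (a - 1) = complex_of_real (real (Suc n) powr (a - 1))"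
      using powr_of_real [OF of_nat_0_le_iff, of "Suc n" "a - 1"] by (simp only: of_real_of_nat_eq)
    ultimately show ?thesis by (simp only:)
  qed
  have z1s: "(\<lambda>n. complex_of_real (real (Suc n) powr (a - 1))) sums zeta (complex_of_real (1 - a))"
    using zeta_series_sums [OF Re1, folded zeta_eq_zeta_series [OF Re1]] unfolding pw .
  have z1: "zeta (complex_of_real (1 - a)) = of_real (Re (zeta (complex_of_real (1 - a))))"
    by (rule sums_of_real_imp_real [OF z1s])
  have z1pos: "Re (zeta (complex_of_real (1 - a))) > 0"
  proof -
    have s: "(\<lambda>n. real (Suc n) powr (a - 1)) sums Re (zeta (complex_of_real (1 - a)))"
      using sums_Re [OF z1s] by simp
    have "0 < (\<Sum>n. real (Suc n) powr (a - 1))"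
      by (rule suminf_pos [OF sums_summable [OF s]]) simp
    then show ?thesis using sums_unique [OF s] by simp
  qed
  have y: "y > 0" unfolding y_def using a z1pos
    by (intro mult_pos_pos) (auto intro!: Gamma_real_pos)
  have "ennreal x = ennreal y"
    using nn_integral_coth_kernel_zeta [OF a] nn_integral_coth_kernel_reflected [OF a]
    unfolding x_def y_def by simp
  \<comment> \<open>Since \<open>ennreal\<close> sends every negative number to 0, the positivity of
    \<open>y\<close> is what allows the equality to be read in the reals.\<close>
  then have xy: "x = y"
    using y by (metis ennreal_eq_0_iff ennreal_inj less_eq_real_def linorder_not_le)
  have J: "complex_of_real (Gamma ((1 + a) / 2) * Gamma ((1 - a) / 2)) = of_real pi / cos (of_real pi * A / 2)"
  proof -
    have "complex_of_real (Gamma ((1 + a) / 2) * Gamma ((1 - a) / 2)) = Gamma ((1 + A) / 2) * Gamma (1 - (1 + A) / 2)"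
      unfolding of_real_mult Gamma_complex_of_real [symmetric] by (simp add: A_def field_simps)
    also have "\<dots> = of_real pi / sin (of_real pi * ((1 + A) / 2))"
      by (rule Gamma_reflection_complex)
    also have "of_real pi * ((1 + A) / 2) = of_real pi * A / 2 + of_real (pi / 2)"
      by (simp add: field_simps)
    also have "sin (of_real pi * A / 2 + of_real (pi / 2)) = cos (of_real pi * A / 2)"
      by (simp only: sin_add sin_of_real cos_of_real) simp
    finally show ?thesis .
  qed
  have cosnz: "cos (of_real pi * A / 2) \<noteq> 0"
  proof
    assume "cos (of_real pi * A / 2) = 0"
    then have "Gamma ((1 + a) / 2) * Gamma ((1 - a) / 2) = 0" using J by (simp only: div_by_0 of_real_eq_0_iff)
    moreover have "Gamma ((1 + a) / 2) > 0" "Gamma ((1 - a) / 2) > 0" using a by (auto intro!: Gamma_real_pos)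
    ultimately show False by simp
  qed
  have nz: "A \<noteq> 0" "A + 1 \<noteq> 0" using a by (auto simp: A_def complex_eq_iff)
  have "complex_of_real x = Gamma (A + 2) * (zeta A / (A * (A + 1)))"
    using za Gamma_complex_of_real [of "a + 2"] unfolding x_def A_def by simp
  moreover have "complex_of_real y = of_real (2 * pi) powr (A - 1) * (of_real pi / cos (of_real pi * A / 2)) * zeta (1 - A)"
  proof -
    have "complex_of_real ((2 * pi) powr (a - 1)) = of_real (2 * pi) powr (A - 1)"
      using powr_of_real [of "2 * pi" "a - 1"] by (simp add: A_def)
    then show ?thesis
      using z1 unfolding y_def of_real_mult [of "(2 * pi) powr (a - 1) * (Gamma ((1 + a) / 2) * Gamma ((1 - a) / 2))"]
        of_real_mult [of "(2 * pi) powr (a - 1)"] J by (simp add: A_def)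
  qed
  moreover have "of_real (2 * pi) powr A = of_real (2 * pi) powr (A - 1) * complex_of_real (2 * pi)"
    using powr_add [of "complex_of_real (2 * pi)" "A - 1" 1] by simp
  moreover have "rGamma A = A * (A + 1) * rGamma (A + 2)"
    using rGamma_plus1 [of A] rGamma_plus1 [of "A + 1"] by (simp add: add.assoc mult.assoc)
  moreover have "rGamma (A + 2) = 1 / Gamma (A + 2)"
    by (simp add: rGamma_inverse_Gamma inverse_eq_divide)
  moreover have G2: "Gamma (A + 2) \<noteq> 0"
  proof -
    have "Gamma (A + 2) = of_real (Gamma (a + 2))" using Gamma_complex_of_real [of "a + 2"] by (simp add: A_def)
    moreover have "Gamma (a + 2) > 0" using a by (intro Gamma_real_pos) auto
    ultimately show ?thesis by simp
  qed
  ultimately have "zeta A * (2 * cos (of_real pi * A / 2)) = of_real (2 * pi) powr A * zeta (1 - A) * rGamma A"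
  proof -
    have gen: "Z * (2 * c) = P * (2 * p) * Z1 * (B * (1 / G))"
      if "G * (Z / B) = P * (p / c) * Z1" "G \<noteq> 0" "B \<noteq> 0" "c \<noteq> 0" for Z c P p Z1 B G :: complex
      using that by (simp add: divide_simps mult_ac)
    assume "complex_of_real x = Gamma (A + 2) * (zeta A / (A * (A + 1)))"
      and "complex_of_real y = of_real (2 * pi) powr (A - 1) * (of_real pi / cos (of_real pi * A / 2)) * zeta (1 - A)"
      and P: "of_real (2 * pi) powr A = of_real (2 * pi) powr (A - 1) * complex_of_real (2 * pi)"
      and r1: "rGamma A = A * (A + 1) * rGamma (A + 2)" and r2: "rGamma (A + 2) = 1 / Gamma (A + 2)"
    then have "Gamma (A + 2) * (zeta A / (A * (A + 1))) =
        of_real (2 * pi) powr (A - 1) * (of_real pi / cos (of_real pi * A / 2)) * zeta (1 - A)"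
      using xy by simp
    from gen [OF this G2 _ cosnz] show ?thesis
      unfolding P r1 r2 using nz by simp
  qed
  then show ?thesis by (simp add: A_def)
qed

text \<open>Both sides are holomorphic off 0 and 1, and they agree on a real interval accumulating
  at \<open>- 1 / 2\<close>. The entire function \<open>rGamma\<close> creates no further
  exceptional points.\<close>

theorem zeta_functional_equation:
  assumes "s \<noteq> 0" "s \<noteq> 1"
  shows "zeta s * (2 * cos (of_real pi * s / 2)) = of_real (2 * pi) powr s * zeta (1 - s) * rGamma s"
proof -
  define D where "D = - {0, 1 :: complex}"
  define f where "f s = zeta s * (2 * cos (of_real pi * s / 2)) - of_real (2 * pi) powr s * zeta (1 - s) * rGamma s" for s
  define I where "I = {-1<..<0 :: real}"
  have D: "open D" "connected D"
    unfolding D_def using connected_open_diff_countable [of "UNIV :: complex set" "{0, 1}"]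
    by (auto simp: Compl_eq_Diff_UNIV intro!: open_Diff finite_imp_closed)
  have "(\<lambda>s. zeta (1 - s)) holomorphic_on D"
  proof -
    have "zeta \<circ> (\<lambda>s. 1 - s) holomorphic_on D"
      by (rule holomorphic_on_compose_gen [OF _ zeta_holomorphic]) (auto intro!: holomorphic_intros simp: D_def)
    then show ?thesis by (simp add: o_def)
  qed
  moreover have "zeta holomorphic_on D"
    by (rule holomorphic_on_subset [OF zeta_holomorphic]) (auto simp: D_def)
  ultimately have hol: "f holomorphic_on D"
    unfolding f_def [abs_def] by (intro holomorphic_intros) auto
  have "f s = 0"
  proof (rule analytic_continuation [OF hol D])
    show "of_real ` I \<subseteq> D" by (auto simp: I_def D_def)
    show "complex_of_real (- 1 / 2) \<in> D" by (auto simp: D_def complex_eq_iff)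
    have "(- 1 / 2 :: real) islimpt I"
      unfolding I_def by (rule open_imp_islimpt) auto
    then have "(of_real (- 1 / 2) :: complex) islimpt of_real ` I"
      by (rule islimpt_isCont_image) (auto simp: eventually_at_filter complex_eq_iff)
    then show "complex_of_real (- 1 / 2) islimpt of_real ` I" .
    show "f z = 0" if "z \<in> of_real ` I" for z
      using that zeta_functional_equation_real by (auto simp: f_def I_def)
    show "s \<in> D" using assms by (simp add: D_def)
  qed
  then show ?thesis by (simp add: f_def)
qed

text \<open>On the right of the functional equation \<open>zeta (1 - s)\<close> is nonzero as
  \<open>Re (1 - s) > 1\<close>. The condition \<open>Im s \<noteq> 0\<close> keeps \<open>s\<close>
  away from the zeros of \<open>rGamma\<close>, among which are the trivial zeros.\<close>

lemma zeta_nonzero_Re_lt_0: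
  assumes "Re s < 0" "Im s \<noteq> 0"
  shows "zeta s \<noteq> 0"
proof
  assume "zeta s = 0"
  then have "of_real (2 * pi) powr s * zeta (1 - s) * rGamma s = 0"
    using zeta_functional_equation [of s] assms by fastforce
  moreover have "zeta (1 - s) \<noteq> 0" using assms by (intro zeta_nonzero_Re_gt_1) simp
  moreover have "rGamma s \<noteq> 0"
    using assms by (auto simp: rGamma_eq_zero_iff elim!: nonpos_Ints_cases)
  ultimately show False by simp
qed

lemma zeta_zero_strip:
  assumes "zeta s = 0" "Im s \<noteq> 0"
  shows "0 \<le> Re s" "Re s \<le> 1"
  using zeta_nonzero_Re_lt_0 [of s] zeta_nonzero_Re_gt_1 [of s] assms by (auto simp: not_less [symmetric])

section \<open>The weight and its Mellin transform\<close>

definition bump_poly :: "real poly" where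
  "bump_poly = [:-1, 5 / 2, -1:]"

lemma poly_bump_poly: "poly bump_poly x = (x - 1 / 2) * (2 - x)"
  by (simp add: bump_poly_def field_simps)

text \<open>This family contains the weight and is closed under differentiation.\<close>

definition bump_family :: "real poly \<Rightarrow> nat \<Rightarrow> real \<Rightarrow> real" where
  "bump_family P m x = (if 1 / 2 < x \<and> x < 2
     then poly P x / poly bump_poly x ^ m * exp (- (1 / poly bump_poly x)) else 0)"

lemma power_le_fact_exp:
  fixes y :: real
  assumes "y \<ge> 0"
  shows "y ^ k \<le> fact k * exp y"
proof -
  have "(\<Sum>i\<in>{k}. y ^ i / fact i) \<le> (\<Sum>i. y ^ i / fact i)"
    using assms summable_exp [of y] by (intro sum_le_suminf) (auto simp: divide_inverse mult.commute)
  also have "\<dots> = exp y" by (simp add: exp_def divide_inverse mult.commute)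
  finally show ?thesis by (simp add: field_simps)
qed

text \<open>With \<open>q = poly bump_poly x\<close>, the bound
  \<open>exp (- (1 / q)) \<le> fact (m + 2) * q ^ (m + 2)\<close> beats the denominator
  \<open>q ^ m\<close> and leaves \<open>q\<^sup>2\<close>; and \<open>q\<close> is at most
  \<open>3 / 2\<close> times the distance to either endpoint. Quadratic contact at the endpoints is
  what makes the derivative vanish there.\<close>

lemma bump_family_bound:
  obtains K where "K \<ge> 0" "\<And>x. \<bar>bump_family P m x\<bar> \<le> K * (x - 1 / 2)\<^sup>2" "\<And>x. \<bar>bump_family P m x\<bar> \<le> K * (x - 2)\<^sup>2"
proof -
  have "compact ((\<lambda>x. poly P x) ` {1 / 2..2})"
    by (intro compact_continuous_image continuous_intros) auto
  then have "bounded ((\<lambda>x. poly P x) ` {1 / 2..2})" by (rule compact_imp_bounded)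
  then obtain B where B: "B > 0" "\<And>x. x \<in> {1 / 2..2} \<Longrightarrow> \<bar>poly P x\<bar> \<le> B"
    unfolding bounded_pos by auto
  define K where "K = B * fact (m + 2) * (9 / 4)"
  have main: "\<bar>bump_family P m x\<bar> \<le> B * (fact (m + 2) * (poly bump_poly x)\<^sup>2)" if x: "1 / 2 < x" "x < 2" for x
  proof -
    define q where "q = poly bump_poly x"
    have q: "q > 0" using x by (simp add: q_def poly_bump_poly)
    have "(1 / q) ^ (m + 2) \<le> fact (m + 2) * exp (1 / q)" using q by (intro power_le_fact_exp) auto
    then have "exp (- (1 / q)) \<le> fact (m + 2) * q ^ (m + 2)"
      using q by (simp add: exp_minus field_simps)
    then have "1 / q ^ m * exp (- (1 / q)) \<le> 1 / q ^ m * (fact (m + 2) * q ^ (m + 2))"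
      using q by (intro mult_left_mono) auto
    also have "\<dots> = fact (m + 2) * q\<^sup>2" using q by (simp add: power_add power2_eq_square)
    finally have *: "1 / q ^ m * exp (- (1 / q)) \<le> fact (m + 2) * q\<^sup>2" .
    have "\<bar>bump_family P m x\<bar> = \<bar>poly P x\<bar> * (1 / q ^ m * exp (- (1 / q)))"
      using x q by (simp add: bump_family_def q_def [symmetric] abs_mult)
    also have "\<dots> \<le> B * (fact (m + 2) * q\<^sup>2)"
      using B(2) [of x] x B(1) q by (intro mult_mono *) auto
    finally show ?thesis by (simp add: q_def)
  qed
  have b1: "\<bar>bump_family P m x\<bar> \<le> K * c\<^sup>2"
    if c: "1 / 2 < x \<Longrightarrow> x < 2 \<Longrightarrow> poly bump_poly x \<le> 3 / 2 * \<bar>c\<bar>" for x c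
  proof (cases "1 / 2 < x \<and> x < 2")
    case True
    then have "0 \<le> poly bump_poly x" by (simp add: poly_bump_poly)
    then have "(poly bump_poly x)\<^sup>2 \<le> (3 / 2 * \<bar>c\<bar>)\<^sup>2" using c True by (intro power_mono) auto
    then have "B * (fact (m + 2) * (poly bump_poly x)\<^sup>2) \<le> B * (fact (m + 2) * (3 / 2 * \<bar>c\<bar>)\<^sup>2)"
      using B by (intro mult_left_mono) auto
    also have "\<dots> = K * c\<^sup>2" by (simp add: K_def power_mult_distrib power_divide del: fact_Suc)
    finally show ?thesis using main [of x] True by linarith
  next
    case False
    then have "bump_family P m x = 0" by (auto simp: bump_family_def)
    then show ?thesis using B by (simp add: K_def)
  qed
  show ?thesis
  proof (rule that)
    show "K \<ge> 0" using B by (simp add: K_def)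
    show "\<bar>bump_family P m x\<bar> \<le> K * (x - 1 / 2)\<^sup>2" for x
    proof (rule b1)
      assume x: "1 / 2 < x" "x < 2"
      have "(x - 1 / 2) * (2 - x) \<le> (x - 1 / 2) * (3 / 2)" using x by (intro mult_left_mono) auto
      then show "poly bump_poly x \<le> 3 / 2 * \<bar>x - 1 / 2\<bar>" using x by (simp add: poly_bump_poly)
    qed
    show "\<bar>bump_family P m x\<bar> \<le> K * (x - 2)\<^sup>2" for x
    proof (rule b1)
      assume x: "1 / 2 < x" "x < 2"
      have "(x - 1 / 2) * (2 - x) \<le> (3 / 2) * (2 - x)" using x by (intro mult_right_mono) auto
      then show "poly bump_poly x \<le> 3 / 2 * \<bar>x - 2\<bar>" using x by (simp add: poly_bump_poly)
    qed
  qed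
qed

lemma DERIV_zero_if_quadratic_bound:
  fixes f :: "real \<Rightarrow> real"
  assumes "\<And>x. \<bar>f x\<bar> \<le> K * (x - c)\<^sup>2"
  shows "(f has_real_derivative 0) (at c)"
proof -
  have f0: "f c = 0" using assms [of c] by simp
  have "((\<lambda>h. (f (c + h) - f c) / h) \<longlongrightarrow> 0) (at 0)"
  proof (rule Lim_null_comparison)
    show "\<forall>\<^sub>F h in at 0. norm ((f (c + h) - f c) / h) \<le> K * \<bar>h\<bar>"
    proof (rule eventually_at_filter [THEN iffD2], rule always_eventually, intro allI impI)
      fix h :: real assume h: "h \<noteq> 0"
      have "\<bar>f (c + h)\<bar> \<le> K * (\<bar>h\<bar> * \<bar>h\<bar>)"
        using assms [of "c + h"] by (simp add: power2_eq_square abs_mult_self_eq)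
      then show "norm ((f (c + h) - f c) / h) \<le> K * \<bar>h\<bar>"
        using h by (simp add: f0 field_simps)
    qed
    show "((\<lambda>h. K * \<bar>h\<bar>) \<longlongrightarrow> 0) (at 0)"
      by (rule tendsto_eq_intros refl | simp)+
  qed
  then show ?thesis by (simp add: DERIV_def)
qed

text \<open>Inside the support this is the quotient rule, with the three terms brought to the common
  denominator \<open>q ^ (m + 2)\<close>; the last one comes from differentiating
  \<open>- (1 / q)\<close> in the exponent.\<close>

lemma DERIV_bump_family:
  "(bump_family P m has_real_derivative
    bump_family (pderiv P * bump_poly ^ 2 - smult (real m) (P * bump_poly * pderiv bump_poly) + P * pderiv bump_poly) (m + 2) x) (at x)"
proof -
  define Q where "Q = pderiv P * bump_poly ^ 2 - smult (real m) (P * bump_poly * pderiv bump_poly) + P * pderiv bump_poly"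
  obtain K where "K \<ge> 0" and K: "\<And>x. \<bar>bump_family P m x\<bar> \<le> K * (x - 1 / 2)\<^sup>2"
    "\<And>x. \<bar>bump_family P m x\<bar> \<le> K * (x - 2)\<^sup>2"
    by (rule bump_family_bound [of P m]) (rule that)
  consider "x < 1 / 2 \<or> x > 2" | "x = 1 / 2" | "x = 2" | "1 / 2 < x \<and> x < 2" by linarith
  then have "(bump_family P m has_real_derivative bump_family Q (m + 2) x) (at x)"
  proof cases
    case 1
    have "((\<lambda>x. 0) has_real_derivative 0) (at x)" by simp
    then have "(bump_family P m has_real_derivative 0) (at x)"
    proof (rule has_field_derivative_transform_within_open [of _ _ _ "{..<1/2} \<union> {2<..}"])
      show "x \<in> {..<1/2} \<union> {2<..}" using 1 by auto
    qed (auto simp: bump_family_def)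
    then show ?thesis using 1 by (auto simp: bump_family_def)
  next
    case 2
    then have "bump_family Q (m + 2) x = 0" by (simp add: bump_family_def)
    then show ?thesis using DERIV_zero_if_quadratic_bound [OF K(1)] by (simp only: 2)
  next
    case 3
    then have "bump_family Q (m + 2) x = 0" by (simp add: bump_family_def)
    then show ?thesis using DERIV_zero_if_quadratic_bound [OF K(2)] by (simp only: 3)
  next
    case 4
    define q where "q = poly bump_poly x"
    define q' where "q' = poly (pderiv bump_poly) x"
    have q: "q > 0" using 4 by (simp add: q_def poly_bump_poly)
    have dp: "(poly P has_real_derivative poly (pderiv P) x) (at x)"
      and dq: "(poly bump_poly has_real_derivative q') (at x)"
      unfolding q'_def by (rule poly_DERIV)+
    have "((\<lambda>x. poly P x / poly bump_poly x ^ m * exp (- (1 / poly bump_poly x))) has_real_derivative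
        (poly (pderiv P) x * q ^ m - poly P x * (real m * q ^ (m - 1) * q')) / (q ^ m * q ^ m) * exp (- (1 / q))
        + exp (- (1 / q)) * (q' / (q * q)) * (poly P x / q ^ m)) (at x)"
    proof -
      have d1: "((\<lambda>x. poly bump_poly x ^ m) has_real_derivative real m * q ^ (m - 1) * q') (at x)"
        using DERIV_power [OF dq, of m] by (simp add: q_def mult_ac)
      have d2: "((\<lambda>x. poly P x / poly bump_poly x ^ m) has_real_derivative
          (poly (pderiv P) x * q ^ m - poly P x * (real m * q ^ (m - 1) * q')) / (q ^ m * q ^ m)) (at x)"
        using DERIV_divide [OF dp d1] q by (simp add: q_def)
      have "((\<lambda>x. 1 / poly bump_poly x) has_real_derivative (0 * q - 1 * q') / (q * q)) (at x)"
        using DERIV_divide [OF DERIV_const dq, of 1] q by (simp add: q_def)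
      from DERIV_chain2 [OF DERIV_exp DERIV_minus [OF this]]
      have d3: "((\<lambda>x. exp (- (1 / poly bump_poly x))) has_real_derivative exp (- (1 / q)) * (q' / (q * q))) (at x)"
        by (simp add: q_def)
      show ?thesis using DERIV_mult [OF d2 d3] by (simp add: q_def)
    qed
    then have "(bump_family P m has_real_derivative
        (poly (pderiv P) x * q ^ m - poly P x * (real m * q ^ (m - 1) * q')) / (q ^ m * q ^ m) * exp (- (1 / q))
        + exp (- (1 / q)) * (q' / (q * q)) * (poly P x / q ^ m)) (at x)"
      by (rule has_field_derivative_transform_within_open [of _ _ _ "{1/2<..<2}"])
         (use 4 in \<open>auto simp: bump_family_def\<close>)
    also have "(poly (pderiv P) x * q ^ m - poly P x * (real m * q ^ (m - 1) * q')) / (q ^ m * q ^ m) * exp (- (1 / q))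
        + exp (- (1 / q)) * (q' / (q * q)) * (poly P x / q ^ m) = bump_family Q (m + 2) x"
    proof -
      have e: "real m * q ^ (m - 1) * q = real m * q ^ m" by (cases m) auto
      have "(poly (pderiv P) x * q ^ m - poly P x * (real m * q ^ (m - 1) * q')) / (q ^ m * q ^ m) =
        (poly (pderiv P) x * q ^ m * q - poly P x * (real m * q ^ (m - 1) * q * q')) / (q ^ m * q ^ m * q)"
        using q by (simp add: divide_simps) (simp add: algebra_simps)
      also have "\<dots> = (poly (pderiv P) x * q - poly P x * real m * q') / (q ^ m * q)"
        unfolding e using q by (simp add: divide_simps) (simp add: algebra_simps)
      finally have e2: "(poly (pderiv P) x * q ^ m - poly P x * (real m * q ^ (m - 1) * q')) / (q ^ m * q ^ m) =
        (poly (pderiv P) x * q - poly P x * real m * q') / (q ^ m * q)" .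
      show ?thesis unfolding e2 using 4 q
        by (simp add: bump_family_def Q_def q_def [symmetric] q'_def [symmetric] power_add power2_eq_square divide_simps)
           (simp add: algebra_simps)
    qed
    finally show ?thesis .
  qed
  then show ?thesis by (simp add: Q_def)
qed

lemma funpow_deriv_bump_family: "\<exists>Q n. (deriv ^^ k) (bump_family P m) = bump_family Q n"
proof (induction k)
  case 0
  show ?case by auto
next
  case (Suc k)
  then obtain Q n where Q: "(deriv ^^ k) (bump_family P m) = bump_family Q n" by blast
  have "deriv (bump_family Q n) = bump_family (pderiv Q * bump_poly ^ 2 - smult (real n) (Q * bump_poly * pderiv bump_poly) + Q * pderiv bump_poly) (n + 2)"
    by (rule ext, rule DERIV_imp_deriv, rule DERIV_bump_family)
  then show ?case unfolding funpow.simps o_def Q by blast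
qed

lemma smooth_bump_family: "smooth (bump_family P m)"
  unfolding smooth_def
proof
  fix k
  obtain Q n where Q: "(deriv ^^ k) (bump_family P m) = bump_family Q n"
    using funpow_deriv_bump_family by blast
  show "(deriv ^^ k) (bump_family P m) differentiable_on UNIV"
    unfolding Q differentiable_on_def
    using DERIV_bump_family real_differentiable_def by blast
qed

definition bump :: "real \<Rightarrow> real" where
  "bump x = (if 1 / 2 < x \<and> x < 2 then exp (- (1 / ((x - 1 / 2) * (2 - x)))) else 0)"

lemma bump_eq_bump_family: "bump = bump_family 1 0"
  by (auto simp: bump_def bump_family_def poly_bump_poly fun_eq_iff)

lemma smooth_bump: "smooth bump"
  unfolding bump_eq_bump_family by (rule smooth_bump_family)

lemma bump_nonneg: "bump x \<ge> 0" and bump_le_1: "bump x \<le> 1"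
  by (auto simp: bump_def)

lemma bump_support: "closure {x. bump x \<noteq> 0} \<subseteq> {1 / 2..2}"
  by (rule closure_minimal) (auto simp: bump_def split: if_splits)

lemma bump_eq_0: "x \<le> 1 / 2 \<or> x \<ge> 2 \<Longrightarrow> bump x = 0"
  by (auto simp: bump_def)

lemma bump_has_derivative:
  obtains b' where "\<And>x. (bump has_real_derivative b' x) (at x)" "continuous_on UNIV b'"
proof -
  have "(bump has_real_derivative (bump_family (pderiv 1 * bump_poly ^ 2 - smult (real 0) (1 * bump_poly * pderiv bump_poly) + 1 * pderiv bump_poly) (0 + 2)) x) (at x)" for x
    unfolding bump_eq_bump_family by (rule DERIV_bump_family)
  moreover have "continuous_on UNIV (bump_family P m)" for P m
    by (rule DERIV_continuous_on [OF has_field_derivative_at_within [OF DERIV_bump_family]])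
  ultimately show ?thesis using that by blast
qed

lemma continuous_bump: "continuous_on A bump"
  using bump_has_derivative by (metis DERIV_continuous_on has_field_derivative_at_within)

section \<open>The Mellin transform of the weight, its size and its sign\<close>

definition mellin :: "complex \<Rightarrow> complex" where
  "mellin s = integral {1 / 2..2} (\<lambda>x. of_real (bump x) * exp ((s - 1) * of_real (ln x)))"

lemma continuous_mellin_integrand:
  "continuous_on {1 / 2..2} (\<lambda>x. complex_of_real (bump x) * exp ((s - 1) * of_real (ln x)))"
  by (intro continuous_intros continuous_bump) auto

lemma mellin_integrable:
  "(\<lambda>x. complex_of_real (bump x) * exp ((s - 1) * of_real (ln x))) integrable_on {1 / 2..2}"
  by (rule integrable_continuous_interval [OF continuous_mellin_integrand])

lemma mellin_holomorphic: "mellin holomorphic_on A"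
proof -
  have "(\<lambda>s. integral (cbox (1 / 2) 2) (\<lambda>x. complex_of_real (bump x) * exp ((s - 1) * of_real (ln x)))) holomorphic_on UNIV"
  proof (rule leibniz_rule_holomorphic)
    show "((\<lambda>s. complex_of_real (bump t) * exp ((s - 1) * of_real (ln t))) has_field_derivative
        complex_of_real (bump t) * (exp ((s - 1) * of_real (ln t)) * of_real (ln t))) (at s within UNIV)" for s t
      by (auto intro!: derivative_eq_intros)
    show "(\<lambda>x. complex_of_real (bump x) * exp ((s - 1) * of_real (ln x))) integrable_on cbox (1 / 2) 2" for s
      using mellin_integrable by simp
    have c: "continuous_on (UNIV \<times> cbox (1 / 2) 2) (\<lambda>p. bump (snd p))"
      by (rule continuous_on_compose2 [OF continuous_bump [of UNIV]]) (auto intro!: continuous_intros)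
    show "continuous_on (UNIV \<times> cbox (1 / 2) 2)
       (\<lambda>(s, t). complex_of_real (bump t) * (exp ((s - 1) * of_real (ln t)) * of_real (ln t)))"
      unfolding case_prod_beta by (intro continuous_intros c) auto
  qed simp
  then have "mellin holomorphic_on UNIV" by (simp add: mellin_def [abs_def])
  then show ?thesis by (rule holomorphic_on_subset) auto
qed

lemma ln_le_1_half_2:
  assumes "x \<in> {1 / 2..2 :: real}"
  shows "\<bar>ln x\<bar> \<le> ln 2"
proof -
  have "ln x \<le> ln 2" using assms by (subst ln_le_cancel_iff) auto
  moreover have "ln (1 / 2) \<le> ln x" using assms by (subst ln_le_cancel_iff) auto
  moreover have "ln (1 / 2) = - ln (2 :: real)" by (simp add: ln_div)
  ultimately show ?thesis by simp
qed

text \<open>The range of \<open>c\<close> is that of \<open>Re s - 1\<close> for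
  \<open>\<bar>Re s\<bar> \<le> 2\<close>; the value 8 is \<open>2 ^ 3\<close>.\<close>

lemma exp_mult_ln_bound:
  assumes "x \<in> {1 / 2..2 :: real}" "\<bar>c\<bar> \<le> 3"
  shows "exp (c * ln x) \<le> 8"
proof -
  have "c * ln x \<le> \<bar>c\<bar> * \<bar>ln x\<bar>" by (simp flip: abs_mult)
  also have "\<dots> \<le> 3 * ln 2" using assms ln_le_1_half_2 [OF assms(1)] by (intro mult_mono) auto
  also have "3 * ln 2 = ln (2 ^ 3 :: real)" by (subst ln_realpow) auto
  finally have "exp (c * ln x) \<le> exp (ln (2 ^ 3))" by (subst exp_le_cancel_iff)
  then show ?thesis by simp
qed

lemma mellin_bound:
  assumes "\<bar>Re s\<bar> \<le> 2"
  shows "norm (mellin s) \<le> 12"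
proof -
  have "norm (mellin s) \<le> 8 * (2 - 1 / 2)"
    unfolding mellin_def
  proof (rule integral_bound [OF _ continuous_mellin_integrand])
    fix x :: real assume x: "x \<in> {1 / 2..2}"
    have "norm (complex_of_real (bump x) * exp ((s - 1) * of_real (ln x))) = bump x * exp ((Re s - 1) * ln x)"
      using bump_nonneg [of x] by (simp add: norm_mult)
    also have "\<dots> \<le> 1 * 8"
      using assms by (intro mult_mono bump_le_1 exp_mult_ln_bound x bump_nonneg) auto
    finally show "norm (complex_of_real (bump x) * exp ((s - 1) * of_real (ln x))) \<le> 8" by simp
  qed auto
  then show ?thesis by simp
qed

lemma mellin_cnj: "mellin (cnj s) = cnj (mellin s)"
proof -
  have "((\<lambda>x. complex_of_real (bump x) * exp ((s - 1) * of_real (ln x))) has_integral mellin s) {1 / 2..2}"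
    unfolding mellin_def using mellin_integrable by (rule integrable_integral)
  from has_integral_linear [OF this bounded_linear_cnj]
  have "((\<lambda>x. complex_of_real (bump x) * exp ((cnj s - 1) * of_real (ln x))) has_integral cnj (mellin s)) {1 / 2..2}"
    by (simp add: o_def exp_cnj)
  then show ?thesis unfolding mellin_def by (rule integral_unique)
qed

text \<open>
  On the two legs of the right triangle \<open>wedge\<close> over \<open>[1/2, 2]\<close> the height \<open>Im z\<close> is comparable to the
  distance from the corner. There, for a constant \<open>c > 0\<close>, \<open>z powr (s - 1)\<close> is at most of order \<open>exp (- c * Im s * Im z)\<close> and the
  weight is at most \<open>exp (- c / Im z)\<close>, so that their product is at most of order \<open>exp (- c * sqrt (Im s))\<close>.
\<close>

definition cbump :: "complex \<Rightarrow> complex" where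
  "cbump z = (if z = 1 / 2 \<or> z = 2 then 0 else exp (- (1 / ((z - 1 / 2) * (2 - z)))))"

definition wedge :: "complex set" where
  "wedge = {z. 0 \<le> Im z \<and> Im z \<le> Re z - 1 / 2 \<and> Im z \<le> 2 - Re z}"

lemma cbump_of_real: "x \<in> {1 / 2..2} \<Longrightarrow> cbump (of_real x) = of_real (bump x)"
proof -
  assume x: "x \<in> {1 / 2..2}"
  consider "x = 1 / 2" | "x = 2" | "1 / 2 < x" "x < 2" using x by force
  then show ?thesis
  proof cases
    case 3
    have "complex_of_real x \<noteq> 1 / 2" "complex_of_real x \<noteq> 2"
      using 3 by (auto simp: complex_eq_iff)
    moreover have "- (1 / ((complex_of_real x - 1 / 2) * (2 - complex_of_real x))) = of_real (- (1 / ((x - 1 / 2) * (2 - x))))"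
      by simp
    ultimately show ?thesis using 3 by (simp only: cbump_def bump_def exp_of_real) simp
  next
    case 1
    have "complex_of_real x = 1 / 2" unfolding 1 by simp
    then have "cbump (of_real x) = 0" by (simp only: cbump_def) simp
    then show ?thesis by (simp only: bump_def 1) simp
  next
    case 2
    then show ?thesis by (simp add: cbump_def bump_def)
  qed
qed

lemma Re_inverse_ge:
  assumes "w \<noteq> 0" "\<bar>Im w\<bar> \<le> Re w"
  shows "Re (1 / w) \<ge> 1 / (2 * norm w)"
proof -
  have "norm w \<le> \<bar>Re w\<bar> + \<bar>Im w\<bar>" by (rule cmod_le)
  then have n: "norm w \<le> 2 * Re w" using assms by linarith
  have p: "norm w > 0" using assms by simp
  have "Re (1 / w) = Re w / (norm w)\<^sup>2" by (simp add: Re_divide cmod_power2)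
  also have "\<dots> \<ge> (norm w / 2) / (norm w)\<^sup>2" using n p by (intro divide_right_mono) auto
  also have "(norm w / 2) / (norm w)\<^sup>2 = 1 / (2 * norm w)" using p by (simp add: power2_eq_square)
  finally show ?thesis .
qed

text \<open>By partial fractions the exponent is \<open>- (2 / 3)\<close> times the sum of
  \<open>1 / (z - 1 / 2)\<close> and \<open>1 / (2 - z)\<close>. On the triangle both differences
  lie in the sector \<open>\<bar>Im w\<bar> \<le> Re w\<close>, so both reciprocals have nonnegative
  real part and either of them alone gives a bound.\<close>

lemma norm_cbump_le:
  assumes z: "z \<in> wedge"
  shows "z \<noteq> 1 / 2 \<Longrightarrow> norm (cbump z) \<le> exp (- (1 / (3 * norm (z - 1 / 2))))"
    and "z \<noteq> 2 \<Longrightarrow> norm (cbump z) \<le> exp (- (1 / (3 * norm (z - 2))))"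
proof -
  have main: "norm (cbump z) \<le> exp (- (1 / (3 * norm (z - 1 / 2)))) \<and> norm (cbump z) \<le> exp (- (1 / (3 * norm (z - 2))))"
    if ne: "z \<noteq> 1 / 2" "z \<noteq> 2"
  proof -
    have w: "z - 1 / 2 \<noteq> 0" "2 - z \<noteq> 0" using ne by auto
    have "1 / ((z - 1 / 2) * (2 - z)) = (2 / 3) * (1 / (z - 1 / 2) + 1 / (2 - z))"
      using w by (simp add: divide_simps)
    then have "Re (1 / ((z - 1 / 2) * (2 - z))) = Re ((2 / 3) * (1 / (z - 1 / 2) + 1 / (2 - z)))" by (simp only:)
    also have "Re ((2 / 3) * (A + B)) = 2 / 3 * (Re A + Re B)" for A B :: complex by simp
    finally have re: "Re (1 / ((z - 1 / 2) * (2 - z))) = 2 / 3 * (Re (1 / (z - 1 / 2)) + Re (1 / (2 - z)))" .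
    have r1: "Re (1 / (z - 1 / 2)) \<ge> 1 / (2 * norm (z - 1 / 2))"
      using z w by (intro Re_inverse_ge) (auto simp: wedge_def)
    have r2: "Re (1 / (2 - z)) \<ge> 1 / (2 * norm (2 - z))"
      using z w by (intro Re_inverse_ge) (auto simp: wedge_def)
    have p: "1 / (2 * norm (z - 1 / 2)) \<ge> 0" "1 / (2 * norm (2 - z)) \<ge> 0" by auto
    have gen: "x \<le> R \<and> y \<le> R"
      if "x = 2 / 3 * a" "y = 2 / 3 * b" "R = 2 / 3 * (r + q)" "a \<le> r" "b \<le> q" "0 \<le> a" "0 \<le> b"
      for x y R a b r q :: real using that by auto
    have "norm (cbump z) = exp (- Re (1 / ((z - 1 / 2) * (2 - z))))"
      using ne by (simp add: cbump_def)
    moreover have "1 / (3 * norm (z - 1 / 2)) = 2 / 3 * (1 / (2 * norm (z - 1 / 2)))"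
      "1 / (3 * norm (z - 2)) = 2 / 3 * (1 / (2 * norm (2 - z)))" by (simp_all add: norm_minus_commute)
    note gen [OF this re r1 r2 p]
    ultimately show ?thesis by simp
  qed
  show "z \<noteq> 1 / 2 \<Longrightarrow> norm (cbump z) \<le> exp (- (1 / (3 * norm (z - 1 / 2))))"
    using main by (cases "z = 2") (auto simp: cbump_def)
  show "z \<noteq> 2 \<Longrightarrow> norm (cbump z) \<le> exp (- (1 / (3 * norm (z - 2))))"
    using main by (cases "z = 1 / 2") (auto simp: cbump_def)
qed

lemma exp_minus_inverse_le: "r > 0 \<Longrightarrow> exp (- (1 / r)) \<le> (r :: real)"
proof -
  assume r: "r > 0"
  have "1 / r \<le> exp (1 / r)" using exp_ge_add_one_self [of "1 / r"] by linarith
  then show ?thesis using r by (simp add: exp_minus field_simps)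
qed

lemma cbump_holomorphic: "cbump holomorphic_on - {1 / 2, 2}"
proof -
  have "(\<lambda>z. exp (- (1 / ((z - 1 / 2) * (2 - z))))) holomorphic_on - {1 / 2, 2}"
    by (intro holomorphic_intros) auto
  then show ?thesis by (rule holomorphic_transform) (auto simp: cbump_def)
qed

lemma continuous_cbump: "continuous_on wedge cbump"
  unfolding continuous_on_eq_continuous_within
proof
  fix z0 assume z0: "z0 \<in> wedge"
  have le: "norm (cbump z) \<le> 3 * norm (z - c)" if "z \<in> wedge" "c = 1 / 2 \<or> c = 2" for z c
  proof (cases "z = c")
    case True
    then show ?thesis using that by (auto simp: cbump_def)
  next
    case False
    have "norm (cbump z) \<le> exp (- (1 / (3 * norm (z - c))))"
    proof (rule disjE [OF that(2)])
      assume c: "c = 1 / 2"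
      show ?thesis unfolding c by (rule norm_cbump_le(1) [OF that(1) False [unfolded c]])
    next
      assume c: "c = 2"
      show ?thesis unfolding c by (rule norm_cbump_le(2) [OF that(1) False [unfolded c]])
    qed
    also have "\<dots> \<le> 3 * norm (z - c)" using False by (intro exp_minus_inverse_le) auto
    finally show ?thesis .
  qed
  have end_pt: "continuous (at c within wedge) cbump" if c: "c = 1 / 2 \<or> c = 2" for c
  proof -
    have "(cbump \<longlongrightarrow> 0) (at c within wedge)"
    proof (rule Lim_null_comparison)
      show "\<forall>\<^sub>F z in at c within wedge. norm (cbump z) \<le> 3 * norm (z - c)"
        using le [OF _ c] by (auto simp: eventually_at_filter)
      show "((\<lambda>z. 3 * norm (z - c)) \<longlongrightarrow> 0) (at c within wedge)"
        by (rule tendsto_eq_intros refl | simp)+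
    qed
    then show ?thesis using c by (auto simp: continuous_within cbump_def)
  qed
  show "continuous (at z0 within wedge) cbump"
  proof (cases "z0 = 1 / 2 \<or> z0 = 2")
    case True
    then show ?thesis by (rule end_pt)
  next
    case False
    have "open (- {1 / 2, 2 :: complex})" by (intro open_Compl finite_imp_closed) auto
    then have "continuous (at z0) cbump"
      using holomorphic_on_imp_continuous_on [OF cbump_holomorphic] False
      by (auto simp: continuous_on_eq_continuous_at)
    then show ?thesis by (rule continuous_at_imp_continuous_within)
  qed
qed

lemma wedge_norm: "z \<in> wedge \<Longrightarrow> 1 / 2 \<le> norm z" "z \<in> wedge \<Longrightarrow> norm z \<le> 2"
proof -
  assume z: "z \<in> wedge"
  show "1 / 2 \<le> norm z" using z complex_Re_le_cmod [of z] by (auto simp: wedge_def)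
  have "norm z \<le> \<bar>Re z\<bar> + \<bar>Im z\<bar>" by (rule cmod_le)
  then show "norm z \<le> 2" using z by (auto simp: wedge_def)
qed

lemma Im_Ln_ge:
  assumes "z \<noteq> 0" "Im z \<ge> 0"
  shows "Im (Ln z) \<ge> Im z / norm z"
proof -
  have "Im z = norm z * sin (Im (Ln z))"
    using Im_exp [of "Ln z"] assms by simp
  moreover have "0 \<le> Im (Ln z)" using Im_Ln_pos_le [OF assms(1)] assms(2) by simp
  ultimately have "Im z \<le> norm z * Im (Ln z)" using sin_x_le_x by (metis mult_left_mono norm_ge_zero)
  then show ?thesis using assms by (simp add: field_simps)
qed

lemma mellin_decay_pos:
  assumes s: "\<bar>Re s\<bar> \<le> 2" "Im s \<ge> 0"
  shows "norm (mellin s) \<le> 24 * exp (- (sqrt (Im s) / 2))"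
proof -
  \<comment> \<open>The integral over the base of the triangle is \<open>mellin s\<close>, so by
    Cauchy's theorem it equals minus the integrals over the two legs meeting at \<open>c\<close>.
    This moves the path to where \<open>z powr (s - 1)\<close> decays with
    \<open>Im s\<close>.\<close>
  define a b c where "a = (1 / 2 :: complex)" and "b = (2 :: complex)" and "c = Complex (5 / 4) (3 / 4)"
  define \<Phi> where "\<Phi> z = cbump z * exp ((s - 1) * Ln z)" for z
  define T where "T = convex hull {a, b, c}"
  have convR: "convex wedge"
  proof -
    have w: "wedge = {z. Im z \<ge> 0} \<inter> {z. inner (Complex 1 (- 1)) z \<ge> 1 / 2} \<inter> {z. inner (Complex 1 1) z \<le> 2}"
      by (auto simp: wedge_def inner_complex_def)
    show ?thesis unfolding w
      by (intro convex_Int convex_halfspace_ge convex_halfspace_le convex_halfspace_Im_ge)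
  qed
  have TR: "T \<subseteq> wedge" unfolding T_def
    by (rule hull_minimal) (use convR in \<open>auto simp: wedge_def a_def b_def c_def\<close>)
  have LnR: "z \<notin> \<real>\<^sub>\<le>\<^sub>0" if "z \<in> wedge" for z
    using that by (auto simp: wedge_def complex_nonpos_Reals_iff)
  have cont: "continuous_on T \<Phi>"
    unfolding \<Phi>_def using TR LnR
    by (intro continuous_intros continuous_on_subset [OF continuous_cbump]) auto
  have hol: "\<Phi> holomorphic_on interior T"
  proof -
    have "interior T \<subseteq> - {1 / 2, 2}"
    proof -
      have "x \<noteq> e" if xi: "x \<in> interior T" and ec: "e = 1 / 2 \<or> e = 2" for x e
      proof
        assume "x = e"
        obtain r where "r > 0" "ball x r \<subseteq> interior T"
          using openE [OF open_interior xi] by blast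
        then have r: "r > 0" "ball x r \<subseteq> T" using interior_subset by blast+
        have "x - of_real (r / 2) * \<i> \<in> ball x r" using r by (simp add: dist_norm norm_mult)
        then have "x - of_real (r / 2) * \<i> \<in> wedge" using r TR by blast
        moreover have "Im x = 0"
        proof (rule disjE [OF ec])
          assume e: "e = 1 / 2"
          show ?thesis unfolding \<open>x = e\<close> e by simp
        next
          assume e: "e = 2"
          show ?thesis unfolding \<open>x = e\<close> e by simp
        qed
        ultimately show False using r by (simp add: wedge_def)
      qed
      then show ?thesis by blast
    qed
    then have "cbump holomorphic_on interior T" by (rule holomorphic_on_subset [OF cbump_holomorphic])
    moreover have "z \<notin> \<real>\<^sub>\<le>\<^sub>0" if "z \<in> interior T" for z
      using that TR LnR interior_subset by blast
    ultimately show ?thesis unfolding \<Phi>_def [abs_def] by (intro holomorphic_intros) auto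
  qed
  have seg: "closed_segment a b \<subseteq> T" "closed_segment b c \<subseteq> T" "closed_segment c a \<subseteq> T"
    unfolding T_def segment_convex_hull by (rule hull_mono, blast)+
  have int: "\<Phi> contour_integrable_on linepath a b" "\<Phi> contour_integrable_on linepath b c" "\<Phi> contour_integrable_on linepath c a"
    using seg by (auto intro!: contour_integrable_continuous_linepath continuous_on_subset [OF cont])
  have "(\<Phi> has_contour_integral 0) (linepath a b +++ linepath b c +++ linepath c a)"
    using Cauchy_theorem_triangle_interior [OF cont [unfolded T_def] hol [unfolded T_def]] .
  moreover have "(\<Phi> has_contour_integral (contour_integral (linepath a b) \<Phi> + (contour_integral (linepath b c) \<Phi> + contour_integral (linepath c a) \<Phi>)))
      (linepath a b +++ linepath b c +++ linepath c a)"
    using int by (intro has_contour_integral_join has_contour_integral_integral valid_path_join) auto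
  ultimately have sum0: "contour_integral (linepath a b) \<Phi> + (contour_integral (linepath b c) \<Phi> + contour_integral (linepath c a) \<Phi>) = 0"
    using has_contour_integral_unique by blast
  have ab: "contour_integral (linepath a b) \<Phi> = mellin s"
  proof (rule contour_integral_unique)
    have "((\<lambda>x. complex_of_real (bump x) * exp ((s - 1) * of_real (ln x))) has_integral mellin s) {1 / 2..2}"
      unfolding mellin_def using mellin_integrable by (rule integrable_integral)
    then have "((\<lambda>x. \<Phi> (of_real x)) has_integral mellin s) {1 / 2..2}"
      by (rule has_integral_eq [rotated]) (auto simp: \<Phi>_def cbump_of_real Ln_of_real)
    then show "(\<Phi> has_contour_integral mellin s) (linepath a b)"
      by (subst has_contour_integral_linepath_Reals_iff) (auto simp: a_def b_def)
  qed
  have bd: "norm (\<Phi> z) \<le> 8 * exp (- (sqrt (Im s) / 2))"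
    if z: "z \<in> wedge" and leg: "Im z = Re z - 1 / 2 \<or> Im z = 2 - Re z" for z
  proof (cases "Im z = 0")
    case True
    then have "z = 1 / 2 \<or> z = 2" using leg by (auto simp: complex_eq_iff)
    then show ?thesis by (auto simp: \<Phi>_def cbump_def)
  next
    case False
    define y where "y = Im z"
    have y: "y > 0" using False z by (auto simp: y_def wedge_def)
    have nz: "z \<noteq> 0" using wedge_norm(1) [OF z] by auto
    have ne: "z \<noteq> 1 / 2" "z \<noteq> 2"
    proof -
      show "z \<noteq> 1 / 2"
      proof
        assume e: "z = 1 / 2"
        have "Im z = 0" unfolding e by simp
        with False show False by simp
      qed
    qed (use False in auto)
    have "norm (cbump z) \<le> exp (- (1 / (6 * y)))"
    proof -
      have "norm (z - 1 / 2) \<le> 2 * y \<or> norm (z - 2) \<le> 2 * y"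
        using leg cmod_le [of "z - 1 / 2"] cmod_le [of "z - 2"] y z by (auto simp: y_def wedge_def)
      moreover have "exp (- (1 / (3 * r))) \<le> exp (- (1 / (6 * y)))" if "0 < r" "r \<le> 2 * y" for r
        using that y by (simp add: field_simps)
      ultimately show ?thesis
        using norm_cbump_le(1) [OF z ne(1)] norm_cbump_le(2) [OF z ne(2)] ne
        by (meson order_trans right_minus_eq zero_less_norm_iff)
    qed
    moreover have "norm (exp ((s - 1) * Ln z)) \<le> 8 * exp (- (Im s * y / 2))"
    proof -
      have "norm (exp ((s - 1) * Ln z)) = exp ((Re s - 1) * ln (norm z)) * exp (- (Im s * Im (Ln z)))"
        using nz by (simp flip: exp_add)
      also have "\<dots> \<le> 8 * exp (- (Im s * y / 2))"
      proof (rule mult_mono)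
        show "exp ((Re s - 1) * ln (norm z)) \<le> 8"
          using wedge_norm [OF z] s by (intro exp_mult_ln_bound) auto
        have "y / 2 \<le> y / norm z" using wedge_norm [OF z] y nz by (intro divide_left_mono) auto
        also have "\<dots> \<le> Im (Ln z)" unfolding y_def using nz y by (intro Im_Ln_ge) (auto simp: y_def)
        finally have "Im s * (y / 2) \<le> Im s * Im (Ln z)" using s by (intro mult_left_mono) auto
        then show "exp (- (Im s * Im (Ln z))) \<le> exp (- (Im s * y / 2))" by simp
      qed auto
      finally show ?thesis .
    qed
    ultimately have "norm (\<Phi> z) \<le> exp (- (1 / (6 * y))) * (8 * exp (- (Im s * y / 2)))"
      unfolding \<Phi>_def norm_mult by (intro mult_mono) auto
    also have "\<dots> = 8 * exp (- (1 / (6 * y) + Im s * y / 2))" by (simp flip: exp_add)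
    \<comment> \<open>By the inequality of arithmetic and geometric means the exponent
      \<open>1 / (6 * y) + Im s * y / 2\<close> is at least \<open>2 * sqrt (Im s / 12)\<close> for
      every \<open>y\<close>, hence at least \<open>sqrt (Im s) / 2\<close>.\<close>
    also have "\<dots> \<le> 8 * exp (- (sqrt (Im s) / 2))"
    proof -
      have e: "(1 / (6 * y)) * (Im s * y / 2) = Im s / 12" using y by simp
      have "sqrt ((1 / (6 * y)) * (Im s * y / 2)) \<le> (1 / (6 * y) + Im s * y / 2) / 2"
        using y s by (intro arith_geo_mean_sqrt) auto
      then have "sqrt (Im s / 12) \<le> (1 / (6 * y) + Im s * y / 2) / 2" unfolding e .
      moreover have "sqrt (Im s / 16) \<le> sqrt (Im s / 12)" using s by simp
      moreover have "sqrt (Im s / 16) = sqrt (Im s) / 4" by (simp add: real_sqrt_divide)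
      moreover have "X / 2 \<le> Q" if "a \<le> Q / 2" "b \<le> a" "b = X / 4" for X Q a b :: real
        using that by linarith
      ultimately have "sqrt (Im s) / 2 \<le> 1 / (6 * y) + Im s * y / 2" by metis
      then show ?thesis by simp
    qed
    finally show ?thesis .
  qed
  have legs: "norm (contour_integral (linepath b c) \<Phi>) \<le> 8 * exp (- (sqrt (Im s) / 2)) * norm (c - b)"
    "norm (contour_integral (linepath c a) \<Phi>) \<le> 8 * exp (- (sqrt (Im s) / 2)) * norm (a - c)"
  proof -
    have onseg: "z \<in> wedge \<and> (Im z = Re z - 1 / 2 \<or> Im z = 2 - Re z)"
      if zs: "z \<in> closed_segment b c \<union> closed_segment c a" for z
    proof
      show "z \<in> wedge" using zs seg TR by blast
      show "Im z = Re z - 1 / 2 \<or> Im z = 2 - Re z"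
      proof -
        have ex: "\<exists>u. Re z = (1 - u) * Re p + u * Re q \<and> Im z = (1 - u) * Im p + u * Im q"
          if "z \<in> closed_segment p q" for p q
          using that by (auto simp: closed_segment_def)
        then obtain u where "Re z = (1 - u) * Re b + u * Re c \<and> Im z = (1 - u) * Im b + u * Im c \<or>
            Re z = (1 - u) * Re c + u * Re a \<and> Im z = (1 - u) * Im c + u * Im a"
          using zs ex [of b c] ex [of c a] by blast
        then show ?thesis
        proof
          assume "Re z = (1 - u) * Re b + u * Re c \<and> Im z = (1 - u) * Im b + u * Im c"
          then have "Im z = 2 - Re z" by (simp add: b_def c_def algebra_simps)
          then show ?thesis ..
        next
          assume "Re z = (1 - u) * Re c + u * Re a \<and> Im z = (1 - u) * Im c + u * Im a"
          then have "Im z = Re z - 1 / 2" by (simp add: a_def c_def field_simps)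
          then show ?thesis ..
        qed
      qed
    qed
    show "norm (contour_integral (linepath b c) \<Phi>) \<le> 8 * exp (- (sqrt (Im s) / 2)) * norm (c - b)"
      by (rule contour_integral_bound_linepath [OF int(2)]) (use onseg bd in auto)
    show "norm (contour_integral (linepath c a) \<Phi>) \<le> 8 * exp (- (sqrt (Im s) / 2)) * norm (a - c)"
      by (rule contour_integral_bound_linepath [OF int(3)]) (use onseg bd in auto)
  qed
  have len: "norm (c - b) \<le> 3 / 2" "norm (a - c) \<le> 3 / 2"
    using cmod_le [of "c - b"] cmod_le [of "a - c"] by (auto simp: a_def b_def c_def)
  have "norm (mellin s) = norm (contour_integral (linepath b c) \<Phi> + contour_integral (linepath c a) \<Phi>)"
    using sum0 unfolding ab by (simp add: add_eq_0_iff)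
  also have "\<dots> \<le> 8 * exp (- (sqrt (Im s) / 2)) * norm (c - b) + 8 * exp (- (sqrt (Im s) / 2)) * norm (a - c)"
    using legs by (intro order_trans [OF norm_triangle_ineq] add_mono)
  also have "\<dots> \<le> 8 * exp (- (sqrt (Im s) / 2)) * (3 / 2) + 8 * exp (- (sqrt (Im s) / 2)) * (3 / 2)"
    using len by (intro add_mono mult_left_mono) auto
  finally show ?thesis by simp
qed

lemma mellin_decay:
  assumes s: "\<bar>Re s\<bar> \<le> 2"
  shows "norm (mellin s) \<le> 24 * exp (- (sqrt \<bar>Im s\<bar> / 2))"
proof (cases "Im s \<ge> 0")
  case True
  then show ?thesis using mellin_decay_pos [of s] s by simp
next
  case False
  then have "norm (mellin (cnj s)) \<le> 24 * exp (- (sqrt (Im (cnj s)) / 2))"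
    using s by (intro mellin_decay_pos) auto
  then show ?thesis using False by (simp add: mellin_cnj)
qed

text \<open>On the support \<open>\<bar>ln x\<bar> \<le> ln 2 < 1\<close>, so the phase of the
  integrand is at most \<open>1 + 1 / 4\<close> in absolute value, which is below
  \<open>pi / 2\<close>. The rotation by \<open>\<theta>\<close> makes room for the phase that a
  small difference of real parts of two zeros produces.\<close>

lemma Re_mellin_nonneg:
  assumes "\<bar>Im s\<bar> \<le> 1" "\<bar>\<theta>\<bar> \<le> 1 / 4"
  shows "Re (mellin s * exp (\<i> * of_real \<theta>)) \<ge> 0"
proof -
  have "((\<lambda>x. complex_of_real (bump x) * exp ((s - 1) * of_real (ln x)) * exp (\<i> * of_real \<theta>)) has_integral mellin s * exp (\<i> * of_real \<theta>)) {1 / 2..2}"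
    unfolding mellin_def by (intro has_integral_mult_left integrable_integral mellin_integrable)
  from has_integral_linear [OF this bounded_linear_Re]
  have "((\<lambda>x. Re (complex_of_real (bump x) * exp ((s - 1) * of_real (ln x)) * exp (\<i> * of_real \<theta>))) has_integral Re (mellin s * exp (\<i> * of_real \<theta>))) {1 / 2..2}"
    by (simp add: o_def)
  then show ?thesis
  proof (rule has_integral_nonneg)
    fix x :: real assume x: "x \<in> {1 / 2..2}"
    have l: "\<bar>ln x\<bar> \<le> 1" using ln_le_1_half_2 [OF x] ln_2_less_1 by linarith
    have e: "complex_of_real (bump x) * exp ((s - 1) * of_real (ln x)) * exp (\<i> * of_real \<theta>) =
        of_real (bump x) * exp (Complex ((Re s - 1) * ln x) (Im s * ln x + \<theta>))"
      unfolding mult.assoc by (simp add: complex_eq_iff flip: exp_add) (simp add: Re_exp Im_exp)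
    have "Re (complex_of_real (bump x) * exp ((s - 1) * of_real (ln x)) * exp (\<i> * of_real \<theta>)) =
        bump x * (exp ((Re s - 1) * ln x) * cos (Im s * ln x + \<theta>))"
      unfolding e by (simp add: Re_exp)
    moreover have "\<bar>Im s * ln x\<bar> \<le> 1 * 1" unfolding abs_mult using assms l by (intro mult_mono) auto
    then have "\<bar>Im s * ln x + \<theta>\<bar> \<le> 5 / 4" using assms by linarith
    then have "- (pi / 2) \<le> Im s * ln x + \<theta>" "Im s * ln x + \<theta> \<le> pi / 2"
      using pi_gt3 by linarith+
    then have "cos (Im s * ln x + \<theta>) \<ge> 0" by (rule cos_ge_zero)
    ultimately show "0 \<le> Re (complex_of_real (bump x) * exp ((s - 1) * of_real (ln x)) * exp (\<i> * of_real \<theta>))"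
      using bump_nonneg by simp
  qed
qed

lemma Re_mellin_0: "Re (mellin 0) > 0"
proof -
  have "((\<lambda>x. complex_of_real (bump x) * exp ((0 - 1) * of_real (ln x))) has_integral mellin 0) {1 / 2..2}"
    unfolding mellin_def by (intro integrable_integral mellin_integrable)
  from has_integral_linear [OF this bounded_linear_Re]
  have "((\<lambda>x. bump x * exp (- ln x)) has_integral Re (mellin 0)) {1 / 2..2}"
    by (simp add: o_def Re_exp)
  then have I: "((\<lambda>x. bump x / x) has_integral Re (mellin 0)) {1 / 2..2}"
    by (rule has_integral_eq [rotated]) (auto simp: exp_minus field_simps)
  have "continuous_on {1 / 2..2} (\<lambda>x. bump x / x)"
    by (intro continuous_intros continuous_bump) auto
  then have c: "continuous_on {1..3 / 2} (\<lambda>x. bump x / x)"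
    by (rule continuous_on_subset) auto
  have "exp (- 4) / 2 * (3 / 2 - 1) \<le> integral {1..3 / 2} (\<lambda>x. bump x / x)"
  proof -
    have "integral {1..3 / 2 :: real} (\<lambda>x. exp (- 4) / 2) \<le> integral {1..3 / 2} (\<lambda>x. bump x / x)"
    proof (rule integral_le)
      show "(\<lambda>x. bump x / x) integrable_on {1..3 / 2}" by (rule integrable_continuous_interval [OF c])
      fix x :: real assume x: "x \<in> {1..3 / 2}"
      have "1 / 2 * (1 / 2) \<le> (x - 1 / 2) * (2 - x)" using x by (intro mult_mono) auto
      then have "1 / ((x - 1 / 2) * (2 - x)) \<le> 1 / (1 / 4)" by (intro divide_left_mono) auto
      then have "exp (- 4) \<le> bump x" using x by (simp add: bump_def)
      then show "exp (- 4) / 2 \<le> bump x / x" using x bump_nonneg [of x] by (intro frac_le) auto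
    qed auto
    then show ?thesis by simp
  qed
  also have "\<dots> \<le> integral {1 / 2..2} (\<lambda>x. bump x / x)"
  proof (rule integral_subset_le)
    show "(\<lambda>x. bump x / x) integrable_on {1..3 / 2}" by (rule integrable_continuous_interval [OF c])
    show "(\<lambda>x. bump x / x) integrable_on {1 / 2..2}" using I by blast
  qed (use bump_nonneg in auto)
  also have "\<dots> = Re (mellin 0)" using I by (rule integral_unique)
  finally have "exp (- 4) / 2 * (3 / 2 - 1) \<le> Re (mellin 0)" .
  moreover have "(0 :: real) < exp (- 4) / 2 * (3 / 2 - 1)" by simp
  ultimately show ?thesis by linarith
qed

section \<open>Mellin inversion\<close>

lemma integral_exp_i_sinc:
  assumes "X \<ge> 0"
  shows "integral {-X..X} (\<lambda>t. exp (\<i> * of_real (t * l))) = of_real (2 * X * sinc (X * l))"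
proof (cases "l = 0")
  case True
  then show ?thesis using assms by (simp add: content_real scaleR_conv_of_real)
next
  case False
  have "((\<lambda>t. exp (\<i> * of_real (t * l))) has_integral exp (\<i> * of_real (X * l)) / (\<i> * of_real l) - exp (\<i> * of_real (- X * l)) / (\<i> * of_real l)) {-X..X}"
  proof (rule fundamental_theorem_of_calculus)
    fix t
    have "((\<lambda>t. exp (\<i> * (t * of_real l)) / (\<i> * of_real l)) has_field_derivative exp (\<i> * (of_real t * of_real l))) (at (of_real t))"
    proof -
      have "((\<lambda>t. exp (\<i> * (t * of_real l))) has_field_derivative exp (\<i> * (of_real t * of_real l)) * (\<i> * of_real l)) (at (of_real t))"
        by (auto intro!: derivative_eq_intros)
      from DERIV_cdivide [OF this, of "\<i> * of_real l"] show ?thesis using False by simp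
    qed
    from has_vector_derivative_real_field [OF this]
    show "((\<lambda>t. exp (\<i> * of_real (t * l)) / (\<i> * of_real l)) has_vector_derivative exp (\<i> * of_real (t * l))) (at t within {-X..X})"
      by (simp add: o_def)
  qed (use assms in auto)
  moreover have "exp (\<i> * of_real (X * l)) / (\<i> * of_real l) - exp (\<i> * of_real (- X * l)) / (\<i> * of_real l) = of_real (2 * X * sinc (X * l))"
  proof (cases "X = 0")
    case True
    then show ?thesis by simp
  next
    case X: False
    have "exp (\<i> * of_real (X * l)) - exp (\<i> * of_real (- X * l)) = 2 * \<i> * of_real (sin (X * l))"
      by (simp add: complex_eq_iff Re_exp Im_exp)
    then show ?thesis using False X by (simp add: diff_divide_distrib [symmetric])
  qed
  ultimately show ?thesis by (simp add: integral_unique)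
qed

text \<open>After the order of integration is exchanged, the integral over \<open>t\<close> is a
  \<open>sinc\<close> kernel, which up to the factor \<open>1 / x\<close> is the derivative of
  \<open>2 * Si (X * (ln x - ln y))\<close>. As \<open>g\<close> vanishes at both ends, integration
  by parts leaves the bounded kernel \<open>Si\<close>, for which the limit of large
  \<open>X\<close> is harmless.\<close>

lemma mellin_partial_inversion:
  fixes X y \<sigma> :: real
  assumes y: "y > 0" and X: "X \<ge> 0"
  defines "g \<equiv> \<lambda>x. bump x * exp (\<sigma> * (ln x - ln y))"
  assumes g': "\<And>x. x \<in> {1 / 2..2} \<Longrightarrow> (g has_real_derivative g' x) (at x)" "continuous_on {1 / 2..2} g'"
  shows "integral {-X..X} (\<lambda>t. mellin (Complex \<sigma> t) * exp (- Complex \<sigma> t * of_real (ln y))) =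
    - of_real (integral {1 / 2..2} (\<lambda>x. g' x * (2 * Si (X * (ln x - ln y)))))"
proof -
  define f where "f t x = of_real (g x / x) * exp (\<i> * of_real (t * (ln x - ln y)))" for t x
  have cg: "continuous_on {1 / 2..2} g"
    unfolding g_def by (intro continuous_intros continuous_bump) auto
  have eq: "mellin (Complex \<sigma> t) * exp (- Complex \<sigma> t * of_real (ln y)) = integral (cbox (1 / 2) 2) (f t)" for t
  proof -
    have "((\<lambda>x. complex_of_real (bump x) * exp ((Complex \<sigma> t - 1) * of_real (ln x)) * exp (- Complex \<sigma> t * of_real (ln y))) has_integral
        mellin (Complex \<sigma> t) * exp (- Complex \<sigma> t * of_real (ln y))) {1 / 2..2}"
      unfolding mellin_def by (intro has_integral_mult_left integrable_integral mellin_integrable)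
    then have "(f t has_integral mellin (Complex \<sigma> t) * exp (- Complex \<sigma> t * of_real (ln y))) {1 / 2..2}"
    proof (rule has_integral_eq [rotated])
      fix x :: real assume x: "x \<in> {1 / 2..2}"
      then have x0: "x > 0" by auto
      have "f t x = of_real (bump x) * (of_real (exp (\<sigma> * (ln x - ln y)) / exp (ln x)) * exp (\<i> * of_real (t * (ln x - ln y))))"
        using x0 by (simp add: f_def g_def)
      also have "of_real (exp (\<sigma> * (ln x - ln y)) / exp (ln x)) = exp (complex_of_real (\<sigma> * (ln x - ln y) - ln x))"
        unfolding exp_of_real exp_diff ..
      also have "exp (complex_of_real (\<sigma> * (ln x - ln y) - ln x)) * exp (\<i> * of_real (t * (ln x - ln y))) =
        exp ((Complex \<sigma> t - 1) * of_real (ln x) + (- Complex \<sigma> t * of_real (ln y)))"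
        unfolding exp_add [symmetric]
        by (rule arg_cong [of _ _ exp]) (simp add: complex_eq_iff algebra_simps)
      finally show "complex_of_real (bump x) * exp ((Complex \<sigma> t - 1) * of_real (ln x)) * exp (- Complex \<sigma> t * of_real (ln y)) = f t x"
        unfolding exp_add by (simp only: mult.assoc)
    qed
    then show ?thesis by (simp add: integral_unique)
  qed
  have "continuous_on (cbox (-X, 1 / 2) (X, 2)) (\<lambda>(t, x). f t x)"
  proof -
    have "continuous_on (cbox (-X, 1 / 2) (X, 2)) (\<lambda>p. g (snd p))"
      by (rule continuous_on_compose2 [OF cg]) (auto intro!: continuous_intros simp: cbox_Pair_eq)
    then show ?thesis
      unfolding case_prod_beta f_def by (intro continuous_intros) (auto simp: cbox_Pair_eq)
  qed
  then have "integral (cbox (-X) X) (\<lambda>t. integral (cbox (1 / 2) 2) (f t)) =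
      integral (cbox (1 / 2) 2) (\<lambda>x. integral (cbox (-X) X) (\<lambda>t. f t x))"
    by (rule integral_swap_continuous)
  also have "integral (cbox (1 / 2) 2) (\<lambda>x. integral (cbox (-X) X) (\<lambda>t. f t x)) =
      integral {1 / 2..2} (\<lambda>x. complex_of_real (g x / x * (2 * X * sinc (X * (ln x - ln y)))))"
    unfolding f_def using integral_exp_i_sinc [OF X] by (simp only: integral_mult_right cbox_interval of_real_mult)
  also have "\<dots> = of_real (- integral {1 / 2..2} (\<lambda>x. g' x * (2 * Si (X * (ln x - ln y)))))"
  proof (rule integral_unique)
    define h where "h x = g' x * (2 * Si (X * (ln x - ln y)))" for x
    have cSi: "continuous_on UNIV Si" by (intro continuous_at_imp_continuous_on ballI isCont_Si)
    have ch: "continuous_on {1 / 2..2} h"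
      unfolding h_def by (intro continuous_intros g' continuous_on_compose2 [OF cSi]) auto
    have "((\<lambda>x. h x + g x * (2 * (sinc (X * (ln x - ln y)) * (X * (1 / x))))) has_integral
        g 2 * (2 * Si (X * (ln 2 - ln y))) - g (1 / 2) * (2 * Si (X * (ln (1 / 2) - ln y)))) {1 / 2..2}"
    proof (rule fundamental_theorem_of_calculus)
      fix x :: real assume x: "x \<in> {1 / 2..2}"
      then have x0: "x > 0" by auto
      have "((\<lambda>x. X * (ln x - ln y)) has_real_derivative X * (1 / x)) (at x)"
        using x0 by (auto intro!: derivative_eq_intros)
      from DERIV_mult [OF g'(1) [OF x] DERIV_cmult [OF DERIV_chain2 [OF DERIV_Si this], of 2]]
      have "((\<lambda>x. g x * (2 * Si (X * (ln x - ln y)))) has_real_derivative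
          h x + g x * (2 * (sinc (X * (ln x - ln y)) * (X * (1 / x))))) (at x)"
        unfolding h_def by (rule DERIV_cong) (simp add: mult.commute)
      then show "((\<lambda>x. g x * (2 * Si (X * (ln x - ln y)))) has_vector_derivative
          h x + g x * (2 * (sinc (X * (ln x - ln y)) * (X * (1 / x))))) (at x within {1 / 2..2})"
        by (rule has_vector_derivative_at_within [OF iffD1 [OF has_real_derivative_iff_has_vector_derivative]])
    qed simp
    moreover have "g 2 = 0" "g (1 / 2) = 0" by (simp_all add: g_def bump_eq_0)
    ultimately have I1: "((\<lambda>x. h x + g x * (2 * (sinc (X * (ln x - ln y)) * (X * (1 / x))))) has_integral 0) {1 / 2..2}"
      by simp
    have I2: "(h has_integral integral {1 / 2..2} h) {1 / 2..2}"
      by (intro integrable_integral integrable_continuous_interval ch)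
    have I3: "((\<lambda>x. g x / x * (2 * X * sinc (X * (ln x - ln y)))) has_integral 0 - integral {1 / 2..2} h) {1 / 2..2}"
      by (rule has_integral_eq [OF _ has_integral_diff [OF I1 I2]]) simp
    have bl: "bounded_linear complex_of_real" by (rule bounded_linear_of_real)
    from has_integral_linear [OF I3 bl]
    show "((\<lambda>x. complex_of_real (g x / x * (2 * X * sinc (X * (ln x - ln y))))) has_integral
      complex_of_real (- integral {1 / 2..2} (\<lambda>x. g' x * (2 * Si (X * (ln x - ln y)))))) {1 / 2..2}"
      unfolding h_def o_def diff_0 .
  qed
  finally show ?thesis unfolding eq by simp
qed

text \<open>Since \<open>Si (k * l)\<close> tends to \<open>pi / 2 * sgn l\<close> and stays
  bounded, dominated convergence leaves the integral of \<open>g'\<close> against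
  \<open>pi * sgn (ln x - ln y)\<close>. It equals \<open>- 2 * pi * g y\<close>, and
  \<open>g y = bump y\<close>.\<close>

lemma mellin_inversion_limit:
  assumes y: "y > 0"
  shows "(\<lambda>k::nat. integral {- real k..real k} (\<lambda>t. mellin (Complex \<sigma> t) * exp (- Complex \<sigma> t * of_real (ln y))))
    \<longlonglongrightarrow> of_real (2 * pi * bump y)"
proof -
  obtain b' where b': "\<And>x. (bump has_real_derivative b' x) (at x)" "continuous_on UNIV b'"
    by (rule bump_has_derivative) (rule that)
  define g where "g x = bump x * exp (\<sigma> * (ln x - ln y))" for x
  define g' where "g' x = b' x * exp (\<sigma> * (ln x - ln y)) + exp (\<sigma> * (ln x - ln y)) * (\<sigma> * (1 / x)) * bump x" for x
  have dg: "(g has_real_derivative g' x) (at x)" if "x \<in> {1 / 2..2}" for x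
  proof -
    have x0: "x > 0" using that by auto
    have "((\<lambda>x. \<sigma> * (ln x - ln y)) has_real_derivative \<sigma> * (1 / x)) (at x)"
      using x0 by (auto intro!: derivative_eq_intros)
    from DERIV_mult [OF b'(1) DERIV_chain2 [OF DERIV_exp this]]
    show ?thesis unfolding g_def [abs_def] g'_def by simp
  qed
  have cg': "continuous_on {1 / 2..2} g'"
    unfolding g'_def by (intro continuous_intros continuous_bump continuous_on_subset [OF b'(2)]) auto
  define F where "F k x = g' x * (2 * Si (real k * (ln x - ln y)))" for k :: nat and x
  define L where "L x = g' x * (pi * sgn (ln x - ln y))" for x
  obtain B where B: "\<And>t. \<bar>Si t\<bar> \<le> B" using bounded_Si by blast
  have cSi: "continuous_on UNIV Si" by (intro continuous_at_imp_continuous_on ballI isCont_Si)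
  have lim: "(\<lambda>k. integral {1 / 2..2} (F k)) \<longlonglongrightarrow> integral {1 / 2..2} L"
  proof (rule dominated_convergence(2))
    show "F k integrable_on {1 / 2..2}" for k
      unfolding F_def by (intro integrable_continuous_interval continuous_intros cg' continuous_on_compose2 [OF cSi]) auto
    show "(\<lambda>x. \<bar>g' x\<bar> * (2 * B)) integrable_on {1 / 2..2}"
      by (intro integrable_continuous_interval continuous_intros cg')
    show "norm (F k x) \<le> \<bar>g' x\<bar> * (2 * B)" for k x
      using B [of "real k * (ln x - ln y)"] unfolding F_def real_norm_def abs_mult
      by (intro mult_left_mono) auto
    fix x :: real assume "x \<in> {1 / 2..2}"
    have "(\<lambda>k. Si (real k * l)) \<longlonglongrightarrow> pi / 2 * sgn l" for l
    proof -
      consider "l = 0" | "l > 0" | "l < 0" by linarith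
      then show ?thesis
      proof cases
        case 1
        have "Si 0 = 0" using Si_neg [of 0] by simp
        then show ?thesis using 1 by simp
      next
        case 2
        have "filterlim (\<lambda>k. real k * l) at_top sequentially"
          using 2 by (intro filterlim_at_top_mult_tendsto_pos [OF tendsto_const] filterlim_real_sequentially) auto
        from filterlim_compose [OF Si_at_top this] show ?thesis using 2 by simp
      next
        case 3
        have "filterlim (\<lambda>k. real k * (- l)) at_top sequentially"
          using 3 by (intro filterlim_at_top_mult_tendsto_pos [OF tendsto_const] filterlim_real_sequentially) auto
        from tendsto_minus [OF filterlim_compose [OF Si_at_top this]]
        have "(\<lambda>k. - Si (real k * (- l))) \<longlonglongrightarrow> - (pi / 2)" .
        moreover have "- Si (real k * (- l)) = Si (real k * l)" for k
          using Si_neg [of "real k * (- l)"] 3 by (simp add: mult_nonneg_nonpos)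
        ultimately show ?thesis using 3 by simp
      qed
    qed
    from this [of "ln x - ln y"] have "(\<lambda>k. g' x * (2 * Si (real k * (ln x - ln y)))) \<longlonglongrightarrow> g' x * (2 * (pi / 2 * sgn (ln x - ln y)))"
      by (intro tendsto_intros)
    then show "(\<lambda>k. F k x) \<longlonglongrightarrow> L x" by (simp add: F_def L_def)
  qed
  \<comment> \<open>Subtracting \<open>g y\<close> makes the antiderivative
    \<open>pi * sgn (x - y) * (g x - g y)\<close> continuous across the jump of the sign, so the
    fundamental theorem applies with the single exceptional point \<open>y\<close>.\<close>
  have "(L has_integral (pi * sgn (2 - y) * (g 2 - g y) - pi * sgn (1 / 2 - y) * (g (1 / 2) - g y))) {1 / 2..2}"
  proof (rule fundamental_theorem_of_calculus_interior_strong [of "{y}"])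
    fix x assume x: "x \<in> {1 / 2<..<2} - {y}"
    have x0: "x > 0" and xi: "x \<in> {1 / 2..2}" using x by auto
    have sg: "sgn (ln x - ln y) = sgn (x - y)"
      using x0 y x by (auto simp: sgn_if)
    have "((\<lambda>x. pi * sgn (x - y) * (g x - g y)) has_real_derivative pi * sgn (x - y) * (g' x - 0)) (at x)"
    proof (rule has_field_derivative_transform_within_open)
      show "((\<lambda>z. pi * sgn (x - y) * (g z - g y)) has_real_derivative pi * sgn (x - y) * (g' x - 0)) (at x)"
        by (intro DERIV_cmult DERIV_diff dg [OF xi] DERIV_const)
      show "open (if x > y then {y<..} else {..<y})" by auto
    qed (use x in \<open>auto split: if_splits\<close>)
    then show "((\<lambda>x. pi * sgn (x - y) * (g x - g y)) has_vector_derivative L x) (at x)"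
      unfolding L_def sg by (simp add: has_real_derivative_iff_has_vector_derivative mult_ac)
  next
    have cg: "continuous_on {1 / 2..2} g"
      by (rule DERIV_continuous_on [OF has_field_derivative_at_within [OF dg]])
    show "continuous_on {1 / 2..2} (\<lambda>x. pi * sgn (x - y) * (g x - g y))"
      unfolding continuous_on_def
    proof
      fix x assume x: "x \<in> {1 / 2..2 :: real}"
      have gl: "(g \<longlongrightarrow> g x) (at x within {1 / 2..2})" using cg x by (simp add: continuous_on_def)
      show "((\<lambda>x. pi * sgn (x - y) * (g x - g y)) \<longlongrightarrow> pi * sgn (x - y) * (g x - g y)) (at x within {1 / 2..2})"
      proof (cases "x = y")
        case True
        have "((\<lambda>x. pi * sgn (x - y) * (g x - g y)) \<longlongrightarrow> 0) (at x within {1 / 2..2})"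
        proof (rule Lim_null_comparison)
          show "\<forall>\<^sub>F z in at x within {1 / 2..2}. norm (pi * sgn (z - y) * (g z - g y)) \<le> pi * \<bar>g z - g y\<bar>"
            by (intro always_eventually) (auto simp: abs_mult sgn_if)
          have "((\<lambda>z. pi * \<bar>g z - g y\<bar>) \<longlongrightarrow> pi * \<bar>g x - g y\<bar>) (at x within {1 / 2..2})"
            by (intro tendsto_intros gl)
          then show "((\<lambda>z. pi * \<bar>g z - g y\<bar>) \<longlongrightarrow> 0) (at x within {1 / 2..2})" using True by simp
        qed
        then show ?thesis using True by simp
      next
        case False
        then show ?thesis by (intro tendsto_intros gl) auto
      qed
    qed
  qed auto
  moreover have "g 2 = 0" "g (1 / 2) = 0" by (simp_all add: g_def bump_eq_0)
  moreover have "- (pi * sgn (2 - y) * (0 - g y) - pi * sgn (1 / 2 - y) * (0 - g y)) = 2 * pi * bump y"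
  proof (cases "1 / 2 < y \<and> y < 2")
    case True
    then show ?thesis by (simp add: g_def)
  next
    case False
    then have "bump y = 0" by (intro bump_eq_0) auto
    then show ?thesis by (simp add: g_def)
  qed
  ultimately have "- integral {1 / 2..2} L = 2 * pi * bump y" by (simp add: integral_unique)
  then have "(\<lambda>k. - complex_of_real (integral {1 / 2..2} (F k))) \<longlonglongrightarrow> of_real (2 * pi * bump y)"
    using tendsto_of_real [OF tendsto_minus [OF lim], where 'a = complex] by simp
  moreover have "integral {- real k..real k} (\<lambda>t. mellin (Complex \<sigma> t) * exp (- Complex \<sigma> t * of_real (ln y))) =
      - complex_of_real (integral {1 / 2..2} (F k))" for k
    unfolding F_def using mellin_partial_inversion [OF y of_nat_0_le_iff dg [unfolded g_def [abs_def]] cg'] .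
  ultimately show ?thesis by simp
qed

text \<open>A quantitative tail is needed because the contour used later has finite height. The
  majorant \<open>exp (- (sqrt t / 2))\<close> has the elementary antiderivative \<open>A\<close>;
  the factor 48 is 24 from the decay of \<open>mellin\<close>, once for each of the two
  tails.\<close>

lemma mellin_inversion:
  assumes y: "y > 0" and \<sigma>: "\<bar>\<sigma>\<bar> \<le> 2" and X: "X > 0"
  shows "norm (of_real (2 * pi * bump y) - integral {-X..X} (\<lambda>t. mellin (Complex \<sigma> t) * exp (- Complex \<sigma> t * of_real (ln y))))
    \<le> y powr (- \<sigma>) * (48 * ((4 * sqrt X + 8) * exp (- (sqrt X / 2))))"
proof -
  define f where "f t = mellin (Complex \<sigma> t) * exp (- Complex \<sigma> t * of_real (ln y))" for t
  define A where "A t = - ((4 * sqrt t + 8) * exp (- (sqrt t / 2)))" for t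
  define D where "D = 24 * y powr (- \<sigma>)"
  have D: "D \<ge> 0" by (simp add: D_def)
  have cf: "continuous_on S f" for S
  proof -
    have "continuous_on S (\<lambda>t. mellin (Complex \<sigma> t))"
      by (rule continuous_on_compose2 [OF holomorphic_on_imp_continuous_on [OF mellin_holomorphic [of UNIV]]])
         (auto simp: Complex_eq intro!: continuous_intros)
    then show ?thesis unfolding f_def Complex_eq by (intro continuous_intros)
  qed
  have fb: "norm (f t) \<le> D * exp (- (sqrt \<bar>t\<bar> / 2))" for t
  proof -
    have "norm (f t) = norm (mellin (Complex \<sigma> t)) * y powr (- \<sigma>)"
      using y by (simp add: f_def norm_mult powr_def)
    also have "\<dots> \<le> 24 * exp (- (sqrt \<bar>t\<bar> / 2)) * y powr (- \<sigma>)"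
      using mellin_decay [of "Complex \<sigma> t"] \<sigma> by (intro mult_right_mono) auto
    finally show ?thesis by (simp add: D_def mult_ac)
  qed
  have IA: "((\<lambda>t. exp (- (sqrt t / 2))) has_integral A b - A a) {a..b}" if "0 < a" "a \<le> b" for a b
  proof (rule fundamental_theorem_of_calculus [OF that(2)])
    fix t assume "t \<in> {a..b}"
    then have t: "t > 0" using that by auto
    have "(A has_real_derivative exp (- (sqrt t / 2))) (at t)"
      unfolding A_def using t
      by (auto intro!: derivative_eq_intros simp: field_simps)
    then show "(A has_vector_derivative exp (- (sqrt t / 2))) (at t within {a..b})"
      by (rule has_vector_derivative_at_within [OF iffD1 [OF has_real_derivative_iff_has_vector_derivative]])
  qed
  have part: "norm (integral {a..b} f) \<le> D * (- A c)"
    if "0 < c" "c \<le> d" "{a..b} = {c..d} \<or> {a..b} = {- d..- c}" for a b c d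
  proof -
    have "0 \<le> (4 * sqrt d + 8) * exp (- (sqrt d / 2))"
      using that by (intro mult_nonneg_nonneg add_nonneg_nonneg) auto
    then have Ad: "A d \<le> 0" by (simp add: A_def)
    have I1: "((\<lambda>t. D * exp (- (sqrt \<bar>t\<bar> / 2))) has_integral D * (A d - A c)) {c..d}"
      by (rule has_integral_eq [OF _ has_integral_mult_right [OF IA [OF that(1,2)], of D]]) (use that in auto)
    have "((\<lambda>t. D * exp (- (sqrt \<bar>- t\<bar> / 2))) has_integral D * (A d - A c)) {- d..- c}"
      using has_integral_reflect_real [of "\<lambda>t. D * exp (- (sqrt \<bar>t\<bar> / 2))" "D * (A d - A c)" d c] I1 by simp
    then have I2: "((\<lambda>t. D * exp (- (sqrt \<bar>t\<bar> / 2))) has_integral D * (A d - A c)) {a..b}"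
      using I1 that(3) by auto
    have "norm (integral {a..b} f) \<le> integral {a..b} (\<lambda>t. D * exp (- (sqrt \<bar>t\<bar> / 2)))"
    proof (rule integral_norm_bound_integral)
      show "f integrable_on {a..b}" by (intro integrable_continuous_interval cf)
      show "(\<lambda>t. D * exp (- (sqrt \<bar>t\<bar> / 2))) integrable_on {a..b}" using I2 by blast
    qed (rule fb)
    also have "\<dots> = D * (A d - A c)" using I2 by (rule integral_unique)
    also have "\<dots> \<le> D * (- A c)" using Ad D by (intro mult_left_mono) auto
    finally show ?thesis .
  qed
  have le: "norm (integral {- Z..Z} f - integral {-X..X} f) \<le> 2 * (D * (- A X))" if Z: "Z \<ge> X" for Z
  proof -
    have int: "f integrable_on {a..b}" for a b by (intro integrable_continuous_interval cf)
    have "integral {- Z..Z} f = integral {- Z..- X} f + (integral {- X..X} f + integral {X..Z} f)"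
      using X Z int by (simp add: Henstock_Kurzweil_Integration.integral_combine)
    then have "integral {- Z..Z} f - integral {-X..X} f = integral {- Z..- X} f + integral {X..Z} f" by simp
    also have "norm \<dots> \<le> D * (- A X) + D * (- A X)"
      using part [of X Z "- Z" "- X"] part [of X Z X Z] X Z by (intro order_trans [OF norm_triangle_ineq] add_mono) auto
    finally show ?thesis by simp
  qed
  have "(\<lambda>k::nat. norm (integral {- real k..real k} f - integral {-X..X} f)) \<longlonglongrightarrow> norm (of_real (2 * pi * bump y) - integral {-X..X} f)"
    using mellin_inversion_limit [OF y, of \<sigma>] unfolding f_def by (intro tendsto_intros)
  then have "norm (of_real (2 * pi * bump y) - integral {-X..X} f) \<le> 2 * (D * (- A X))"
  proof (rule tendsto_upperbound)
    show "\<forall>\<^sub>F k in sequentially. norm (integral {- real k..real k} f - integral {-X..X} f) \<le> 2 * (D * (- A X))"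
      using eventually_ge_at_top [of "nat \<lceil>X\<rceil>"]
      by eventually_elim (rule le, linarith)
  qed simp
  moreover have "2 * (D * (- A X)) = y powr (- \<sigma>) * (48 * ((4 * sqrt X + 8) * exp (- (sqrt X / 2))))"
    by (simp add: D_def A_def)
  ultimately show ?thesis unfolding f_def by (simp only:)
qed

section \<open>The explicit formula\<close>

text \<open>The centres of \<open>card B + 1\<close> equal cells of \<open>[a, a + 1]\<close>, of
  half-width \<open>d\<close>, are the candidates. A point of \<open>B\<close> is closer than
  \<open>d\<close> to at most one of them, so one candidate is left.\<close>

lemma pigeonhole_gap:
  fixes B :: "real set"
  assumes fin: "finite B"
  obtains x where "a \<le> x" "x \<le> a + 1" "\<And>b. b \<in> B \<Longrightarrow> \<bar>x - b\<bar> \<ge> 1 / (2 * (real (card B) + 1))"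
proof -
  define N where "N = card B"
  define d where "d = 1 / (2 * (real N + 1))"
  have d: "d > 0" "2 * d * (real N + 1) = 1" by (simp_all add: d_def field_simps)
  define x where "x j = a + (2 * real j + 1) * d" for j :: nat
  have "\<exists>j\<le>N. \<forall>b\<in>B. \<bar>x j - b\<bar> \<ge> d"
  proof (rule ccontr)
    assume contr: "\<not> (\<exists>j\<le>N. \<forall>b\<in>B. \<bar>x j - b\<bar> \<ge> d)"
    have "\<exists>b. b \<in> B \<and> \<bar>x j - b\<bar> < d" if "j \<le> N" for j
    proof (rule ccontr)
      assume "\<not> (\<exists>b. b \<in> B \<and> \<bar>x j - b\<bar> < d)"
      then have "\<forall>b\<in>B. \<bar>x j - b\<bar> \<ge> d" by (simp add: not_less)
      with contr that show False by blast
    qed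
    then obtain f where f: "\<And>j. j \<le> N \<Longrightarrow> f j \<in> B \<and> \<bar>x j - f j\<bar> < d" by metis
    have "inj_on f {..N}"
    proof (rule linorder_inj_onI')
      fix i j assume ij: "i \<in> {..N}" "j \<in> {..N}" "i < j"
      have "1 * d \<le> (real j - real i) * d" using ij d by (intro mult_right_mono) auto
      then have "x j - x i \<ge> 2 * d" by (simp add: x_def algebra_simps)
      then show "f i \<noteq> f j" using f [of i] f [of j] ij by auto
    qed
    then have "card {..N} \<le> card B" by (rule card_inj_on_le) (use f fin in auto)
    then show False by (simp add: N_def)
  qed
  then obtain j where j: "j \<le> N" "\<And>b. b \<in> B \<Longrightarrow> \<bar>x j - b\<bar> \<ge> d" by blast
  show ?thesis
  proof (rule that [of "x j"])
    show "a \<le> x j" using d by (simp add: x_def)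
    have "(2 * real j + 1) * d \<le> (2 * (real N + 1)) * d" using j d by (intro mult_right_mono) auto
    then show "x j \<le> a + 1" using d by (simp add: x_def algebra_simps)
  qed (use j in \<open>auto simp: d_def N_def\<close>)
qed

definition prime_sum :: "complex \<Rightarrow> real \<Rightarrow> complex" where
  "prime_sum \<rho> Y = (\<Sum>\<^sub>\<infinity>n\<in>{1..}. (mangoldt n :: complex) / of_nat n powr \<rho> * of_real (bump (real n / Y)))"

lemma prime_sum_eq_sum:
  assumes Y: "Y > 0" and N: "real N \<ge> 2 * Y"
  shows "prime_sum \<rho> Y = (\<Sum>n<N. (mangoldt n :: complex) / of_nat n powr \<rho> * of_real (bump (real n / Y)))"
proof -
  have "((\<lambda>n. (mangoldt n :: complex) / of_nat n powr \<rho> * of_real (bump (real n / Y))) has_sum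
     (\<Sum>n\<in>{1..<N}. (mangoldt n :: complex) / of_nat n powr \<rho> * of_real (bump (real n / Y)))) {1..}"
  proof (rule has_sum_finite_neutralI)
    fix n assume "n \<in> {1..} - {1..<N}"
    then have "real n \<ge> 2 * Y" using N by auto
    then have "real n / Y \<ge> 2" using Y by (simp add: field_simps)
    then show "(mangoldt n :: complex) / of_nat n powr \<rho> * of_real (bump (real n / Y)) = 0"
      by (simp add: bump_eq_0)
  qed auto
  then have "prime_sum \<rho> Y = (\<Sum>n\<in>{1..<N}. (mangoldt n :: complex) / of_nat n powr \<rho> * of_real (bump (real n / Y)))"
    unfolding prime_sum_def by (rule infsumI)
  also have "\<dots> = (\<Sum>n<N. (mangoldt n :: complex) / of_nat n powr \<rho> * of_real (bump (real n / Y)))"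
    by (rule sum.mono_neutral_left) (auto simp: not_less_eq_eq le_Suc_eq)
  finally show ?thesis .
qed

lemma sums_from_has_sum:
  fixes f :: "nat \<Rightarrow> 'a :: {topological_comm_monoid_add, real_normed_vector}"
  assumes "(f has_sum S) {1..}" "f 0 = 0"
  shows "f sums S"
proof -
  have "((\<lambda>n. f (Suc n)) has_sum S) UNIV" using assms(1) by (subst has_sum_Suc_iff)
  then have "(\<lambda>n. f (Suc n)) sums S" by (rule has_sum_imp_sums)
  then show ?thesis using sums_Suc_iff [of f S] assms(2) by simp
qed

definition mangoldt_abs_2 :: real where
  "mangoldt_abs_2 = infsum (\<lambda>n. mangoldt n * real n powr (- 2)) {1..}"

lemma mangoldt_abs_2_sums: "(\<lambda>n. mangoldt n * real n powr (- 2)) sums mangoldt_abs_2"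
  unfolding mangoldt_abs_2_def
  by (rule sums_from_has_sum [OF has_sum_infsum [OF mangoldt_series_bound(2) [of 2 2]]]) auto

lemma mangoldt_abs_2_nonneg: "mangoldt_abs_2 \<ge> 0"
  unfolding mangoldt_abs_2_def by (rule infsum_nonneg) (simp add: mangoldt_nonneg)

text \<open>On the line \<open>Re s = 2\<close> the von Mangoldt series converges uniformly, so it
  may be integrated term by term. The \<open>n\<close>-th term is Mellin inversion at
  \<open>y = n / exp u\<close>, multiplied by \<open>mangoldt n / n powr \<rho>\<close>. Its error
  carries \<open>n powr (- Re \<rho>) * n powr (- \<sigma>) = n powr (- 2)\<close>, where
  \<open>\<sigma> = 2 - Re \<rho>\<close>, and therefore sums to
  \<open>mangoldt_abs_2\<close>.\<close>

lemma right_line_integral: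
  assumes \<rho>: "0 \<le> Re \<rho>" "Re \<rho> \<le> 1" and u: "u \<ge> 0" and X: "X > 0"
  shows "norm (integral {-X..X} (\<lambda>t. mangoldt_series (Complex 2 (Im \<rho> + t)) *
      (mellin (Complex (2 - Re \<rho>) t) * exp (Complex (2 - Re \<rho>) t * of_real u)))
      - of_real (2 * pi) * prime_sum \<rho> (exp u)) \<le>
    mangoldt_abs_2 * (exp (2 * u) * (48 * ((4 * sqrt X + 8) * exp (- (sqrt X / 2)))))"
proof -
  define \<sigma> where "\<sigma> = 2 - Re \<rho>"
  define E where "E = 48 * ((4 * sqrt X + 8) * exp (- (sqrt X / 2)))"
  have E: "E \<ge> 0" unfolding E_def using X by simp
  have \<sigma>: "1 \<le> \<sigma>" "\<sigma> \<le> 2" using \<rho> by (auto simp: \<sigma>_def)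
  define H where "H t = mellin (Complex \<sigma> t) * exp (Complex \<sigma> t * of_real u)" for t
  define f where "f n t = mangoldt n * of_nat n powr (- Complex 2 (Im \<rho> + t)) * H t" for n t
  have cm: "continuous_on S (\<lambda>t. mellin (Complex \<sigma> t))" for S
    by (rule continuous_on_compose2 [OF holomorphic_on_imp_continuous_on [OF mellin_holomorphic [of UNIV]]])
       (auto simp: Complex_eq intro!: continuous_intros)
  then have cH: "continuous_on S H" for S
    unfolding H_def Complex_eq by (intro continuous_intros)
  have cf: "continuous_on S (f n)" for S n
  proof (cases "n = 0")
    case True
    then have "f n = (\<lambda>t. 0)" by (simp add: f_def [abs_def])
    then show ?thesis by simp
  next
    case False
    then have "f n = (\<lambda>t. mangoldt n * exp (- Complex 2 (Im \<rho> + t) * ln (of_nat n)) * H t)"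
      by (simp add: f_def [abs_def] powr_def)
    then show ?thesis by (simp only: Complex_eq) (intro continuous_intros cH)
  qed
  have Hb: "norm (H t) \<le> 12 * exp (2 * u)" for t
  proof -
    have "norm (H t) = norm (mellin (Complex \<sigma> t)) * exp (\<sigma> * u)" by (simp add: H_def norm_mult)
    also have "\<dots> \<le> 12 * exp (2 * u)"
      using \<sigma> u mellin_bound [of "Complex \<sigma> t"] by (intro mult_mono) (auto intro: mult_right_mono)
    finally show ?thesis .
  qed
  have nb: "norm (mangoldt n * of_nat n powr (- Complex 2 s) :: complex) = mangoldt n * real n powr (- 2)" for n s
    by (cases "n = 0") (simp_all add: norm_mult norm_mangoldt norm_powr_real_powr)
  have un: "uniform_limit (cbox (-X) X) (\<lambda>N t. \<Sum>n<N. f n t) (\<lambda>t. \<Sum>n. f n t) sequentially"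
  proof (rule Weierstrass_m_test)
    show "norm (f n t) \<le> mangoldt n * real n powr (- 2) * (12 * exp (2 * u))" for n t
      unfolding f_def norm_mult [of _ "H t"] nb
      using Hb [of t] by (intro mult_left_mono) (auto simp: mangoldt_nonneg)
    show "summable (\<lambda>n. mangoldt n * real n powr (- 2) * (12 * exp (2 * u)))"
      by (intro summable_mult2 sums_summable [OF mangoldt_abs_2_sums])
  qed
  have lim: "(\<Sum>n. f n t) = mangoldt_series (Complex 2 (Im \<rho> + t)) * H t" for t
  proof -
    have "(\<lambda>n. mangoldt n * of_nat n powr (- Complex 2 (Im \<rho> + t))) sums mangoldt_series (Complex 2 (Im \<rho> + t))"
      by (rule sums_from_has_sum [OF mangoldt_has_sum]) auto
    from sums_mult2 [OF this] show ?thesis unfolding f_def by (rule sums_unique [symmetric])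
  qed
  obtain I J where IJ: "\<And>N. ((\<lambda>t. \<Sum>n<N. f n t) has_integral I N) (cbox (-X) X)"
    "((\<lambda>t. \<Sum>n. f n t) has_integral J) (cbox (-X) X)" "I \<longlonglongrightarrow> J"
    by (rule uniform_limit_integral_cbox [OF un]) (auto intro!: continuous_on_sum cf)
  have J: "integral {-X..X} (\<lambda>t. mangoldt_series (Complex 2 (Im \<rho> + t)) * H t) = J"
    using IJ(2) by (simp add: lim integral_unique)
  have trm: "norm (integral {-X..X} (f n) - of_real (2 * pi) * (mangoldt n / of_nat n powr \<rho> * of_real (bump (real n / exp u))))
      \<le> mangoldt n * real n powr (- 2) * (exp (2 * u) * E)" for n
  proof (cases "n = 0")
    case True
    then have "f n = (\<lambda>t. 0)" by (simp add: f_def [abs_def])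
    then show ?thesis using True by simp
  next
    case False
    then have n: "real n > 0" by simp
    define y where "y = real n / exp u"
    have y: "y > 0" using n by (simp add: y_def)
    have lny: "ln y = ln (real n) - u" using n by (simp add: y_def ln_div)
    have lnn: "ln (of_nat n :: complex) = of_real (ln (real n))"
      using Ln_of_real [OF n] by simp
    define c where "c = (mangoldt n / of_nat n powr \<rho> :: complex)"
    have "f n = (\<lambda>t. c * (mellin (Complex \<sigma> t) * exp (- Complex \<sigma> t * of_real (ln y))))"
    proof
      fix t
      have "of_nat n powr (- Complex 2 (Im \<rho> + t)) * exp (Complex \<sigma> t * of_real u) =
          exp (- Complex 2 (Im \<rho> + t) * of_real (ln (real n)) + Complex \<sigma> t * of_real u)"
        unfolding exp_add using False by (simp add: powr_def lnn)
      also have "- Complex 2 (Im \<rho> + t) * of_real (ln (real n)) + Complex \<sigma> t * of_real u =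
          - \<rho> * of_real (ln (real n)) + (- Complex \<sigma> t * of_real (ln y))"
        by (simp add: complex_eq_iff lny \<sigma>_def algebra_simps)
      also have "exp (- \<rho> * of_real (ln (real n)) + (- Complex \<sigma> t * of_real (ln y))) =
          1 / of_nat n powr \<rho> * exp (- Complex \<sigma> t * of_real (ln y))"
        using False unfolding exp_add by (simp add: powr_def lnn exp_minus divide_inverse)
      finally have e: "of_nat n powr (- Complex 2 (Im \<rho> + t)) * exp (Complex \<sigma> t * of_real u) =
          1 / of_nat n powr \<rho> * exp (- Complex \<sigma> t * of_real (ln y))" .
      have "f n t = mangoldt n * mellin (Complex \<sigma> t) * (of_nat n powr (- Complex 2 (Im \<rho> + t)) * exp (Complex \<sigma> t * of_real u))"
        by (simp add: f_def H_def)
      then show "f n t = c * (mellin (Complex \<sigma> t) * exp (- Complex \<sigma> t * of_real (ln y)))"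
        unfolding e c_def by simp
    qed
    then have "integral {-X..X} (f n) = c * integral {-X..X} (\<lambda>t. mellin (Complex \<sigma> t) * exp (- Complex \<sigma> t * of_real (ln y)))"
      by (simp only: integral_mult_right)
    then have "integral {-X..X} (f n) - of_real (2 * pi) * (c * of_real (bump y)) =
      - (c * (of_real (2 * pi * bump y) - integral {-X..X} (\<lambda>t. mellin (Complex \<sigma> t) * exp (- Complex \<sigma> t * of_real (ln y)))))"
      by (simp add: algebra_simps)
    then have "norm (integral {-X..X} (f n) - of_real (2 * pi) * (c * of_real (bump y))) =
       norm c * norm (of_real (2 * pi * bump y) - integral {-X..X} (\<lambda>t. mellin (Complex \<sigma> t) * exp (- Complex \<sigma> t * of_real (ln y))))"
      by (simp only: norm_minus_cancel norm_mult)
    also have "\<dots> \<le> norm c * (y powr (- \<sigma>) * E)"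
      unfolding E_def using \<sigma> by (intro mult_left_mono mellin_inversion y X) auto
    also have "norm c = mangoldt n * real n powr (- Re \<rho>)"
      using n by (simp add: c_def norm_divide norm_powr_real_powr powr_minus field_simps)
    also have "y powr (- \<sigma>) = real n powr (- \<sigma>) * exp (\<sigma> * u)"
      using n y by (simp add: powr_def lny flip: exp_add) (simp add: algebra_simps)
    also have "mangoldt n * real n powr (- Re \<rho>) * (real n powr (- \<sigma>) * exp (\<sigma> * u) * E) =
        mangoldt n * (real n powr (- Re \<rho>) * real n powr (- \<sigma>)) * (exp (\<sigma> * u) * E)" by simp
    also have "real n powr (- Re \<rho>) * real n powr (- \<sigma>) = real n powr (- 2)"
      by (simp add: \<sigma>_def flip: powr_add)
    also have "mangoldt n * real n powr (- 2) * (exp (\<sigma> * u) * E) \<le> mangoldt n * real n powr (- 2) * (exp (2 * u) * E)"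
      using \<sigma> u E by (intro mult_left_mono mult_right_mono) (auto simp: mangoldt_nonneg intro: mult_right_mono)
    finally show ?thesis unfolding c_def y_def .
  qed
  have "norm (J - of_real (2 * pi) * prime_sum \<rho> (exp u)) \<le> mangoldt_abs_2 * (exp (2 * u) * E)"
  proof (rule tendsto_upperbound)
    show "(\<lambda>N. norm (I N - of_real (2 * pi) * prime_sum \<rho> (exp u))) \<longlonglongrightarrow> norm (J - of_real (2 * pi) * prime_sum \<rho> (exp u))"
      by (intro tendsto_intros IJ(3))
    show "\<forall>\<^sub>F N in sequentially. norm (I N - of_real (2 * pi) * prime_sum \<rho> (exp u)) \<le> mangoldt_abs_2 * (exp (2 * u) * E)"
      using eventually_ge_at_top [of "nat \<lceil>2 * exp u\<rceil>"]
    proof eventually_elim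
      case (elim N)
      then have N: "real N \<ge> 2 * exp u" by linarith
      have "((\<lambda>t. \<Sum>n<N. f n t) has_integral (\<Sum>n<N. integral {-X..X} (f n))) {-X..X}"
        by (intro has_integral_sum integrable_integral integrable_continuous_interval cf) auto
      then have "I N = (\<Sum>n<N. integral {-X..X} (f n))"
        using IJ(1) [of N] has_integral_unique by (metis cbox_interval)
      then have "I N - of_real (2 * pi) * prime_sum \<rho> (exp u) =
          (\<Sum>n<N. integral {-X..X} (f n) - of_real (2 * pi) * (mangoldt n / of_nat n powr \<rho> * of_real (bump (real n / exp u))))"
        unfolding prime_sum_eq_sum [OF exp_gt_zero N] by (simp add: sum_subtractf sum_distrib_left)
      also have "norm \<dots> \<le> (\<Sum>n<N. mangoldt n * real n powr (- 2) * (exp (2 * u) * E))"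
        by (rule sum_norm_le) (rule trm)
      also have "\<dots> = (\<Sum>n<N. mangoldt n * real n powr (- 2)) * (exp (2 * u) * E)"
        by (simp add: sum_distrib_right)
      also have "(\<Sum>n<N. mangoldt n * real n powr (- 2)) \<le> mangoldt_abs_2"
        using sum_le_suminf [OF sums_summable [OF mangoldt_abs_2_sums], of "{..<N}"] sums_unique [OF mangoldt_abs_2_sums]
        by (simp add: mangoldt_nonneg)
      finally show ?case using E by (simp add: mult_right_mono)
    qed
  qed simp
  then show ?thesis unfolding J [symmetric] H_def \<sigma>_def E_def .
qed

section \<open>Multiplicities, contour integrals and the truncated formula\<close>

definition zmult :: "complex \<Rightarrow> real" where
  "zmult p = real (nat (zorder zeta p))"

lemma upper_half_plane: "open {s. Im s > 0}" "connected {s. Im s > 0}"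
  by (auto intro: open_halfspace_Im_gt convex_connected convex_halfspace_Im_gt)

lemma zeta_holomorphic_upper: "zeta holomorphic_on {s. Im s > 0}"
  by (rule holomorphic_on_subset [OF zeta_holomorphic]) auto

lemma zeta_nonzero_upper: "\<exists>w\<in>{s. Im s > 0}. zeta w \<noteq> 0"
  using norm_zeta_ge [of "Complex 3 1"] by (intro bexI [of _ "Complex 3 1"]) auto

lemma zmult_nonneg: "zmult p \<ge> 0"
  by (simp add: zmult_def)

lemma zorder_zeta_zero:
  assumes "zeta p = 0" "Im p > 0"
  shows "zorder zeta p > 0" "zmult p \<ge> 1" "of_int (zorder zeta p) = complex_of_real (zmult p)"
proof -
  show 1: "zorder zeta p > 0"
    using zorder_exist_zero [OF zeta_holomorphic_upper upper_half_plane _ zeta_nonzero_upper] assms by auto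
  then show "zmult p \<ge> 1" by (simp add: zmult_def)
  show "of_int (zorder zeta p) = complex_of_real (zmult p)"
    using 1 by (simp add: zmult_def)
qed

lemma finite_zeta_zeros_compact:
  assumes "compact C" "C \<subseteq> {s. Im s > 0}"
  shows "finite {z \<in> C. zeta z = 0}"
  by (rule finite_zeros_cball [OF zeta_holomorphic_upper upper_half_plane assms zeta_nonzero_upper])

text \<open>If every zero in a horizontal window about \<open>z\<close> stays at distance
  \<open>d\<close>, each pole in the local expansion costs at most its multiplicity over
  \<open>d\<close>. The window of half-height 10 contains the whole disc about
  \<open>Complex 3 (Im z)\<close>, and \<open>d \<le> 1\<close> absorbs the regular part into the
  same bound.\<close>

lemma zeta_log_deriv_bound:
  obtains K T\<^sub>1 :: real where "K \<ge> 1" "T\<^sub>1 \<ge> 40"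
    "\<And>t. t \<ge> T\<^sub>1 \<Longrightarrow> finite {z \<in> cball (Complex 3 t) 10. zeta z = 0}"
    "\<And>t. t \<ge> T\<^sub>1 \<Longrightarrow> (\<Sum>p\<in>{z \<in> cball (Complex 3 t) 10. zeta z = 0}. zmult p) \<le> K * ln t"
    "\<And>z d. Im z \<ge> T\<^sub>1 \<Longrightarrow> -1 \<le> Re z \<Longrightarrow> Re z \<le> 2 \<Longrightarrow> 0 < d \<Longrightarrow> d \<le> 1 \<Longrightarrow>
       \<forall>p. zeta p = 0 \<longrightarrow> \<bar>Im p - Im z\<bar> \<le> 10 \<longrightarrow> norm (z - p) \<ge> d \<Longrightarrow>
       norm (deriv zeta z / zeta z) \<le> 2 * K * ln (Im z) / d"
proof -
  obtain K T\<^sub>1 :: real where K: "K > 0" "T\<^sub>1 \<ge> 40"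
    and fin: "\<And>t. t \<ge> T\<^sub>1 \<Longrightarrow> finite {z \<in> cball (Complex 3 t) 10. zeta z = 0}"
    and cnt: "\<And>t. t \<ge> T\<^sub>1 \<Longrightarrow> (\<Sum>p\<in>{z \<in> cball (Complex 3 t) 10. zeta z = 0}. real (nat (zorder zeta p))) \<le> K * ln t"
    and ld: "\<And>t z. t \<ge> T\<^sub>1 \<Longrightarrow> dist (Complex 3 t) z \<le> 5 \<Longrightarrow> zeta z \<noteq> 0 \<Longrightarrow>
      norm (deriv zeta z / zeta z - (\<Sum>p\<in>{z \<in> cball (Complex 3 t) 10. zeta z = 0}. of_nat (nat (zorder zeta p)) / (z - p))) \<le> K * ln t"
    by (rule zeta_deriv_over_zeta_local) (rule that)
  define K' where "K' = max K 1"
  have lnpos: "ln t \<ge> 0" if "t \<ge> T\<^sub>1" for t using that K by simp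
  have KK: "K * ln t \<le> K' * ln t" if "t \<ge> T\<^sub>1" for t
    using lnpos [OF that] by (intro mult_right_mono) (auto simp: K'_def)
  show ?thesis
  proof (rule that [of K' T\<^sub>1])
    show "K' \<ge> 1" "T\<^sub>1 \<ge> 40" using K by (auto simp: K'_def)
    show "finite {z \<in> cball (Complex 3 t) 10. zeta z = 0}" if "t \<ge> T\<^sub>1" for t by (rule fin [OF that])
    show "(\<Sum>p\<in>{z \<in> cball (Complex 3 t) 10. zeta z = 0}. zmult p) \<le> K' * ln t" if "t \<ge> T\<^sub>1" for t
      using cnt [OF that] KK [OF that] unfolding zmult_def by linarith
    fix z d assume z: "Im z \<ge> T\<^sub>1" "-1 \<le> Re z" "Re z \<le> 2" and d: "0 < d" "d \<le> (1 :: real)"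
      and far': "\<forall>p. zeta p = 0 \<longrightarrow> \<bar>Im p - Im z\<bar> \<le> 10 \<longrightarrow> norm (z - p) \<ge> d"
    then have far: "norm (z - p) \<ge> d" if "zeta p = 0" "\<bar>Im p - Im z\<bar> \<le> 10" for p using that by blast
    define t where "t = Im z"
    define Z where "Z = {z \<in> cball (Complex 3 t) 10. zeta z = 0}"
    have zz: "zeta z \<noteq> 0" using far [of z] d by auto
    have dist: "dist (Complex 3 t) z \<le> 5"
      using cmod_le [of "Complex 3 t - z"] z by (simp add: dist_norm t_def)
    have Zfar: "norm (z - p) \<ge> d" if "p \<in> Z" for p
    proof (rule far)
      show "zeta p = 0" using that by (simp add: Z_def)
      show "\<bar>Im p - Im z\<bar> \<le> 10"
        using that abs_Im_le_cmod [of "p - Complex 3 t"] by (simp add: Z_def t_def dist_norm norm_minus_commute)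
    qed
    have "norm (\<Sum>p\<in>Z. of_nat (nat (zorder zeta p)) / (z - p)) \<le> (\<Sum>p\<in>Z. zmult p / d)"
    proof (rule sum_norm_le)
      fix p assume "p \<in> Z"
      then have zp: "norm (z - p) \<ge> d" by (rule Zfar)
      have "norm (z - p) * d > 0" using less_le_trans [OF d(1) zp] d(1) by (rule mult_pos_pos)
      with zp show "norm (of_nat (nat (zorder zeta p)) / (z - p)) \<le> zmult p / d"
        unfolding norm_divide zmult_def norm_of_nat
        by (intro divide_left_mono) auto
    qed
    also have "\<dots> = (\<Sum>p\<in>Z. zmult p) / d" by (simp add: sum_divide_distrib)
    also have "\<dots> \<le> K * ln t / d"
      using cnt [of t] z d unfolding Z_def t_def zmult_def by (intro divide_right_mono) auto
    finally have s: "norm (\<Sum>p\<in>Z. of_nat (nat (zorder zeta p)) / (z - p)) \<le> K * ln t / d" .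
    have "norm (deriv zeta z / zeta z - (\<Sum>p\<in>Z. of_nat (nat (zorder zeta p)) / (z - p))) \<le> K * ln t"
      unfolding Z_def using z by (intro ld dist zz) (simp add: t_def)
    then have "norm (deriv zeta z / zeta z) \<le> K * ln t + K * ln t / d"
      using s norm_triangle_sub [of "deriv zeta z / zeta z" "\<Sum>p\<in>Z. of_nat (nat (zorder zeta p)) / (z - p)"] by linarith
    moreover have "K * ln t \<le> K * ln t / d"
    proof -
      have "K * ln t \<ge> 0" using K lnpos [of t] z by (simp add: t_def)
      then show ?thesis using d divide_left_mono [of d 1 "K * ln t"] by simp
    qed
    ultimately have "norm (deriv zeta z / zeta z) \<le> 2 * (K * ln t) / d" by simp
    also have "\<dots> \<le> 2 * (K' * ln t) / d"
      using KK [of t] z d by (intro divide_right_mono mult_left_mono) (auto simp: t_def)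
    finally show "norm (deriv zeta z / zeta z) \<le> 2 * K' * ln (Im z) / d" by (simp add: t_def)
  qed
qed

text \<open>The zeros are sorted by the integer part of \<open>Im p - \<gamma>\<close>. Since they
  have \<open>0 \<le> Re p \<le> 1\<close>, those in one slice of height 1 lie within distance 4 of
  \<open>Complex 3 t\<close>, well inside the disc of radius 10 where the local count
  applies.\<close>

lemma zero_count_window:
  assumes cnt: "\<And>t. t \<ge> T\<^sub>1 \<Longrightarrow> (\<Sum>p\<in>{z \<in> cball (Complex 3 t) 10. zeta z = 0}. zmult p) \<le> K * ln t"
    and fin: "\<And>t. t \<ge> T\<^sub>1 \<Longrightarrow> finite {z \<in> cball (Complex 3 t) 10. zeta z = 0}"
    and K: "K \<ge> 0" "T\<^sub>1 \<ge> 1" and \<gamma>: "\<gamma> \<ge> T\<^sub>1 + real M" "\<gamma> \<ge> real M"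
    and Z: "finite Z" "\<And>p. p \<in> Z \<Longrightarrow> zeta p = 0 \<and> \<bar>Im p - \<gamma>\<bar> \<le> real M"
  shows "(\<Sum>p\<in>Z. zmult p) \<le> (2 * real M + 1) * (K * ln (2 * \<gamma>))"
proof -
  define I where "I = {- int M..int M}"
  have img: "(\<lambda>p. \<lfloor>Im p - \<gamma>\<rfloor>) ` Z \<subseteq> I"
  proof
    fix k assume "k \<in> (\<lambda>p. \<lfloor>Im p - \<gamma>\<rfloor>) ` Z"
    then obtain p where p: "p \<in> Z" "k = \<lfloor>Im p - \<gamma>\<rfloor>" by auto
    then have "\<bar>Im p - \<gamma>\<bar> \<le> real M" using Z by auto
    then show "k \<in> I" unfolding p I_def by (auto simp: le_floor_iff floor_le_iff)
  qed
  have "(\<Sum>p\<in>Z. zmult p) = (\<Sum>k\<in>I. \<Sum>p\<in>{p \<in> Z. \<lfloor>Im p - \<gamma>\<rfloor> = k}. zmult p)"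
    by (rule sum.group [symmetric]) (use Z img in \<open>auto simp: I_def\<close>)
  also have "\<dots> \<le> (\<Sum>k\<in>I. K * ln (2 * \<gamma>))"
  proof (rule sum_mono)
    fix k assume k: "k \<in> I"
    define t where "t = \<gamma> + of_int k"
    have kM: "- real M \<le> of_int k" "of_int k \<le> real M" using k by (auto simp: I_def)
    have t: "t \<ge> T\<^sub>1" "t \<le> 2 * \<gamma>" using kM \<gamma> by (auto simp: t_def)
    have "(\<Sum>p\<in>{p \<in> Z. \<lfloor>Im p - \<gamma>\<rfloor> = k}. zmult p) \<le> (\<Sum>p\<in>{z \<in> cball (Complex 3 t) 10. zeta z = 0}. zmult p)"
    proof (rule sum_mono2)
      show "finite {z \<in> cball (Complex 3 t) 10. zeta z = 0}" by (rule fin [OF t(1)])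
      show "{p \<in> Z. \<lfloor>Im p - \<gamma>\<rfloor> = k} \<subseteq> {z \<in> cball (Complex 3 t) 10. zeta z = 0}"
      proof
        fix p assume "p \<in> {p \<in> Z. \<lfloor>Im p - \<gamma>\<rfloor> = k}"
        then have p: "p \<in> Z" "\<lfloor>Im p - \<gamma>\<rfloor> = k" by auto
        have z0: "zeta p = 0" and w: "\<bar>Im p - \<gamma>\<bar> \<le> real M" using Z(2) [OF p(1)] by auto
        have "Im p \<noteq> 0" using w \<gamma> K by auto
        then have re: "0 \<le> Re p" "Re p \<le> 1" using zeta_zero_strip [OF z0] by auto
        have "of_int k \<le> Im p - \<gamma>" "Im p - \<gamma> < of_int k + 1" using p(2) by linarith+
        then have "\<bar>Im (Complex 3 t - p)\<bar> \<le> 1" by (simp add: t_def)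
        then show "p \<in> {z \<in> cball (Complex 3 t) 10. zeta z = 0}"
          using z0 re cmod_le [of "Complex 3 t - p"] by (simp add: dist_norm)
      qed
    qed (auto simp: zmult_nonneg)
    also have "\<dots> \<le> K * ln t" by (rule cnt [OF t(1)])
    also have "\<dots> \<le> K * ln (2 * \<gamma>)" using t K by (intro mult_left_mono) auto
    finally show "(\<Sum>p\<in>{p \<in> Z. \<lfloor>Im p - \<gamma>\<rfloor> = k}. zmult p) \<le> K * ln (2 * \<gamma>)" .
  qed
  also have "\<dots> = (2 * real M + 1) * (K * ln (2 * \<gamma>))"
    by (simp add: I_def)
  finally show ?thesis .
qed

text \<open>The argument principle with the test function \<open>h\<close>, applied in the rectangle
  enlarged by 1 on each side. The condition \<open>Im a > 1\<close> keeps this enlargement in the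
  upper half-plane, so the pole of \<open>zeta\<close> never enters.\<close>

lemma rectpath_log_deriv:
  fixes h :: "complex \<Rightarrow> complex"
  assumes ab: "Re a < Re b" "Im a < Im b" "Im a > 1"
    and h: "h holomorphic_on UNIV"
    and nz: "\<And>z. z \<in> path_image (rectpath a b) \<Longrightarrow> zeta z \<noteq> 0"
  shows "contour_integral (rectpath a b) (\<lambda>z. deriv zeta z * h z / zeta z) =
      2 * pi * \<i> * (\<Sum>p\<in>{p \<in> box a b. zeta p = 0}. of_real (zmult p) * h p)"
proof -
  define S where "S = box (a - Complex 1 1) (b + Complex 1 1)"
  have cl: "cbox (a - Complex 1 1) (b + Complex 1 1) \<subseteq> {s. Im s > 0}"
    using ab by (auto simp: in_cbox_complex_iff)
  have bS: "box a b \<subseteq> S" "cbox a b \<subseteq> S"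
    by (auto simp: S_def in_box_complex_iff in_cbox_complex_iff)
  have Scl: "S \<subseteq> cbox (a - Complex 1 1) (b + Complex 1 1)" unfolding S_def by (rule box_subset_cbox)
  have fin: "finite {w \<in> S. zeta w = 0 \<or> w \<in> {}}"
    by (rule finite_subset [OF _ finite_zeta_zeros_compact [OF compact_cbox cl]]) (use Scl in auto)
  have pi: "path_image (rectpath a b) \<subseteq> cbox a b"
    using ab by (intro path_image_rectpath_subset_cbox) auto
  have "contour_integral (rectpath a b) (\<lambda>z. deriv zeta z * h z / zeta z) =
     2 * pi * \<i> * (\<Sum>p\<in>{w \<in> S. zeta w = 0 \<or> w \<in> {}}. winding_number (rectpath a b) p * h p * zorder zeta p)"
  proof (rule argument_principle)
    show "open S" "connected S" unfolding S_def by (auto intro: convex_connected)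
    show "zeta holomorphic_on S - {}"
      using Scl cl by (intro holomorphic_on_subset [OF zeta_holomorphic_upper]) auto
    show "h holomorphic_on S" by (rule holomorphic_on_subset [OF h]) auto
    show "path_image (rectpath a b) \<subseteq> S - {w \<in> S. zeta w = 0 \<or> w \<in> {}}"
      using pi bS nz by auto
    show "\<forall>z. z \<notin> S \<longrightarrow> winding_number (rectpath a b) z = 0"
      using bS ab by (auto intro!: winding_number_rectpath_outside)
  qed (use fin in auto)
  also have "(\<Sum>p\<in>{w \<in> S. zeta w = 0 \<or> w \<in> {}}. winding_number (rectpath a b) p * h p * zorder zeta p) =
     (\<Sum>p\<in>{p \<in> box a b. zeta p = 0}. of_real (zmult p) * h p)"
  proof (rule sum.mono_neutral_cong_right [OF fin])
    show "{p \<in> box a b. zeta p = 0} \<subseteq> {w \<in> S. zeta w = 0 \<or> w \<in> {}}" using bS by auto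
    show "\<forall>i\<in>{w \<in> S. zeta w = 0 \<or> w \<in> {}} - {p \<in> box a b. zeta p = 0}. winding_number (rectpath a b) i * h i * zorder zeta i = 0"
    proof
      fix p assume p: "p \<in> {w \<in> S. zeta w = 0 \<or> w \<in> {}} - {p \<in> box a b. zeta p = 0}"
      then have "p \<notin> box a b" "zeta p = 0" by auto
      then have "p \<notin> path_image (rectpath a b)" using nz by auto
      then have "p \<notin> cbox a b" using \<open>p \<notin> box a b\<close> path_image_rectpath_cbox_minus_box [of a b] ab by auto
      then have "winding_number (rectpath a b) p = 0" using ab by (intro winding_number_rectpath_outside) auto
      then show "winding_number (rectpath a b) p * h p * zorder zeta p = 0" by simp
    qed
    fix p assume p: "p \<in> {p \<in> box a b. zeta p = 0}"
    then have "Im p > 0" using ab by (auto simp: in_box_complex_iff)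
    then have "of_int (zorder zeta p) = complex_of_real (zmult p)" using p zorder_zeta_zero by auto
    moreover have "winding_number (rectpath a b) p = 1" using p by (intro winding_number_rectpath) auto
    ultimately show "winding_number (rectpath a b) p * h p * zorder zeta p = of_real (zmult p) * h p"
      by simp
  qed
  finally show ?thesis .
qed

lemma contour_integral_rectpath_split:
  assumes "continuous_on (path_image (rectpath a b)) F" "Re a \<le> Re b" "Im a \<le> Im b"
  shows "contour_integral (rectpath a b) F =
    contour_integral (linepath a (Complex (Re b) (Im a))) F + contour_integral (linepath (Complex (Re b) (Im a)) b) F +
    contour_integral (linepath b (Complex (Re a) (Im b))) F + contour_integral (linepath (Complex (Re a) (Im b)) a) F"
    and "F contour_integrable_on linepath a (Complex (Re b) (Im a))"
    "F contour_integrable_on linepath b (Complex (Re a) (Im b))"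
    "F contour_integrable_on linepath (Complex (Re a) (Im b)) a"
    "closed_segment a (Complex (Re b) (Im a)) \<subseteq> path_image (rectpath a b)"
    "closed_segment b (Complex (Re a) (Im b)) \<subseteq> path_image (rectpath a b)"
    "closed_segment (Complex (Re a) (Im b)) a \<subseteq> path_image (rectpath a b)"
proof -
  define a2 a4 where "a2 = Complex (Re b) (Im a)" and "a4 = Complex (Re a) (Im b)"
  have pi: "path_image (rectpath a b) = closed_segment a a2 \<union> closed_segment a2 b \<union> closed_segment b a4 \<union> closed_segment a4 a"
    by (auto simp: rectpath_def Let_def path_image_join a2_def a4_def)
  have i: "F contour_integrable_on linepath a a2" "F contour_integrable_on linepath a2 b"
    "F contour_integrable_on linepath b a4" "F contour_integrable_on linepath a4 a"
    using assms(1) unfolding pi by (auto intro!: contour_integrable_continuous_linepath elim: continuous_on_subset)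
  show "contour_integral (rectpath a b) F =
    contour_integral (linepath a (Complex (Re b) (Im a))) F + contour_integral (linepath (Complex (Re b) (Im a)) b) F +
    contour_integral (linepath b (Complex (Re a) (Im b))) F + contour_integral (linepath (Complex (Re a) (Im b)) a) F"
    using i unfolding rectpath_def Let_def a2_def [symmetric] a4_def [symmetric]
    by (simp add: add.assoc)
  show "F contour_integrable_on linepath a (Complex (Re b) (Im a))"
    "F contour_integrable_on linepath b (Complex (Re a) (Im b))"
    "F contour_integrable_on linepath (Complex (Re a) (Im b)) a"
    using i by (auto simp: a2_def a4_def)
  show "closed_segment a (Complex (Re b) (Im a)) \<subseteq> path_image (rectpath a b)"
    "closed_segment b (Complex (Re a) (Im b)) \<subseteq> path_image (rectpath a b)"
    "closed_segment (Complex (Re a) (Im b)) a \<subseteq> path_image (rectpath a b)"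
    unfolding pi by (auto simp: a2_def a4_def)
qed

text \<open>The logarithmic derivative times
  \<open>mellin (s - \<rho>) * exp ((s - \<rho>) * u)\<close> is integrated around the rectangle
  \<open>-1 \<le> Re s \<le> 2\<close>, \<open>\<bar>Im s - Im \<rho>\<bar> \<le> X\<close>, with
  \<open>X\<close> of order \<open>L\<^sup>2\<close>. The right side yields the sum over
  \<open>n\<close>. The left side yields the error \<open>exp (- u)\<close>, since
  \<open>Re (s - \<rho>) \<le> -1\<close> there. The horizontal sides and the truncation on the
  right yield \<open>exp (2 * u - L / 3)\<close>.\<close>

lemma explicit_formula:
  obtains C T\<^sub>0 :: real where "C > 0" "T\<^sub>0 \<ge> 40"
    "\<And>\<rho>. zeta \<rho> = 0 \<Longrightarrow> Im \<rho> \<ge> T\<^sub>0 \<Longrightarrow> \<exists>Z. finite Z \<and> \<rho> \<in> Z \<and>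
      (\<forall>p\<in>Z. zeta p = 0 \<and> Im p > 0 \<and> norm (p - \<rho>) \<le> (ln (Im \<rho>))\<^sup>2) \<and>
      (\<Sum>p\<in>Z. zmult p) \<le> C * ln (Im \<rho>) ^ 4 \<and>
      (\<forall>u\<ge>0. norm (prime_sum \<rho> (exp u) + (\<Sum>p\<in>Z. of_real (zmult p) * (mellin (p - \<rho>) * exp ((p - \<rho>) * of_real u))))
        \<le> C * ln (Im \<rho>) ^ 4 * (exp (- u) + exp (2 * u - ln (Im \<rho>) / 3)))"
proof -
  obtain K T\<^sub>1 :: real where K: "K \<ge> 1" and T1: "T\<^sub>1 \<ge> 40"
    and fin: "\<And>t. t \<ge> T\<^sub>1 \<Longrightarrow> finite {z \<in> cball (Complex 3 t) 10. zeta z = 0}"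
    and cnt: "\<And>t. t \<ge> T\<^sub>1 \<Longrightarrow> (\<Sum>p\<in>{z \<in> cball (Complex 3 t) 10. zeta z = 0}. zmult p) \<le> K * ln t"
    and ldb: "\<And>z d. Im z \<ge> T\<^sub>1 \<Longrightarrow> -1 \<le> Re z \<Longrightarrow> Re z \<le> 2 \<Longrightarrow> 0 < d \<Longrightarrow> d \<le> 1 \<Longrightarrow>
       \<forall>p. zeta p = 0 \<longrightarrow> \<bar>Im p - Im z\<bar> \<le> 10 \<longrightarrow> norm (z - p) \<ge> d \<Longrightarrow>
       norm (deriv zeta z / zeta z) \<le> 2 * K * ln (Im z) / d"
    by (rule zeta_log_deriv_bound) (rule that)
  define V where "V = mangoldt_abs_2"
  have V: "V \<ge> 0" unfolding V_def by (rule mangoldt_abs_2_nonneg)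
  \<comment> \<open>One summand for each source: \<open>6 * K\<close> counts the zeros,
    \<open>5760 * K\<^sup>2\<close> bounds the two horizontal sides of length 3
    (\<open>2 * 3 * 960\<close>), \<open>96 * K\<close> the left side, and \<open>576 * V\<close>
    the truncation on the right side.\<close>
  define C where "C = 6 * K + 5760 * K\<^sup>2 + 96 * K + 576 * V"
  have ev: "\<forall>\<^sub>F \<gamma> in at_top. \<gamma> \<ge> T\<^sub>1 + (ln \<gamma>)\<^sup>2 + 20 \<and> ln \<gamma> \<ge> 10 \<and> \<gamma> \<ge> (40 :: real)"
    by (intro eventually_conj) real_asymp+
  then obtain T\<^sub>2 where T2: "\<And>\<gamma>. \<gamma> \<ge> T\<^sub>2 \<Longrightarrow> \<gamma> \<ge> T\<^sub>1 + (ln \<gamma>)\<^sup>2 + 20 \<and> ln \<gamma> \<ge> 10 \<and> \<gamma> \<ge> (40 :: real)"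
    unfolding eventually_at_top_linorder by blast
  show ?thesis
  proof (rule that [of C "max T\<^sub>2 40"])
    show "C > 0" using K V by (simp add: C_def add_pos_nonneg)
    fix \<rho> assume z\<rho>: "zeta \<rho> = 0" and im: "Im \<rho> \<ge> max T\<^sub>2 40"
    define \<gamma> where "\<gamma> = Im \<rho>"
    define L where "L = ln \<gamma>"
    have \<gamma>: "\<gamma> \<ge> T\<^sub>1 + L\<^sup>2 + 20" "L \<ge> 10" "\<gamma> \<ge> 40"
      using T2 [of \<gamma>] im by (auto simp: \<gamma>_def L_def)
    have \<beta>: "0 \<le> Re \<rho>" "Re \<rho> \<le> 1" using zeta_zero_strip [OF z\<rho>] \<gamma> by (auto simp: \<gamma>_def)
    \<comment> \<open>The factor \<open>1 / 2\<close> lies between two demands: below 1, so that the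
      rectangle stays within distance \<open>L\<^sup>2\<close> of \<open>\<rho>\<close>, and above
      \<open>4 / 9\<close>, so that \<open>sqrt X \<ge> 2 / 3 * L\<close>.\<close>
    define X0 where "X0 = L\<^sup>2 / 2"
    have LL: "10 * L \<le> L\<^sup>2" using \<gamma> by (simp add: power2_eq_square)
    have X0: "X0 \<ge> 50" "X0 + 1 \<le> L\<^sup>2" using LL \<gamma> by (auto simp: X0_def)
    have ln2: "ln t \<le> 2 * L" if "0 < t" "t \<le> 2 * \<gamma>" for t
    proof -
      have "2 * \<gamma> \<le> \<gamma> * \<gamma>" using \<gamma> by (intro mult_right_mono) auto
      then have "ln t \<le> ln (\<gamma> * \<gamma>)"
        using that by (subst ln_le_cancel_iff) linarith+
      also have "\<dots> = 2 * L" using \<gamma> by (simp add: ln_mult L_def)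
      finally show ?thesis .
    qed
    define tp tm where "tp = \<gamma> + X0" and "tm = \<gamma> - X0"
    define Zp Zm where "Zp = {z \<in> cball (Complex 3 tp) 10. zeta z = 0}"
      and "Zm = {z \<in> cball (Complex 3 tm) 10. zeta z = 0}"
    have tt: "tp \<ge> T\<^sub>1" "tm \<ge> T\<^sub>1" "tp \<le> 2 * \<gamma>" "tm \<le> 2 * \<gamma>"
      using \<gamma> X0 T1 by (auto simp: tp_def tm_def)
    \<comment> \<open>The same \<open>X\<close> must keep both horizontal sides away from zeros.
      Recording only the distance of each zero to the height \<open>\<gamma>\<close> turns this into
      a single gap problem.\<close>
    define B where "B = (\<lambda>p. \<bar>Im p - \<gamma>\<bar>) ` (Zp \<union> Zm)"
    have finZ: "finite Zp" "finite Zm" unfolding Zp_def Zm_def by (rule fin [OF tt(1)], rule fin [OF tt(2)])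
    have cardZ: "real (card {z \<in> cball (Complex 3 t) 10. zeta z = 0}) \<le> K * (2 * L)"
      if t: "t \<ge> T\<^sub>1" "t \<le> 2 * \<gamma>" for t
    proof -
      have "real (card {z \<in> cball (Complex 3 t) 10. zeta z = 0}) = (\<Sum>p\<in>{z \<in> cball (Complex 3 t) 10. zeta z = 0}. 1)"
        by simp
      also have "\<dots> \<le> (\<Sum>p\<in>{z \<in> cball (Complex 3 t) 10. zeta z = 0}. zmult p)"
      proof (rule sum_mono)
        fix p assume p: "p \<in> {z \<in> cball (Complex 3 t) 10. zeta z = 0}"
        then have "\<bar>Im (Complex 3 t - p)\<bar> \<le> 10" using abs_Im_le_cmod [of "Complex 3 t - p"] by (simp add: dist_norm)
        then have "Im p > 0" using t T1 by (simp add: abs_le_iff)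
        then show "1 \<le> zmult p" using p zorder_zeta_zero(2) by simp
      qed
      also have "\<dots> \<le> K * ln t" by (rule cnt [OF t(1)])
      also have "\<dots> \<le> K * (2 * L)" using t T1 K by (intro mult_left_mono ln2) auto
      finally show ?thesis .
    qed
    have "finite B" using finZ by (simp add: B_def)
    have "card B \<le> card Zp + card Zm"
      unfolding B_def using finZ card_image_le [of "Zp \<union> Zm" "\<lambda>p. \<bar>Im p - \<gamma>\<bar>"] card_Un_le [of Zp Zm] by simp
    then have cB: "real (card B) \<le> 4 * K * L"
      using cardZ [OF tt(1,3)] cardZ [OF tt(2,4)] unfolding Zp_def [symmetric] Zm_def [symmetric] by linarith
    obtain X where X: "X0 \<le> X" "X \<le> X0 + 1"
      and gap: "\<And>b. b \<in> B \<Longrightarrow> \<bar>X - b\<bar> \<ge> 1 / (2 * (real (card B) + 1))"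
      using pigeonhole_gap [OF \<open>finite B\<close>, of X0] by blast
    have KL: "K * L \<ge> 10" using K \<gamma> mult_mono [of 1 K 10 L] by simp
    \<comment> \<open>From \<open>card B \<le> 4 * K * L\<close> it follows that
      \<open>2 * (card B + 1) \<le> 8 * K * L + 2 \<le> 10 * K * L\<close>, so \<open>d\<close> is
      below the gap obtained.\<close>
    define d where "d = 1 / (10 * K * L)"
    have d: "0 < d" "d \<le> 1" using KL by (auto simp: d_def field_simps)
    have d': "d \<le> 1 / (2 * (real (card B) + 1))"
      unfolding d_def using cB KL by (intro divide_left_mono) auto
    have X': "X \<ge> 50" "X \<le> L\<^sup>2" using X X0 by auto
    have upper: "Im p > 0" if "\<bar>Im p - y\<bar> \<le> 10" "y \<ge> T\<^sub>1" for p y using that T1 by (simp add: abs_le_iff)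
    have far: "d \<le> norm (z - p)" if z: "Im z = \<gamma> + X \<or> Im z = \<gamma> - X" and p: "zeta p = 0" "\<bar>Im p - Im z\<bar> \<le> 10" for z p
    proof -
      have "Im z \<ge> T\<^sub>1" using z X' \<gamma> X X0 by auto
      then have "Im p > 0" using p upper by blast
      then have re: "0 \<le> Re p" "Re p \<le> 1" using zeta_zero_strip [OF p(1)] by auto
      have "d \<le> \<bar>Im p - Im z\<bar>"
      proof (cases "\<bar>Im p - Im z\<bar> \<ge> 1")
        case True
        then show ?thesis using d by linarith
      next
        case False
        have inZ: "p \<in> {z \<in> cball (Complex 3 t) 10. zeta z = 0}" if "\<bar>t - Im z\<bar> \<le> 1" for t
        proof -
          have "\<bar>Im (Complex 3 t - p)\<bar> \<le> 2" using that False by simp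
          then show ?thesis using re p cmod_le [of "Complex 3 t - p"] by (simp add: dist_norm)
        qed
        have "p \<in> Zp \<union> Zm" using z
        proof
          assume "Im z = \<gamma> + X"
          then have "p \<in> Zp" unfolding Zp_def using X by (intro inZ) (simp add: tp_def)
          then show ?thesis by simp
        next
          assume "Im z = \<gamma> - X"
          then have "p \<in> Zm" unfolding Zm_def using X by (intro inZ) (simp add: tm_def)
          then show ?thesis by simp
        qed
        then have "\<bar>Im p - \<gamma>\<bar> \<in> B" by (simp add: B_def)
        from gap [OF this] have "d \<le> \<bar>X - \<bar>Im p - \<gamma>\<bar>\<bar>" using d' by linarith
        also have "\<dots> \<le> \<bar>Im p - Im z\<bar>" using z X' by (auto simp: abs_if)
        finally show ?thesis .
      qed
      also have "\<dots> \<le> norm (z - p)" using abs_Im_le_cmod [of "z - p"] by simp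
      finally show ?thesis .
    qed
    define a b where "a = Complex (- 1) (\<gamma> - X)" and "b = Complex 2 (\<gamma> + X)"
    have ab: "Re a = - 1" "Re b = 2" "Im a = \<gamma> - X" "Im b = \<gamma> + X" by (auto simp: a_def b_def)
    have ImaT: "Im a \<ge> T\<^sub>1" using \<gamma> X' by (simp add: ab)
    have path: "z \<in> path_image (rectpath a b) \<longleftrightarrow>
        (Re z \<in> {- 1, 2} \<and> Im z \<in> {\<gamma> - X..\<gamma> + X}) \<or> (Im z \<in> {\<gamma> - X, \<gamma> + X} \<and> Re z \<in> {- 1..2})" for z
      using X' by (subst path_image_rectpath) (auto simp: ab)
    have pathT: "T\<^sub>1 \<le> Im z" "Im z \<le> 2 * \<gamma>" "-1 \<le> Re z" "Re z \<le> 2" if "z \<in> path_image (rectpath a b)" for z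
      using that \<gamma> X' T1 unfolding path by auto
    have nz: "zeta z \<noteq> 0" if "z \<in> path_image (rectpath a b)" for z
    proof
      assume "zeta z = 0"
      moreover have "Im z > 0" using pathT [OF that] T1 by simp
      ultimately have "0 \<le> Re z" "Re z \<le> 1" using zeta_zero_strip by auto
      then have "Im z = \<gamma> + X \<or> Im z = \<gamma> - X" using that unfolding path by auto
      from far [OF this \<open>zeta z = 0\<close>] show False using d by simp
    qed
    define Z where "Z = {p \<in> box a b. zeta p = 0}"
    have Zp: "zeta p = 0 \<and> Im p > 0 \<and> \<bar>Im p - \<gamma>\<bar> \<le> X \<and> 0 \<le> Re p \<and> Re p \<le> 1" if "p \<in> Z" for p
    proof -
      have p: "zeta p = 0" "\<gamma> - X < Im p" "Im p < \<gamma> + X" using that by (auto simp: Z_def in_box_complex_iff ab)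
      then have "Im p > 0" using ImaT T1 by (simp add: ab)
      then show ?thesis using p zeta_zero_strip [OF p(1)] by auto
    qed
    have "finite {p \<in> cbox a b. zeta p = 0}"
      by (rule finite_zeta_zeros_compact) (use ImaT T1 in \<open>auto simp: in_cbox_complex_iff\<close>)
    then have finZZ: "finite Z" unfolding Z_def by (rule finite_subset [rotated]) (use box_subset_cbox in auto)
    have \<rho>Z: "\<rho> \<in> Z" using z\<rho> \<beta> X' by (simp add: Z_def in_box_complex_iff ab \<gamma>_def)
    have near: "norm (p - \<rho>) \<le> L\<^sup>2" if "p \<in> Z" for p
    proof -
      have "norm (p - \<rho>) \<le> \<bar>Re p - Re \<rho>\<bar> + \<bar>Im p - Im \<rho>\<bar>" using cmod_le [of "p - \<rho>"] by simp
      also have "\<dots> \<le> 1 + X" using Zp [OF that] \<beta> by (intro add_mono) (auto simp: \<gamma>_def)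
      also have "\<dots> \<le> L\<^sup>2" using X X0 by (simp add: X0_def)
      finally show ?thesis .
    qed
    have Lpow: "L ^ j \<le> L ^ 4" if "j \<le> 4" for j using that \<gamma> by (intro power_increasing) auto
    have count: "(\<Sum>p\<in>Z. zmult p) \<le> C * L ^ 4"
    proof -
      define M where "M = nat \<lceil>X\<rceil>"
      have M: "X \<le> real M" "real M \<le> X + 1" using X' by (auto simp: M_def)
      have Msq: "real M \<le> L\<^sup>2" using M X X0 by (simp add: X0_def)
      have "(\<Sum>p\<in>Z. zmult p) \<le> (2 * real M + 1) * (K * ln (2 * \<gamma>))"
      proof (rule zero_count_window [of T\<^sub>1 K M \<gamma> Z, OF cnt fin])
        show "zeta p = 0 \<and> \<bar>Im p - \<gamma>\<bar> \<le> real M" if "p \<in> Z" for p using Zp [OF that] M by auto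
      qed (use K T1 \<gamma> Msq finZZ in auto)
      also have "\<dots> \<le> (2 * L\<^sup>2 + 1) * (K * (2 * L))"
        using Msq K \<gamma> by (intro mult_mono mult_left_mono ln2) auto
      also have "\<dots> \<le> (3 * L\<^sup>2) * (K * (2 * L))"
        using K \<gamma> LL by (intro mult_right_mono) auto
      also have "\<dots> = 6 * K * L ^ 3" by (simp add: power2_eq_square power3_eq_cube)
      also have "\<dots> \<le> C * L ^ 4"
        using K V Lpow [of 3] \<gamma> by (intro mult_mono) (auto simp: C_def)
      finally show ?thesis .
    qed
    have main: "norm (prime_sum \<rho> (exp u) + (\<Sum>p\<in>Z. of_real (zmult p) * (mellin (p - \<rho>) * exp ((p - \<rho>) * of_real u))))
        \<le> C * L ^ 4 * (exp (- u) + exp (2 * u - L / 3))" if u: "u \<ge> 0" for u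
    proof -
      define h where "h s = mellin (s - \<rho>) * exp ((s - \<rho>) * of_real u)" for s
      define F where "F z = deriv zeta z * h z / zeta z" for z
      define S where "S = prime_sum \<rho> (exp u)"
      define ZS where "ZS = (\<Sum>p\<in>Z. of_real (zmult p) * h p)"
      define \<epsilon> where "\<epsilon> = exp (2 * u - L / 3)"
      have hh: "h holomorphic_on UNIV"
      proof -
        have "mellin \<circ> (\<lambda>s. s - \<rho>) holomorphic_on UNIV"
          by (rule holomorphic_on_compose_gen [OF _ mellin_holomorphic [of UNIV]]) (auto intro!: holomorphic_intros)
        then show ?thesis unfolding h_def [abs_def] o_def by (intro holomorphic_intros) auto
      qed
      have Fcont: "continuous_on (path_image (rectpath a b)) F"
      proof -
        have sub: "path_image (rectpath a b) \<subseteq> {s. Im s > 0}" using pathT T1 by fastforce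
        have "continuous_on (path_image (rectpath a b)) zeta"
          by (rule continuous_on_subset [OF holomorphic_on_imp_continuous_on [OF zeta_holomorphic_upper] sub])
        moreover have "continuous_on (path_image (rectpath a b)) (deriv zeta)"
          by (rule continuous_on_subset [OF holomorphic_on_imp_continuous_on [OF holomorphic_deriv [OF zeta_holomorphic_upper upper_half_plane(1)]] sub])
        moreover have "continuous_on (path_image (rectpath a b)) h"
          by (rule continuous_on_subset [OF holomorphic_on_imp_continuous_on [OF hh]]) auto
        ultimately show ?thesis unfolding F_def using nz by (intro continuous_intros) auto
      qed
      have res: "contour_integral (rectpath a b) F = 2 * pi * \<i> * ZS"
        unfolding F_def ZS_def Z_def
        by (rule rectpath_log_deriv [OF _ _ _ hh nz]) (use ab X' ImaT T1 in auto)
      define a2 a4 where "a2 = Complex (Re b) (Im a)" and "a4 = Complex (Re a) (Im b)"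
      have "Re a \<le> Re b" "Im a \<le> Im b" using X' by (auto simp: ab)
      note split = contour_integral_rectpath_split [OF Fcont this, folded a2_def a4_def]
      have sqX: "sqrt X \<le> L" "2 / 3 * L \<le> sqrt X"
      proof -
        show "sqrt X \<le> L" using X' \<gamma> by (intro real_le_lsqrt) auto
        have "0 \<le> L * L" by simp
        moreover have "(2 / 3 * L)\<^sup>2 = 4 / 9 * (L * L)" "X0 = L * L / 2" by (simp_all add: X0_def power2_eq_square)
        ultimately have "(2 / 3 * L)\<^sup>2 \<le> X" using X by linarith
        then show "2 / 3 * L \<le> sqrt X" by (rule real_le_rsqrt)
      qed
      have eX: "exp (- (sqrt X / 2)) \<le> exp (- (L / 3))" using sqX by simp
      have logd: "norm (deriv zeta z / zeta z) \<le> 4 * K * L / d'"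
        if z: "z \<in> path_image (rectpath a b)" and d': "0 < d'" "d' \<le> 1"
          and "\<And>p. zeta p = 0 \<Longrightarrow> \<bar>Im p - Im z\<bar> \<le> 10 \<Longrightarrow> norm (z - p) \<ge> d'" for z d'
      proof -
        have "norm (deriv zeta z / zeta z) \<le> 2 * K * ln (Im z) / d'"
          using pathT [OF z] d' that(4) by (intro ldb) auto
        also have "\<dots> \<le> 2 * K * (2 * L) / d'"
          using pathT [OF z] T1 d' K by (intro divide_right_mono mult_left_mono ln2) auto
        finally show ?thesis by simp
      qed
      have horiz: "norm (F z) \<le> 960 * (K\<^sup>2 * L\<^sup>2 * \<epsilon>)"
        if z: "z \<in> path_image (rectpath a b)" "Im z = \<gamma> + X \<or> Im z = \<gamma> - X" for z
      proof -
        have re: "\<bar>Re (z - \<rho>)\<bar> \<le> 2" using pathT [OF z(1)] \<beta> by auto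
        have im': "\<bar>Im (z - \<rho>)\<bar> = X" using z(2) X' by (auto simp: \<gamma>_def)
        have "norm (h z) = norm (mellin (z - \<rho>)) * exp (Re (z - \<rho>) * u)" by (simp add: h_def norm_mult)
        also have "\<dots> \<le> (24 * exp (- (L / 3))) * exp (2 * u)"
        proof (rule mult_mono)
          show "norm (mellin (z - \<rho>)) \<le> 24 * exp (- (L / 3))"
            using mellin_decay [OF re] eX unfolding im' by linarith
          show "exp (Re (z - \<rho>) * u) \<le> exp (2 * u)" using re u by (auto intro: mult_right_mono)
        qed auto
        also have "\<dots> = 24 * \<epsilon>" by (simp add: \<epsilon>_def flip: exp_add)
        finally have hb: "norm (h z) \<le> 24 * \<epsilon>" .
        have "norm (deriv zeta z / zeta z) \<le> 4 * K * L / d"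
          using far [OF z(2)] by (intro logd [OF z(1) d]) auto
        also have "\<dots> = 40 * (K\<^sup>2 * L\<^sup>2)" by (simp add: d_def power2_eq_square)
        finally have "norm (deriv zeta z / zeta z) * norm (h z) \<le> 40 * (K\<^sup>2 * L\<^sup>2) * (24 * \<epsilon>)"
          using hb by (intro mult_mono) auto
        then show ?thesis by (simp add: F_def norm_mult norm_divide)
      qed
      have bot: "norm (contour_integral (linepath a a2) F) \<le> 960 * (K\<^sup>2 * L\<^sup>2 * \<epsilon>) * 3"
      proof -
        have "norm (contour_integral (linepath a a2) F) \<le> 960 * (K\<^sup>2 * L\<^sup>2 * \<epsilon>) * norm (a2 - a)"
        proof (rule contour_integral_bound_linepath [OF split(2)])
          fix z assume z: "z \<in> closed_segment a a2"
          then have "Im z = \<gamma> - X" using closed_segment_same_Im [of a a2] by (auto simp: a2_def ab)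
          then show "norm (F z) \<le> 960 * (K\<^sup>2 * L\<^sup>2 * \<epsilon>)" using z split(5) by (intro horiz) auto
        qed (simp add: \<epsilon>_def)
        also have "a2 - a = 3" by (simp add: complex_eq_iff a2_def ab)
        finally show ?thesis by simp
      qed
      have top: "norm (contour_integral (linepath b a4) F) \<le> 960 * (K\<^sup>2 * L\<^sup>2 * \<epsilon>) * 3"
      proof -
        have "norm (contour_integral (linepath b a4) F) \<le> 960 * (K\<^sup>2 * L\<^sup>2 * \<epsilon>) * norm (a4 - b)"
        proof (rule contour_integral_bound_linepath [OF split(3)])
          fix z assume z: "z \<in> closed_segment b a4"
          then have "Im z = \<gamma> + X" using closed_segment_same_Im [of b a4] by (auto simp: a4_def ab)
          then show "norm (F z) \<le> 960 * (K\<^sup>2 * L\<^sup>2 * \<epsilon>)" using z split(6) by (intro horiz) auto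
        qed (simp add: \<epsilon>_def)
        also have "a4 - b = - 3" by (simp add: complex_eq_iff a4_def ab)
        finally show ?thesis by simp
      qed
      \<comment> \<open>No gap has to be arranged on this side: the zeros above the real axis have
        \<open>Re p \<ge> 0\<close>, hence distance at least 1 from the line
        \<open>Re s = -1\<close>. This is where the functional equation pays off.\<close>
      have left: "norm (contour_integral (linepath a4 a) F) \<le> 48 * K * L * exp (- u) * (2 * L\<^sup>2)"
      proof -
        have "norm (contour_integral (linepath a4 a) F) \<le> 48 * K * L * exp (- u) * norm (a - a4)"
        proof (rule contour_integral_bound_linepath [OF split(4)])
          show "0 \<le> 48 * K * L * exp (- u)" using K \<gamma> by simp
          fix z assume z: "z \<in> closed_segment a4 a"
          then have zr: "Re z = - 1" using closed_segment_same_Re [of a4 a] by (auto simp: a4_def ab)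
          have zp: "z \<in> path_image (rectpath a b)" using z split(7) by auto
          have re: "\<bar>Re (z - \<rho>)\<bar> \<le> 2" using zr \<beta> by auto
          have "norm (h z) = norm (mellin (z - \<rho>)) * exp (Re (z - \<rho>) * u)" by (simp add: h_def norm_mult)
          also have "\<dots> \<le> 12 * exp (- u)"
          proof (rule mult_mono)
            show "norm (mellin (z - \<rho>)) \<le> 12" by (rule mellin_bound [OF re])
            have "Re (z - \<rho>) * u \<le> (- 1) * u" using zr \<beta> u by (intro mult_right_mono) auto
            then show "exp (Re (z - \<rho>) * u) \<le> exp (- u)" by simp
          qed auto
          finally have hb: "norm (h z) \<le> 12 * exp (- u)" .
          have "norm (deriv zeta z / zeta z) \<le> 4 * K * L / 1"
          proof (rule logd [OF zp])
            fix p assume p: "zeta p = 0" "\<bar>Im p - Im z\<bar> \<le> 10"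
            then have "Im p > 0" using pathT [OF zp] upper by blast
            then have "0 \<le> Re p" using zeta_zero_strip [OF p(1)] by auto
            then show "1 \<le> norm (z - p)" using abs_Re_le_cmod [of "z - p"] zr by simp
          qed auto
          then have "norm (deriv zeta z / zeta z) * norm (h z) \<le> 4 * K * L / 1 * (12 * exp (- u))"
            using hb K \<gamma> by (intro mult_mono) auto
          then show "norm (F z) \<le> 48 * K * L * exp (- u)" by (simp add: F_def norm_mult norm_divide)
        qed
        also have "a - a4 = - (2 * X) * \<i>" by (simp add: complex_eq_iff a4_def ab)
        also have "norm (- (2 * X) * \<i>) = 2 * X" using X' by (simp add: norm_mult)
        also have "48 * K * L * exp (- u) * (2 * X) \<le> 48 * K * L * exp (- u) * (2 * L\<^sup>2)"
          using X' K \<gamma> by (intro mult_left_mono) auto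
        finally show ?thesis .
      qed
      define Ir where "Ir = integral {-X..X} (\<lambda>t. mangoldt_series (Complex 2 (Im \<rho> + t)) *
        (mellin (Complex (2 - Re \<rho>) t) * exp (Complex (2 - Re \<rho>) t * of_real u)))"
      \<comment> \<open>On this side the logarithmic derivative is minus the von Mangoldt series;
        the sign is why the sum over \<open>n\<close> and the sum over zeros appear added in the
        formula.\<close>
      have right: "contour_integral (linepath a2 b) F = - (\<i> * Ir)"
      proof -
        have "contour_integral (linepath a2 b) F = \<i> * integral {\<gamma> - X..\<gamma> + X} (\<lambda>y. F (Complex 2 y))"
          using X' by (intro contour_integral_linepath_same_Re) (auto simp: a2_def ab)
        also have "integral {\<gamma> - X..\<gamma> + X} (\<lambda>y. F (Complex 2 y)) = integral {-X..X} (\<lambda>t. F (Complex 2 (\<gamma> + t)))"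
        proof -
          have "continuous_on {- X + \<gamma>..X + \<gamma>} (\<lambda>y. F (Complex 2 y))"
            by (rule continuous_on_compose2 [OF Fcont]) (auto simp: Complex_eq path intro!: continuous_intros)
          from integral_shift [OF this] show ?thesis by (simp add: o_def add.commute)
        qed
        also have "(\<lambda>t. F (Complex 2 (\<gamma> + t))) = (\<lambda>t. - (mangoldt_series (Complex 2 (Im \<rho> + t)) *
          (mellin (Complex (2 - Re \<rho>) t) * exp (Complex (2 - Re \<rho>) t * of_real u))))"
        proof
          fix t
          define s where "s = Complex 2 (\<gamma> + t)"
          have s: "Re s > 1" by (simp add: s_def)
          have "s - \<rho> = Complex (2 - Re \<rho>) t" by (simp add: s_def complex_eq_iff \<gamma>_def)
          then show "F s = - (mangoldt_series (Complex 2 (Im \<rho> + t)) *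
            (mellin (Complex (2 - Re \<rho>) t) * exp (Complex (2 - Re \<rho>) t * of_real u)))"
            using zeta_nonzero_Re_gt_1 [OF s] deriv_zeta [OF s] by (simp add: F_def h_def s_def \<gamma>_def)
        qed
        finally show ?thesis by (simp add: Ir_def)
      qed
      have Irb: "norm (Ir - of_real (2 * pi) * S) \<le> 576 * V * L * \<epsilon>"
      proof -
        have "norm (Ir - of_real (2 * pi) * S) \<le> V * (exp (2 * u) * (48 * ((4 * sqrt X + 8) * exp (- (sqrt X / 2)))))"
          unfolding Ir_def S_def V_def using X' by (intro right_line_integral \<beta> u) auto
        also have "\<dots> \<le> V * (exp (2 * u) * (48 * ((12 * L) * exp (- (L / 3)))))"
          using V sqX \<gamma> eX by (intro mult_left_mono mult_mono) auto
        also have "\<dots> = 576 * V * L * (exp (2 * u) * exp (- (L / 3)))" by simp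
        also have "exp (2 * u) * exp (- (L / 3)) = \<epsilon>" by (simp add: \<epsilon>_def flip: exp_add)
        finally show ?thesis .
      qed
      have "2 * pi * \<i> * ZS = contour_integral (linepath a a2) F + (- (\<i> * Ir)) +
          contour_integral (linepath b a4) F + contour_integral (linepath a4 a) F"
        using split(1) res right by simp
      then have "2 * pi * \<i> * (S + ZS) = contour_integral (linepath a a2) F + contour_integral (linepath b a4) F +
          contour_integral (linepath a4 a) F - \<i> * (Ir - of_real (2 * pi) * S)"
        by (simp add: algebra_simps)
      then have "norm (2 * pi * \<i> * (S + ZS)) \<le> norm (contour_integral (linepath a a2) F) + norm (contour_integral (linepath b a4) F) +
          norm (contour_integral (linepath a4 a) F) + norm (\<i> * (Ir - of_real (2 * pi) * S))"
        by (simp only:) (intro order_trans [OF norm_triangle_ineq4] add_mono order_trans [OF norm_triangle_ineq] order_refl)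
      also have "norm (\<i> * (Ir - of_real (2 * pi) * S)) = norm (Ir - of_real (2 * pi) * S)" by (simp add: norm_mult)
      finally have "norm (2 * pi * \<i> * (S + ZS)) \<le>
          5760 * (K\<^sup>2 * L\<^sup>2 * \<epsilon>) + 96 * (K * (L * L\<^sup>2) * exp (- u)) + 576 * V * L * \<epsilon>"
        using bot top left Irb by (simp add: mult_ac)
      moreover have "norm (S + ZS) \<le> norm (2 * pi * \<i> * (S + ZS))"
      proof -
        have "1 * norm (S + ZS) \<le> (2 * pi) * norm (S + ZS)" using pi_gt3 by (intro mult_right_mono) auto
        then show ?thesis by (simp add: norm_mult)
      qed
      moreover have "5760 * (K\<^sup>2 * L\<^sup>2 * \<epsilon>) \<le> 5760 * (K\<^sup>2 * L ^ 4 * \<epsilon>)"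
        using Lpow [of 2] by (intro mult_left_mono mult_right_mono) (auto simp: \<epsilon>_def)
      moreover have "96 * (K * (L * L\<^sup>2) * exp (- u)) \<le> 96 * (K * L ^ 4 * exp (- u))"
        using Lpow [of 3] K by (intro mult_left_mono mult_right_mono) (auto simp: power2_eq_square power3_eq_cube)
      moreover have "576 * V * L * \<epsilon> \<le> 576 * V * L ^ 4 * \<epsilon>"
        using Lpow [of 1] V by (intro mult_left_mono mult_right_mono) (auto simp: \<epsilon>_def)
      moreover have "5760 * (K\<^sup>2 * L ^ 4 * \<epsilon>) + 96 * (K * L ^ 4 * exp (- u)) + 576 * V * L ^ 4 * \<epsilon> \<le> C * L ^ 4 * (exp (- u) + \<epsilon>)"
      proof -
        have "C * L ^ 4 * (exp (- u) + \<epsilon>) = 5760 * (K\<^sup>2 * L ^ 4 * \<epsilon>) + 96 * (K * L ^ 4 * exp (- u)) + 576 * V * L ^ 4 * \<epsilon>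
          + ((6 * K + 5760 * K\<^sup>2 + 576 * V) * L ^ 4 * exp (- u) + (6 * K + 96 * K) * L ^ 4 * \<epsilon>)"
          by (simp add: C_def algebra_simps)
        moreover have "0 \<le> (6 * K + 5760 * K\<^sup>2 + 576 * V) * L ^ 4 * exp (- u) + (6 * K + 96 * K) * L ^ 4 * \<epsilon>"
          using K V \<gamma> by (intro add_nonneg_nonneg mult_nonneg_nonneg) (auto simp: \<epsilon>_def)
        ultimately show ?thesis by linarith
      qed
      ultimately have "norm (S + ZS) \<le> C * L ^ 4 * (exp (- u) + \<epsilon>)" by linarith
      then show ?thesis by (simp add: S_def ZS_def h_def \<epsilon>_def)
    qed
    show "\<exists>Z. finite Z \<and> \<rho> \<in> Z \<and>
      (\<forall>p\<in>Z. zeta p = 0 \<and> Im p > 0 \<and> norm (p - \<rho>) \<le> (ln (Im \<rho>))\<^sup>2) \<and>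
      (\<Sum>p\<in>Z. zmult p) \<le> C * ln (Im \<rho>) ^ 4 \<and>
      (\<forall>u\<ge>0. norm (prime_sum \<rho> (exp u) + (\<Sum>p\<in>Z. of_real (zmult p) * (mellin (p - \<rho>) * exp ((p - \<rho>) * of_real u))))
        \<le> C * ln (Im \<rho>) ^ 4 * (exp (- u) + exp (2 * u - ln (Im \<rho>) / 3)))"
      unfolding \<gamma>_def [symmetric] L_def [symmetric]
      using finZZ \<rho>Z Zp near count main by (intro exI [of _ Z]) blast
  qed auto
qed

section \<open>One-sided exponential sums\<close>

text \<open>
  The real part of \<open>Q w = \<i> / (w - 5/2 + \<i>/4) - 1/8\<close> is a cheap minorant of a harmonic measure on
  the upper half of the disc of radius \<open>11\<close>: on the boundary it is at most \<open>0\<close> except on the interval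
  \<open>[1, 4]\<close>, where it is at most \<open>4\<close>, but it is positive at \<open>9/4 \<i>\<close>.
\<close>

lemma half_disc_two_constants:
  fixes H :: "complex \<Rightarrow> complex"
  assumes hol: "H holomorphic_on UNIV"
    and M: "\<And>w. Im w \<ge> 0 \<Longrightarrow> norm w \<le> 11 \<Longrightarrow> norm (H w) \<le> M"
    and \<epsilon>: "\<And>x. x \<in> {1..4} \<Longrightarrow> norm (H (of_real x)) \<le> \<epsilon>" "0 < \<epsilon>" "\<epsilon> \<le> M"
  shows "norm (H (\<i> * of_real (9 / 4))) \<le> M * (\<epsilon> / M) powr (3 / 160)"
proof -
  \<comment> \<open>Chosen so that \<open>exp (4 * \<theta>) = M / \<epsilon>\<close>, which makes
    up for the smallness of \<open>H\<close> on \<open>[1, 4]\<close> exactly. Since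
    \<open>Re Q\<close> is \<open>3 / 40\<close> at the target point, the gain there is the power
    \<open>3 / 160\<close> of \<open>\<epsilon> / M\<close>.\<close>
  define \<theta> where "\<theta> = ln (M / \<epsilon>) / 4"
  have \<theta>: "\<theta> \<ge> 0" using \<epsilon> by (simp add: \<theta>_def)
  have M0: "M > 0" using \<epsilon> by linarith
  \<comment> \<open>Its real part plus \<open>1 / 8\<close> is, up to a constant factor, the Poisson
    kernel of the half-plane \<open>Im w > - 1 / 4\<close>, with pole below the midpoint
    \<open>5 / 2\<close> of \<open>[1, 4]\<close>. The subtracted \<open>1 / 8\<close> exceeds the
    largest value \<open>4 / 37\<close> on the real line outside \<open>[1, 4]\<close>, and it
    bounds the kernel on \<open>norm w = 11\<close>, where the distance to the pole is at least
    8.\<close>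
  define Q where "Q w = 1 / ((w - 5 / 2) / \<i> + 1 / 4) - 1 / 8" for w :: complex
  define S where "S = {w. Im w \<ge> 0} \<inter> cball 0 (11 :: real)"
  define g where "g w = H w * exp (of_real \<theta> * Q w)" for w
  have cx: "(w - 5 / 2) / \<i> + 1 / 4 = Complex (Im w + 1 / 4) (5 / 2 - Re w)" for w
    by (simp add: complex_eq_iff)
  have den: "(w - 5 / 2) / \<i> + 1 / 4 \<noteq> 0" if "Im w \<ge> 0" for w
    unfolding cx using that by (simp add: complex_eq_iff)
  have ReQ: "Re (Q w) = (Im w + 1 / 4) / ((Im w + 1 / 4)\<^sup>2 + (Re w - 5 / 2)\<^sup>2) - 1 / 8" for w
    unfolding Q_def cx by (simp add: Re_divide power2_commute)
  have clS: "closed S" unfolding S_def by (intro closed_Int closed_halfspace_Im_ge closed_cball)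
  have gh: "g holomorphic_on S"
    unfolding g_def [abs_def] Q_def using den
    by (intro holomorphic_intros holomorphic_on_subset [OF hol]) (auto simp: S_def)
  have "norm (g (\<i> * of_real (9 / 4))) \<le> M"
  proof (rule maximum_modulus_frontier [of g S])
    show "g holomorphic_on interior S" by (rule holomorphic_on_subset [OF gh interior_subset])
    show "continuous_on (closure S) g"
      using holomorphic_on_imp_continuous_on [OF gh] clS by (simp add: closure_closed)
    show "bounded S" unfolding S_def by (intro bounded_Int) simp
    show "\<i> * of_real (9 / 4) \<in> S" by (simp add: S_def norm_mult)
    fix z assume z: "z \<in> frontier S"
    have zS: "z \<in> S" using z clS by (simp add: frontier_def closure_closed)
    have "\<not> (Im z > 0 \<and> norm z < 11)"
    proof
      assume a: "Im z > 0 \<and> norm z < 11"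
      have "open ({w. Im w > 0} \<inter> ball 0 (11 :: real))" by (intro open_Int open_halfspace_Im_gt open_ball)
      moreover have "{w. Im w > 0} \<inter> ball 0 11 \<subseteq> S" by (auto simp: S_def)
      ultimately have "{w. Im w > 0} \<inter> ball 0 11 \<subseteq> interior S" by (intro interior_maximal)
      then have "z \<in> interior S" using a by (auto simp: subset_iff)
      then show False using z by (simp add: frontier_def)
    qed
    then consider "Im z = 0" "Re z \<in> {1..4}" | "Im z = 0" "Re z \<notin> {1..4}" | "norm z = 11"
      using zS by (fastforce simp: S_def)
    then show "norm (g z) \<le> M"
    proof cases
      case 1
      have "norm (H (of_real (Re z))) \<le> \<epsilon>" by (rule \<epsilon>(1) [OF 1(2)])
      moreover have "of_real (Re z) = z" using 1 by (simp add: complex_eq_iff)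
      ultimately have "norm (H z) \<le> \<epsilon>" by simp
      moreover have "Re (Q z) \<le> 4"
      proof -
        have "(1 / 4) / ((1 / 4)\<^sup>2 + (Re z - 5 / 2)\<^sup>2) \<le> (1 / 4) / ((1 / 4)\<^sup>2 + 0)"
          by (intro divide_left_mono add_left_mono) (auto simp: add_pos_nonneg)
        then show ?thesis using 1 by (simp add: ReQ power2_eq_square)
      qed
      then have "\<theta> * Re (Q z) \<le> \<theta> * 4" using \<theta> by (intro mult_left_mono)
      then have "exp (\<theta> * Re (Q z)) \<le> exp (ln (M / \<epsilon>))" by (simp add: \<theta>_def)
      then have "exp (\<theta> * Re (Q z)) \<le> M / \<epsilon>" using \<epsilon> M0 by simp
      ultimately have "norm (g z) \<le> \<epsilon> * (M / \<epsilon>)"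
        unfolding g_def norm_mult using \<epsilon> by (intro mult_mono) auto
      then show ?thesis using \<epsilon> by simp
    next
      case 2
      have "9 / 4 \<le> (Re z - 5 / 2)\<^sup>2"
      proof -
        have "3 / 2 \<le> \<bar>Re z - 5 / 2\<bar>" using 2 by auto
        then have "(3 / 2)\<^sup>2 \<le> \<bar>Re z - 5 / 2\<bar>\<^sup>2" by (rule power_mono) simp
        then show ?thesis by (simp add: power2_eq_square)
      qed
      then have "(1 / 4) / ((1 / 4)\<^sup>2 + (Re z - 5 / 2)\<^sup>2) \<le> (1 / 4) / ((1 / 4)\<^sup>2 + 9 / 4)"
        by (intro divide_left_mono add_left_mono) (auto simp: add_pos_nonneg)
      then have "Re (Q z) \<le> 0" using 2 by (simp add: ReQ power2_eq_square)
      then have "\<theta> * Re (Q z) \<le> 0" using \<theta> by (simp add: mult_nonneg_nonpos)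
      then have "exp (\<theta> * Re (Q z)) \<le> 1" by simp
      moreover have "norm (H z) \<le> M" using zS by (intro M) (auto simp: S_def)
      ultimately have "norm (g z) \<le> M * 1" unfolding g_def norm_mult using M0 by (intro mult_mono) auto
      then show ?thesis by simp
    next
      case 3
      define v where "v = (z - 5 / 2) / \<i> + 1 / 4"
      have v8: "norm v \<ge> 8"
      proof -
        have "norm (z - 5 / 2) \<ge> 11 - 5 / 2" using norm_triangle_ineq2 [of z "5 / 2"] 3 by simp
        moreover have "norm ((z - 5 / 2) / \<i>) = norm (z - 5 / 2)" unfolding norm_divide by simp
        moreover have "norm v \<ge> norm ((z - 5 / 2) / \<i>) - norm (1 / 4 :: complex)"
          unfolding v_def using norm_triangle_ineq2 [of "(z - 5 / 2) / \<i>" "- (1 / 4)"] by simp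
        ultimately show ?thesis by simp
      qed
      have "Re (1 / v) \<le> norm (1 / v)" by (rule complex_Re_le_cmod)
      also have "\<dots> \<le> 1 / 8" using v8 by (simp add: norm_divide divide_le_eq)
      finally have "Re (Q z) \<le> 0" by (simp add: Q_def v_def)
      then have "\<theta> * Re (Q z) \<le> 0" using \<theta> by (simp add: mult_nonneg_nonpos)
      then have "exp (\<theta> * Re (Q z)) \<le> 1" by simp
      moreover have "norm (H z) \<le> M" using zS by (intro M) (auto simp: S_def)
      ultimately have "norm (g z) \<le> M * 1" unfolding g_def norm_mult using M0 by (intro mult_mono) auto
      then show ?thesis by simp
    qed
  qed
  moreover have "Re (Q (\<i> * of_real (9 / 4))) = 3 / 40" by (simp add: ReQ power2_eq_square)
  moreover have "norm (g p) = norm (H p) * exp (\<theta> * Re (Q p))" for p by (simp add: g_def norm_mult)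
  ultimately have "norm (H (\<i> * of_real (9 / 4))) * exp (\<theta> * (3 / 40)) \<le> M"
    by (simp only:)
  then have "norm (H (\<i> * of_real (9 / 4))) \<le> M * exp (- (\<theta> * (3 / 40)))"
    by (simp add: exp_minus field_simps)
  also have "exp (- (\<theta> * (3 / 40))) = (\<epsilon> / M) powr (3 / 160)"
    using \<epsilon> M0 by (simp add: powr_def \<theta>_def ln_div field_simps)
  finally show ?thesis .
qed

text \<open>The variable is rescaled by \<open>u = lam * w\<close>, so that the half-disc estimate
  applies with fixed geometry. The factor 48 is \<open>12 * 4\<close>: 12 bounds
  \<open>mellin\<close>, and 4 bounds \<open>exp (11 / 10)\<close>, which arises from
  \<open>\<bar>Re (p - \<rho>)\<bar> * lam \<le> 1 / 10\<close> and \<open>norm w \<le> 11\<close>.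
  The imaginary parts only help, as \<open>Im p \<ge> Im \<rho>\<close> and
  \<open>Im w \<ge> 0\<close>.\<close>

lemma one_sided_exp_sum_lower_bound:
  assumes Z: "finite Z" "\<rho> \<in> Z" "\<And>p. p \<in> Z \<Longrightarrow> \<bar>Re p - Re \<rho>\<bar> \<le> 1 / (10 * lam) \<and> Im p \<ge> Im \<rho>"
    and lam: "lam \<ge> 1" and m\<rho>: "zmult \<rho> \<ge> 1" and N: "(\<Sum>p\<in>Z. zmult p) \<le> N"
    and M: "48 * N \<le> M"
    and \<epsilon>: "0 < \<epsilon>" "\<epsilon> \<le> M"
      "\<And>u. u \<in> {lam..4 * lam} \<Longrightarrow> norm (\<Sum>p\<in>Z. of_real (zmult p) * (mellin (p - \<rho>) * exp ((p - \<rho>) * of_real u))) \<le> \<epsilon>"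
  shows "Re (mellin 0) \<le> M * (\<epsilon> / M) powr (3 / 160) + 12 * N * exp (- lam)"
proof -
  define H where "H w = (\<Sum>p\<in>Z. of_real (zmult p) * (mellin (p - \<rho>) * exp ((p - \<rho>) * (of_real lam * w))))" for w
  have l10: "1 / (10 * lam) \<le> 1 / 10" using lam by (intro divide_left_mono) auto
  have re2: "\<bar>Re (p - \<rho>)\<bar> \<le> 2" if "p \<in> Z" for p using Z(3) [OF that] l10 by auto
  have N0: "0 \<le> (\<Sum>p\<in>Z. zmult p)" by (intro sum_nonneg) (simp add: zmult_nonneg)
  have "norm (H (\<i> * of_real (9 / 4))) \<le> M * (\<epsilon> / M) powr (3 / 160)"
  proof (rule half_disc_two_constants)
    show "H holomorphic_on UNIV" unfolding H_def [abs_def] by (intro holomorphic_intros)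
    show "norm (H w) \<le> M" if w: "Im w \<ge> 0" "norm w \<le> 11" for w
    proof -
      have "norm (H w) \<le> (\<Sum>p\<in>Z. zmult p * (12 * 4))"
        unfolding H_def
      proof (rule sum_norm_le)
        fix p assume p: "p \<in> Z"
        have "Re (p - \<rho>) * lam * Re w - Im (p - \<rho>) * lam * Im w \<le> 11 / 10"
        proof -
          have "\<bar>Re (p - \<rho>)\<bar> * lam \<le> 1 / (10 * lam) * lam" using Z(3) [OF p] lam by (intro mult_right_mono) auto
          then have "\<bar>Re (p - \<rho>)\<bar> * lam \<le> 1 / 10" using lam by simp
          moreover have "\<bar>Re w\<bar> \<le> 11" using w abs_Re_le_cmod [of w] by linarith
          ultimately have "\<bar>Re (p - \<rho>)\<bar> * lam * \<bar>Re w\<bar> \<le> 1 / 10 * 11" by (intro mult_mono) auto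
          moreover have "Re (p - \<rho>) * lam * Re w \<le> \<bar>Re (p - \<rho>) * lam * Re w\<bar>" by simp
          moreover have "\<bar>Re (p - \<rho>) * lam * Re w\<bar> = \<bar>Re (p - \<rho>)\<bar> * lam * \<bar>Re w\<bar>" using lam by (simp add: abs_mult)
          moreover have "0 \<le> Im (p - \<rho>) * lam * Im w" using Z(3) [OF p] lam w by simp
          ultimately show ?thesis by linarith
        qed
        then have "exp (Re (p - \<rho>) * lam * Re w - Im (p - \<rho>) * lam * Im w) \<le> exp (11 / 10)" by simp
        also have "\<dots> \<le> 4"
        proof -
          have "11 / 10 \<le> 2 * ln (2 :: real)" using ln2_ge_two_thirds by simp
          also have "2 * ln (2 :: real) = ln (2 ^ 2)" by (subst ln_realpow) auto
          finally have "exp (11 / 10) \<le> exp (ln (2 ^ 2 :: real))" by (subst exp_le_cancel_iff)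
          then show ?thesis by simp
        qed
        finally have "norm (exp ((p - \<rho>) * (of_real lam * w))) \<le> 4" by (simp add: algebra_simps)
        then have "norm (mellin (p - \<rho>)) * norm (exp ((p - \<rho>) * (of_real lam * w))) \<le> 12 * 4"
          using mellin_bound [OF re2 [OF p]] by (intro mult_mono) auto
        then show "norm (of_real (zmult p) * (mellin (p - \<rho>) * exp ((p - \<rho>) * (of_real lam * w)))) \<le> zmult p * (12 * 4)"
          unfolding norm_mult using zmult_nonneg [of p] by (simp add: mult_left_mono)
      qed
      also have "\<dots> = (\<Sum>p\<in>Z. zmult p) * (12 * 4)" by (rule sum_distrib_right [symmetric])
      also have "\<dots> \<le> M" using N M by linarith
      finally show ?thesis .
    qed
    show "norm (H (of_real x)) \<le> \<epsilon>" if "x \<in> {1..4}" for x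
    proof -
      have "lam * x \<in> {lam..4 * lam}" using that lam by (auto simp: mult.commute)
      from \<epsilon>(3) [OF this] show ?thesis by (simp add: H_def)
    qed
  qed (use \<epsilon> in auto)
  moreover have "Re (mellin 0) - 12 * N * exp (- lam) \<le> Re (H (\<i> * of_real (9 / 4)))"
  proof -
    define v where "v p = of_real (zmult p) * (mellin (p - \<rho>) * exp ((p - \<rho>) * (of_real lam * (\<i> * of_real (9 / 4)))))" for p
    have vge: "Re (v p) \<ge> - (zmult p * (12 * exp (- lam)))" if p: "p \<in> Z" for p
    proof -
      define \<tau> where "\<tau> = Im (p - \<rho>)"
      define \<theta> where "\<theta> = 9 / 4 * lam * Re (p - \<rho>)"
      have \<tau>: "\<tau> \<ge> 0" using Z(3) [OF p] by (simp add: \<tau>_def)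
      have "exp ((p - \<rho>) * (of_real lam * (\<i> * of_real (9 / 4)))) = exp (of_real (- (9 / 4 * lam * \<tau>)) + \<i> * of_real \<theta>)"
        by (rule arg_cong [of _ _ exp]) (simp add: complex_eq_iff \<tau>_def \<theta>_def)
      then have e: "exp ((p - \<rho>) * (of_real lam * (\<i> * of_real (9 / 4)))) = of_real (exp (- (9 / 4 * lam * \<tau>))) * exp (\<i> * of_real \<theta>)"
        by (simp only: exp_add exp_of_real)
      have v: "v p = of_real (zmult p * exp (- (9 / 4 * lam * \<tau>))) * (mellin (p - \<rho>) * exp (\<i> * of_real \<theta>))"
        unfolding v_def e by simp
      show ?thesis
      \<comment> \<open>A zero with \<open>\<tau> \<le> 1\<close> is handled by sign, with phase
        \<open>\<bar>\<theta>\<bar> \<le> 9 / 4 * (1 / 10) < 1 / 4\<close>. A higher zero is handled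
        by size, as its exponential is at most \<open>exp (- lam)\<close>.\<close>
      proof (cases "\<tau> \<le> 1")
        case True
        have "\<bar>Re (p - \<rho>)\<bar> * lam \<le> 1 / (10 * lam) * lam" using Z(3) [OF p] lam by (intro mult_right_mono) auto
        then have "\<bar>Re (p - \<rho>)\<bar> * lam \<le> 1 / 10" using lam by simp
        moreover have "\<bar>\<theta>\<bar> = 9 / 4 * (\<bar>Re (p - \<rho>)\<bar> * lam)" using lam by (simp add: \<theta>_def abs_mult)
        ultimately have "\<bar>\<theta>\<bar> \<le> 1 / 4" by linarith
        then have "Re (mellin (p - \<rho>) * exp (\<i> * of_real \<theta>)) \<ge> 0"
          using True \<tau> by (intro Re_mellin_nonneg) (auto simp: \<tau>_def)
        moreover have "Re (of_real r * z) = r * Re z" for r :: real and z by simp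
        ultimately have "Re (v p) \<ge> 0" unfolding v by (metis mult_nonneg_nonneg zmult_nonneg exp_ge_zero)
        moreover have "zmult p * (12 * exp (- lam)) \<ge> 0" using zmult_nonneg [of p] by simp
        ultimately show ?thesis by linarith
      next
        case False
        have "lam * 1 \<le> lam * (9 / 4 * \<tau>)" using False lam by (intro mult_left_mono) auto
        then have "exp (- (9 / 4 * lam * \<tau>)) \<le> exp (- lam)" by (simp add: mult_ac)
        then have "zmult p * exp (- (9 / 4 * lam * \<tau>)) \<le> zmult p * exp (- lam)"
          by (intro mult_left_mono zmult_nonneg)
        then have "norm (of_real (zmult p * exp (- (9 / 4 * lam * \<tau>))) :: complex) \<le> zmult p * exp (- lam)"
          unfolding norm_of_real by (subst abs_of_nonneg) (auto simp: zmult_nonneg)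
        moreover have "norm (mellin (p - \<rho>) * exp (\<i> * of_real \<theta>)) \<le> 12"
          using mellin_bound [OF re2 [OF p]] by (simp add: norm_mult)
        ultimately have "norm (v p) \<le> (zmult p * exp (- lam)) * 12"
          unfolding v norm_mult [of "of_real (zmult p * exp (- (9 / 4 * lam * \<tau>)))"] 
          by (rule mult_mono) (auto simp: zmult_nonneg)
        then show ?thesis using abs_Re_le_cmod [of "v p"] by (simp add: mult_ac abs_le_iff)
      qed
    qed
    have "v \<rho> = of_real (zmult \<rho>) * mellin 0" by (simp add: v_def)
    then have "Re (v \<rho>) = zmult \<rho> * Re (mellin 0)" by simp
    also have "\<dots> \<ge> 1 * Re (mellin 0)" using m\<rho> Re_mellin_0 by (intro mult_right_mono) auto
    finally have v\<rho>: "Re (v \<rho>) \<ge> Re (mellin 0)" by simp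
    have "Re (H (\<i> * of_real (9 / 4))) = (\<Sum>p\<in>Z. Re (v p))" by (simp add: H_def v_def)
    also have "\<dots> = Re (v \<rho>) + (\<Sum>p\<in>Z - {\<rho>}. Re (v p))" by (rule sum.remove [OF Z(1,2)])
    finally have "Re (H (\<i> * of_real (9 / 4))) = Re (v \<rho>) + (\<Sum>p\<in>Z - {\<rho>}. Re (v p))" .
    moreover have "(\<Sum>p\<in>Z - {\<rho>}. - (zmult p * (12 * exp (- lam)))) \<le> (\<Sum>p\<in>Z - {\<rho>}. Re (v p))"
      using vge by (intro sum_mono) auto
    moreover have "(\<Sum>p\<in>Z - {\<rho>}. - (zmult p * (12 * exp (- lam)))) = - ((\<Sum>p\<in>Z - {\<rho>}. zmult p) * (12 * exp (- lam)))"
      by (simp only: sum_negf sum_distrib_right)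
    moreover have "(\<Sum>p\<in>Z - {\<rho>}. zmult p) * (12 * exp (- lam)) \<le> (\<Sum>p\<in>Z. zmult p) * (12 * exp (- lam))"
      using Z by (intro mult_right_mono sum_mono2) (auto simp: zmult_nonneg)
    moreover have "(\<Sum>p\<in>Z. zmult p) * (12 * exp (- lam)) \<le> N * (12 * exp (- lam))"
      using N by (intro mult_right_mono) auto
    ultimately show ?thesis using v\<rho> by linarith
  qed
  moreover have "Re (H (\<i> * of_real (9 / 4))) \<le> norm (H (\<i> * of_real (9 / 4)))" by (rule complex_Re_le_cmod)
  ultimately show ?thesis by linarith
qed

text \<open>The weight is \<open>bump\<close> and the exponent is 640. In terms of
  \<open>L = ln (Im \<rho>\<^sub>0)\<close>, a sum below \<open>(ln T) powr (- 640)\<close> is below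
  \<open>L powr (- 320)\<close>. The two-constants exponent \<open>3 / 160\<close> turns this into
  order \<open>L powr (- 6)\<close>, which times the \<open>L ^ 4\<close> from the count of zeros
  still tends to 0 and so cannot exceed the constant \<open>Re (mellin 0)\<close>.\<close>

theorem theorem1p4:
  shows "\<exists>C::real. C \<ge> 1 \<and>
    (\<exists>w\<^sub>0 :: real \<Rightarrow> real. smooth w\<^sub>0 \<and> (\<forall>x. w\<^sub>0 x \<ge> 0) \<and> closure {x. w\<^sub>0 x \<noteq> 0} \<subseteq> {1/2..2} \<and>
      (\<forall>\<^sub>F T :: real in at_top. \<forall>\<rho>\<^sub>0. half_isolated \<rho>\<^sub>0 \<and> Im \<rho>\<^sub>0 \<in> {T..2 * T} \<longrightarrow>
        (\<exists>Y :: real. Y \<in> {T powr ((ln (ln T)) ^ 3 / ln T) .. T powr (5 / ln (ln T))} \<and>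
          norm (\<Sum>\<^sub>\<infinity>n\<in>{1..}. (mangoldt n :: complex) / of_nat n powr \<rho>\<^sub>0 * of_real (w\<^sub>0 (real n / Y)))
            \<ge> (ln T) powr (- C))))"
proof -
  obtain C\<^sub>0 T\<^sub>0 :: real where C0: "C\<^sub>0 > 0" and T0: "T\<^sub>0 \<ge> 40"
    and expl: "\<And>\<rho>. zeta \<rho> = 0 \<Longrightarrow> Im \<rho> \<ge> T\<^sub>0 \<Longrightarrow> \<exists>Z. finite Z \<and> \<rho> \<in> Z \<and>
      (\<forall>p\<in>Z. zeta p = 0 \<and> Im p > 0 \<and> norm (p - \<rho>) \<le> (ln (Im \<rho>))\<^sup>2) \<and>
      (\<Sum>p\<in>Z. zmult p) \<le> C\<^sub>0 * ln (Im \<rho>) ^ 4 \<and>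
      (\<forall>u\<ge>0. norm (prime_sum \<rho> (exp u) + (\<Sum>p\<in>Z. of_real (zmult p) * (mellin (p - \<rho>) * exp ((p - \<rho>) * of_real u))))
        \<le> C\<^sub>0 * ln (Im \<rho>) ^ 4 * (exp (- u) + exp (2 * u - ln (Im \<rho>) / 3)))"
    by (rule explicit_formula) (rule that)
  define m where "m = Re (mellin 0)"
  have m: "m > 0" using Re_mellin_0 by (simp add: m_def)
  \<comment> \<open>All size conditions on \<open>L\<close> at once. The third line keeps the
    explicit-formula error and the zeros of the second kind below \<open>L powr (- 320)\<close>; the
    last two make each term of the final upper bound for \<open>m\<close> less than
    \<open>m / 2\<close>.\<close>
  have "\<forall>\<^sub>F L in at_top. L \<ge> 16 \<and> ln L \<ge> 48 \<and> 48 * C\<^sub>0 * L ^ 4 \<ge> 1 \<and> 2 * L powr (- 320) \<le> 1 \<and>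
      C\<^sub>0 * L ^ 4 * (exp (- (ln L ^ 3)) + exp (- (L / 6))) + 12 * (C\<^sub>0 * L ^ 4) * exp (- ((ln L)\<^sup>2)) \<le> L powr (- 320) \<and>
      48 * C\<^sub>0 * L ^ 4 * (2 * L powr (- 6)) < m / 2 \<and>
      12 * (C\<^sub>0 * L ^ 4) * exp (- (ln L ^ 3)) < m / 2"
    using C0 m by (intro eventually_conj) real_asymp+
  then obtain L\<^sub>0 where L0: "\<And>L. L \<ge> L\<^sub>0 \<Longrightarrow> L \<ge> 16 \<and> ln L \<ge> 48 \<and> 48 * C\<^sub>0 * L ^ 4 \<ge> 1 \<and> 2 * L powr (- 320) \<le> 1 \<and>
      C\<^sub>0 * L ^ 4 * (exp (- (ln L ^ 3)) + exp (- (L / 6))) + 12 * (C\<^sub>0 * L ^ 4) * exp (- ((ln L)\<^sup>2)) \<le> L powr (- 320) \<and>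
      48 * C\<^sub>0 * L ^ 4 * (2 * L powr (- 6)) < m / 2 \<and>
      12 * (C\<^sub>0 * L ^ 4) * exp (- (ln L ^ 3)) < m / 2"
    unfolding eventually_at_top_linorder by blast
  have main: "\<exists>Y. Y \<in> {T powr ((ln (ln T)) ^ 3 / ln T) .. T powr (5 / ln (ln T))} \<and> norm (prime_sum \<rho> Y) \<ge> (ln T) powr (- 640)"
    if T: "T \<ge> T\<^sub>0" "ln T \<ge> L\<^sub>0" "T \<ge> 40" "ln T \<ge> 16" "ln (ln T) \<ge> 1" and \<rho>: "half_isolated \<rho>" "Im \<rho> \<in> {T..2 * T}" for T \<rho>
  proof (rule ccontr)
    assume neg: "\<not> (\<exists>Y. Y \<in> {T powr ((ln (ln T)) ^ 3 / ln T) .. T powr (5 / ln (ln T))} \<and> norm (prime_sum \<rho> Y) \<ge> (ln T) powr (- 640))"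
    define \<gamma> where "\<gamma> = Im \<rho>"
    define L where "L = ln \<gamma>"
    have \<gamma>: "T \<le> \<gamma>" "\<gamma> \<le> 2 * T" "\<gamma> > 0" using \<rho>(2) T by (auto simp: \<gamma>_def)
    have LT: "ln T \<le> L" unfolding L_def using \<gamma> T by (subst ln_le_cancel_iff) auto
    have LT2: "L \<le> ln T + ln 2"
    proof -
      have "L \<le> ln (2 * T)" unfolding L_def using \<gamma> T by (subst ln_le_cancel_iff) auto
      also have "\<dots> = ln T + ln 2" using T by (simp add: ln_mult)
      finally show ?thesis .
    qed
    have Lc: "L \<ge> 16" "ln L \<ge> 48" "48 * C\<^sub>0 * L ^ 4 \<ge> 1" "2 * L powr (- 320) \<le> 1"
      "C\<^sub>0 * L ^ 4 * (exp (- (ln L ^ 3)) + exp (- (L / 6))) + 12 * (C\<^sub>0 * L ^ 4) * exp (- ((ln L)\<^sup>2)) \<le> L powr (- 320)"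
      "48 * C\<^sub>0 * L ^ 4 * (2 * L powr (- 6)) < m / 2"
      "12 * (C\<^sub>0 * L ^ 4) * exp (- (ln L ^ 3)) < m / 2"
      using L0 [of L] LT T(2) by auto
    obtain Y0 where Y0: "Y0 > 1" "(ln (ln \<bar>Im \<rho>\<bar>)) ^ 3 \<le> ln Y0" "ln Y0 \<le> ln \<bar>Im \<rho>\<bar> / ln (ln \<bar>Im \<rho>\<bar>)" "Y_half_isolated Y0 \<rho>"
      using \<rho>(1) unfolding half_isolated_def by blast
    define lam where "lam = ln Y0"
    have abs\<gamma>: "\<bar>Im \<rho>\<bar> = \<gamma>" using \<gamma> by (simp add: \<gamma>_def)
    have lam: "ln L ^ 3 \<le> lam" "lam \<le> L / ln L"
      using Y0(2,3) unfolding abs\<gamma> lam_def L_def by auto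
    have "1 ^ 3 \<le> ln L ^ 3" using Lc by (intro power_mono) auto
    then have lam1: "lam \<ge> 1" using lam by simp
    have iso: "\<rho> \<in> zeta_zeros" and iso2: "\<And>p. p \<in> zeta_zeros \<Longrightarrow> norm (p - \<rho>) \<le> L\<^sup>2 \<Longrightarrow>
        (\<bar>Re p - Re \<rho>\<bar> \<le> 1 / (10 * lam) \<and> Im p \<ge> Im \<rho>) \<or> Re p \<le> Re \<rho> - (ln L)\<^sup>2 / lam"
      using Y0(4) unfolding Y_half_isolated_def abs\<gamma> lam_def L_def by auto
    have z\<rho>: "zeta \<rho> = 0" using iso by (simp add: zeta_zeros_def)
    have "Im \<rho> \<ge> T\<^sub>0" using \<gamma> T by (simp add: \<gamma>_def)
    from expl [OF z\<rho> this, folded \<gamma>_def L_def] obtain Z where Z: "finite Z" "\<rho> \<in> Z"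
      "\<And>p. p \<in> Z \<Longrightarrow> zeta p = 0 \<and> Im p > 0 \<and> norm (p - \<rho>) \<le> L\<^sup>2" "(\<Sum>p\<in>Z. zmult p) \<le> C\<^sub>0 * L ^ 4"
      and ex: "\<And>u. u \<ge> 0 \<Longrightarrow> norm (prime_sum \<rho> (exp u) + (\<Sum>p\<in>Z. of_real (zmult p) * (mellin (p - \<rho>) * exp ((p - \<rho>) * of_real u))))
        \<le> C\<^sub>0 * L ^ 4 * (exp (- u) + exp (2 * u - L / 3))" by blast
    define Z1 where "Z1 = {p \<in> Z. \<bar>Re p - Re \<rho>\<bar> \<le> 1 / (10 * lam) \<and> Im p \<ge> Im \<rho>}"
    define Z2 where "Z2 = Z - Z1"
    have Z12: "Z = Z1 \<union> Z2" "Z1 \<inter> Z2 = {}" "finite Z1" "finite Z2" using Z(1) by (auto simp: Z1_def Z2_def)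
    have Z2: "Re p \<le> Re \<rho> - (ln L)\<^sup>2 / lam" if "p \<in> Z2" for p
    proof -
      have p: "p \<in> Z" "p \<notin> Z1" using that by (auto simp: Z2_def)
      have "p \<in> zeta_zeros" using Z(3) [OF p(1)] by (auto simp: zeta_zeros_def)
      then show ?thesis using iso2 [of p] Z(3) [OF p(1)] p by (auto simp: Z1_def)
    qed
    have strip: "\<bar>Re (p - \<rho>)\<bar> \<le> 2" if "p \<in> Z" for p
    proof -
      have "0 \<le> Re p" "Re p \<le> 1" using zeta_zero_strip [of p] Z(3) [OF that] by auto
      moreover have "0 \<le> Re \<rho>" "Re \<rho> \<le> 1" using zeta_zero_strip [of \<rho>] Z(3) [OF Z(2)] by auto
      ultimately show ?thesis by auto
    qed
    define t where "t p u = of_real (zmult p) * (mellin (p - \<rho>) * exp ((p - \<rho>) * complex_of_real u))" for p u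
    have small: "norm (\<Sum>p\<in>Z1. t p u) \<le> 2 * L powr (- 320)" if u: "u \<in> {lam..4 * lam}" for u
    proof -
      have u0: "u \<ge> 0" using u lam1 by auto
      have range: "exp u \<in> {T powr ((ln (ln T)) ^ 3 / ln T) .. T powr (5 / ln (ln T))}"
      proof -
        have "T powr ((ln (ln T)) ^ 3 / ln T) = exp (ln (ln T) ^ 3)" using T by (simp add: powr_def)
        moreover have "ln (ln T) ^ 3 \<le> u"
        proof -
          have "ln (ln T) \<le> ln L" using LT T by (subst ln_le_cancel_iff) auto
          then have "ln (ln T) ^ 3 \<le> ln L ^ 3" using T by (intro power_mono) auto
          then show ?thesis using lam u by auto
        qed
        moreover have "T powr (5 / ln (ln T)) = exp (5 * ln T / ln (ln T))" using T by (simp add: powr_def)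
        moreover have "u \<le> 5 * ln T / ln (ln T)"
        proof -
          have "u \<le> 4 * (L / ln L)" using u lam by auto
          also have "\<dots> \<le> 4 * (L / ln (ln T))"
          proof -
            have "ln (ln T) \<le> ln L" using LT T by (subst ln_le_cancel_iff) auto
            then show ?thesis using T Lc by (intro mult_left_mono divide_left_mono) auto
          qed
          also have "4 * (L / ln (ln T)) = 4 * L / ln (ln T)" by simp
          \<comment> \<open>The step from 4 to 5 pays for replacing the height of the zero by
            \<open>T\<close>, as \<open>L \<le> ln T + ln 2\<close>. It is the origin of the
            exponent \<open>5 / ln (ln T)\<close> at the upper end of the range of
            \<open>Y\<close>.\<close>
          also have "4 * L / ln (ln T) \<le> 5 * ln T / ln (ln T)"
            using T LT2 ln_2_less_1 by (intro divide_right_mono) auto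
          finally show ?thesis .
        qed
        ultimately show ?thesis by simp
      qed
      then have "norm (prime_sum \<rho> (exp u)) < ln T powr (- 640)" using neg by (meson not_le)
      \<comment> \<open>A negative power of \<open>ln T\<close> grows when \<open>ln T\<close> is
        replaced by something smaller, and \<open>L\<close> itself may be larger than
        \<open>ln T\<close>. The crude lower bound \<open>sqrt L \<le> L / 2 \<le> ln T\<close>
        costs half of the exponent.\<close>
      also have "\<dots> \<le> (sqrt L) powr (- 640)"
      proof (rule powr_mono2')
        have "L / 2 \<le> ln T" using LT2 T ln_2_less_1 by linarith
        moreover have "(sqrt L)\<^sup>2 \<le> (L / 2)\<^sup>2" using Lc mult_right_mono [of 4 L L] by (simp add: power2_eq_square)
        then have "sqrt L \<le> L / 2" by (rule power2_le_imp_le) (use Lc in auto)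
        ultimately show "sqrt L \<le> ln T" by linarith
      qed (use Lc in auto)
      also have "(sqrt L) powr (- 640) = L powr (- 320)" using Lc by (simp add: powr_half_sqrt [symmetric] powr_powr)
      finally have S: "norm (prime_sum \<rho> (exp u)) \<le> L powr (- 320)" by simp
      have "norm (\<Sum>p\<in>Z2. t p u) \<le> (\<Sum>p\<in>Z2. zmult p * (12 * exp (- ((ln L)\<^sup>2))))"
      proof (rule sum_norm_le)
        fix p assume p: "p \<in> Z2"
        have "(ln L)\<^sup>2 / lam * lam \<le> (ln L)\<^sup>2 / lam * u" using u lam1 by (intro mult_left_mono) auto
        moreover have "Re (p - \<rho>) * u \<le> - ((ln L)\<^sup>2 / lam) * u" using Z2 [OF p] u0 by (intro mult_right_mono) auto
        ultimately have "Re (p - \<rho>) * u \<le> - ((ln L)\<^sup>2)" using lam1 by simp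
        then have "norm (exp ((p - \<rho>) * complex_of_real u)) \<le> exp (- ((ln L)\<^sup>2))" by simp
        moreover have "norm (mellin (p - \<rho>)) \<le> 12" using p by (intro mellin_bound strip) (simp add: Z2_def)
        ultimately show "norm (t p u) \<le> zmult p * (12 * exp (- ((ln L)\<^sup>2)))"
          unfolding t_def norm_mult using zmult_nonneg [of p] by (auto intro!: mult_left_mono mult_mono)
      qed
      also have "\<dots> = (\<Sum>p\<in>Z2. zmult p) * (12 * exp (- ((ln L)\<^sup>2)))" by (simp add: sum_distrib_right)
      also have "\<dots> \<le> (C\<^sub>0 * L ^ 4) * (12 * exp (- ((ln L)\<^sup>2)))"
      proof (rule mult_right_mono)
        have "(\<Sum>p\<in>Z2. zmult p) \<le> (\<Sum>p\<in>Z. zmult p)"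
          using Z by (intro sum_mono2) (auto simp: Z2_def zmult_nonneg)
        then show "(\<Sum>p\<in>Z2. zmult p) \<le> C\<^sub>0 * L ^ 4" using Z(4) by linarith
      qed auto
      finally have S2: "norm (\<Sum>p\<in>Z2. t p u) \<le> 12 * (C\<^sub>0 * L ^ 4) * exp (- ((ln L)\<^sup>2))" by simp
      have "norm (prime_sum \<rho> (exp u) + (\<Sum>p\<in>Z. t p u)) \<le> C\<^sub>0 * L ^ 4 * (exp (- u) + exp (2 * u - L / 3))"
        unfolding t_def by (rule ex [OF u0])
      also have "\<dots> \<le> C\<^sub>0 * L ^ 4 * (exp (- (ln L ^ 3)) + exp (- (L / 6)))"
      proof (intro mult_left_mono add_mono)
        show "exp (- u) \<le> exp (- (ln L ^ 3))" using lam u by auto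
        \<comment> \<open>The requirement \<open>ln L \<ge> 48\<close> is made for this:
          \<open>u \<le> 4 * L / ln L\<close> gives \<open>2 * u \<le> L / 6\<close>, half of the
          available \<open>L / 3\<close>.\<close>
        have "L / ln L \<le> L / 48" using Lc by (intro divide_left_mono) auto
        then have "2 * u \<le> 8 * (L / 48)" using u lam by (simp only: atLeastAtMost_iff) linarith
        then show "exp (2 * u - L / 3) \<le> exp (- (L / 6))" by (subst exp_le_cancel_iff) linarith
      qed (use C0 Lc in auto)
      finally have S3: "norm (prime_sum \<rho> (exp u) + (\<Sum>p\<in>Z. t p u)) \<le> C\<^sub>0 * L ^ 4 * (exp (- (ln L ^ 3)) + exp (- (L / 6)))" .
      have "(\<Sum>p\<in>Z. t p u) = (\<Sum>p\<in>Z1. t p u) + (\<Sum>p\<in>Z2. t p u)"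
        unfolding Z12(1) by (rule sum.union_disjoint) (use Z12 in auto)
      then have "(\<Sum>p\<in>Z1. t p u) = (prime_sum \<rho> (exp u) + (\<Sum>p\<in>Z. t p u)) - prime_sum \<rho> (exp u) - (\<Sum>p\<in>Z2. t p u)"
        by simp
      then have "norm (\<Sum>p\<in>Z1. t p u) \<le> norm (prime_sum \<rho> (exp u) + (\<Sum>p\<in>Z. t p u)) + norm (prime_sum \<rho> (exp u)) + norm (\<Sum>p\<in>Z2. t p u)"
        by (simp only:) (intro order_trans [OF norm_triangle_ineq4] add_mono order_refl)
      then show ?thesis using S S2 S3 Lc(5) by linarith
    qed
    \<comment> \<open>The one-sided bound is used with \<open>N = C\<^sub>0 * L ^ 4\<close>, the
      total multiplicity of the zeros in the explicit formula, with \<open>M = 48 * N\<close>, and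
      with \<open>\<epsilon> = 2 * L powr (- 320)\<close>: one half is for the sum over
      \<open>n\<close>, the other for all error terms together.\<close>
    have "Re (mellin 0) \<le> (48 * (C\<^sub>0 * L ^ 4)) * ((2 * L powr (- 320)) / (48 * (C\<^sub>0 * L ^ 4))) powr (3 / 160) + 12 * (C\<^sub>0 * L ^ 4) * exp (- lam)"
    proof (rule one_sided_exp_sum_lower_bound)
      show "finite Z1" by (rule Z12)
      show "\<rho> \<in> Z1" using Z(2) lam1 by (simp add: Z1_def)
      show "\<bar>Re p - Re \<rho>\<bar> \<le> 1 / (10 * lam) \<and> Im p \<ge> Im \<rho>" if "p \<in> Z1" for p using that by (simp add: Z1_def)
      show "zmult \<rho> \<ge> 1" using zorder_zeta_zero(2) [OF z\<rho>] Z(3) [OF Z(2)] by blast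
      have "(\<Sum>p\<in>Z1. zmult p) \<le> (\<Sum>p\<in>Z. zmult p)"
        using Z by (intro sum_mono2) (auto simp: Z1_def zmult_nonneg)
      then show "(\<Sum>p\<in>Z1. zmult p) \<le> C\<^sub>0 * L ^ 4" using Z(4) by linarith
      show "0 < 2 * L powr (- 320)" using Lc by simp
      show "2 * L powr (- 320) \<le> 48 * (C\<^sub>0 * L ^ 4)" using Lc by simp
      show "norm (\<Sum>p\<in>Z1. of_real (zmult p) * (mellin (p - \<rho>) * exp ((p - \<rho>) * of_real u))) \<le> 2 * L powr (- 320)"
        if "u \<in> {lam..4 * lam}" for u using small [OF that] by (simp only: t_def)
    qed (use lam1 in auto)
    moreover have "((2 * L powr (- 320)) / (48 * (C\<^sub>0 * L ^ 4))) powr (3 / 160) \<le> 2 * L powr (- 6)"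
    proof -
      have "(2 * L powr (- 320)) / (48 * (C\<^sub>0 * L ^ 4)) \<le> (2 * L powr (- 320)) / 1"
        using Lc by (intro divide_left_mono) auto
      then have "((2 * L powr (- 320)) / (48 * (C\<^sub>0 * L ^ 4))) powr (3 / 160) \<le> (2 * L powr (- 320)) powr (3 / 160)"
        using C0 Lc by (intro powr_mono2) auto
      also have "\<dots> = 2 powr (3 / 160) * L powr (- 6)" using Lc by (simp add: powr_mult powr_powr)
      also have "\<dots> \<le> 2 powr 1 * L powr (- 6)" by (intro mult_right_mono powr_mono) auto
      finally show ?thesis by simp
    qed
    then have "(48 * (C\<^sub>0 * L ^ 4)) * ((2 * L powr (- 320)) / (48 * (C\<^sub>0 * L ^ 4))) powr (3 / 160) \<le> (48 * (C\<^sub>0 * L ^ 4)) * (2 * L powr (- 6))"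
      using Lc by (intro mult_left_mono) auto
    moreover have "12 * (C\<^sub>0 * L ^ 4) * exp (- lam) \<le> 12 * (C\<^sub>0 * L ^ 4) * exp (- (ln L ^ 3))"
      using lam C0 Lc by (intro mult_left_mono) auto
    moreover have "(48 * (C\<^sub>0 * L ^ 4)) * (2 * L powr (- 6)) < m / 2" using Lc(6) by (simp add: mult.assoc)
    ultimately show False using Lc(7) unfolding m_def by linarith
  qed
  have "\<forall>\<^sub>F T in at_top. T \<ge> T\<^sub>0 \<and> ln T \<ge> L\<^sub>0 \<and> T \<ge> 40 \<and> ln T \<ge> 16 \<and> ln (ln T) \<ge> (1 :: real)"
    by (intro eventually_conj) real_asymp+
  then have "\<forall>\<^sub>F T in at_top. \<forall>\<rho>\<^sub>0. half_isolated \<rho>\<^sub>0 \<and> Im \<rho>\<^sub>0 \<in> {T..2 * T} \<longrightarrow>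
     (\<exists>Y. Y \<in> {T powr ((ln (ln T)) ^ 3 / ln T) .. T powr (5 / ln (ln T))} \<and> norm (prime_sum \<rho>\<^sub>0 Y) \<ge> (ln T) powr (- 640))"
    by eventually_elim (use main in blast)
  then show ?thesis
    using smooth_bump bump_nonneg bump_support unfolding prime_sum_def
    by (intro exI [of _ 640] exI [of _ bump] conjI) auto
qed

end
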